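(* Under the relaxed definition of a scheme, each of the problems PERFECT-MATCHING (does the graph have a perfect matching?), CONNECTIVITY (is the graph connected?) and NON-BIPARTITENESS (is the graph non-bipartite?) has an $(n\log n+m c_v^{-1/2}\log n\,\log_{c_v} m,\ c_v\log n\,\log_{c_v} m)$-scheme on graphs with $n$ vertices and $m$ edges, for all $c_v>1$. All three schemes work in the strict turnstile update model.
   Context: Graph streams: an $n$-vertex graph is given by a stream of updates $(e,\delta)$ where $e$ is a pair of vertices and $\delta\in\mathbb Z$; in the strict turnstile model the multiplicity of each edge always remains nonnegative; the graph at the end has edge set $E$ consisting of the pairs with positive multiplicity, $|E|=m$. Schemes: a scheme is a pair $(\mathfrak h,V)$. A prover with private randomness $r_P$ supplies after the $i$th stream element an annotation string $\mathfrak h_i(\mathbf x,r_P)$; the verifier $V$ is a streaming algorithm with $w$ bits of memory and private randomness $r_V$ reading the interleaved annotated stream and outputting a value. Its annotation length is $\max\sum_i|\mathfrak h_i|$ and its space is $w$; an $(c_a,c_v)$-scheme has annotation length $O(c_a)$ and space $O(c_v)$. Relaxed definition for a Boolean $F$: (1) for all $\mathbf x$ with $F(\mathbf x)=1$, $\Pr_{r_P,r_V}[\text{output}\ne1]\le1/3$; (2) for all $\mathbf x$ with $F(\mathbf x)=0$ and every annotation sequence $\mathfrak h'$, $\Pr_{r_V}[\text{output}=1]\le1/3$.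
   Formalization: Final edge multiplicities are assumed to be at most n^k for an arbitrary fixed k, with the O-constants depending on k (with unbounded multiplicities the bounds fail already for n = 4); also m ≥ 2 is assumed, since log_{c_v} 1 = 0, and schemes handle all graphs with at most m edges. *)

theory Defs
  imports "HOL-Probability.Probability_Mass_Function"
begin

section \<open>Annotated streams and schemes\<close>

text \<open>The annotation is part of the stream and is read one bit at a time, so a verifier that wants
  to look at an annotation string as a whole has to store it.\<close>

datatype 'a token = Elem 'a | Bit bool

text \<open>\<open>annotated xs a\<close> is the sequence \<open>x\<^sub>0, a\<^sub>0, x\<^sub>1, a\<^sub>1, \<dots>\<close>, where the bit string \<open>a i\<close>
  follows the stream element with index \<open>i\<close> (counting from 0).\<close>

definition annotated :: "'a list \<Rightarrow> (nat \<Rightarrow> bool list) \<Rightarrow> 'a token list" where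
  "annotated xs a = concat (map (\<lambda>i. Elem (xs ! i) # map Bit (a i)) [0..<length xs])"

text \<open>A verifier is a randomized streaming algorithm whose configurations are bit strings. Its
  private randomness consists of the coins tossed in the choice of the initial memory contents and
  in every update of the memory; a coin that is needed again later has to be kept in memory and is
  charged to the space. As usual for streaming space bounds, the transitions are otherwise
  arbitrary (non-uniform). The output \<open>None\<close> stands for ``no value''.\<close>

record 'a verifier =
  initial :: "bool list pmf"
  step :: "bool list \<Rightarrow> 'a token \<Rightarrow> bool list pmf"
  out :: "bool list \<Rightarrow> bool option"

definition verifier_space :: "'a verifier \<Rightarrow> nat \<Rightarrow> bool" where
  "verifier_space V w \<longleftrightarrow>
     (\<forall>s \<in> set_pmf (initial V). length s = w) \<and>
     (\<forall>s t. length s = w \<longrightarrow> (\<forall>s' \<in> set_pmf (step V s t). length s' = w))"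

definition verifier_output :: "'a verifier \<Rightarrow> 'a token list \<Rightarrow> bool option pmf" where
  "verifier_output V ts = map_pmf (out V) (foldl (\<lambda>D t. bind_pmf D (\<lambda>s. step V s t)) (initial V) ts)"

text \<open>\<open>annotation P i xs r\<close> is \<open>\<hh>\<^sub>i(x, r\<^sub>P)\<close>; it may depend on the entire stream. The randomness
  \<open>r\<^sub>P\<close> ranges over \<open>nat\<close>, which is no restriction because a \<open>pmf\<close> has countable support.\<close>

record 'a prover =
  coins :: "nat pmf"
  annotation :: "nat \<Rightarrow> 'a list \<Rightarrow> nat \<Rightarrow> bool list"

definition honest_output :: "'a prover \<Rightarrow> 'a verifier \<Rightarrow> 'a list \<Rightarrow> bool option pmf" where
  "honest_output P V xs =
     bind_pmf (coins P) (\<lambda>r. verifier_output V (annotated xs (\<lambda>i. annotation P i xs r)))"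

definition annotation_length_le :: "'a list set \<Rightarrow> 'a prover \<Rightarrow> real \<Rightarrow> bool" where
  "annotation_length_le X P l \<longleftrightarrow>
     (\<forall>xs \<in> X. \<forall>r \<in> set_pmf (coins P).
        real (\<Sum>i<length xs. length (annotation P i xs r)) \<le> l)"

text \<open>The relaxed definition of a scheme for a Boolean function \<open>F\<close> on the set \<open>X\<close> of input streams.
  A dishonest annotation may depend on the input but not on the coins of the verifier.\<close>

definition relaxed_scheme ::
  "'a list set \<Rightarrow> ('a list \<Rightarrow> bool) \<Rightarrow> 'a prover \<Rightarrow> 'a verifier \<Rightarrow> bool" where
  "relaxed_scheme X F P V \<longleftrightarrow>
     (\<forall>xs \<in> X. F xs \<longrightarrow>
        measure_pmf.prob (honest_output P V xs) {v. v \<noteq> Some True} \<le> 1/3) \<and>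
     (\<forall>xs \<in> X. \<not> F xs \<longrightarrow>
        (\<forall>a. measure_pmf.prob (verifier_output V (annotated xs a)) {v. v = Some True} \<le> 1/3))"

definition has_relaxed_scheme ::
  "'a list set \<Rightarrow> ('a list \<Rightarrow> bool) \<Rightarrow> real \<Rightarrow> real \<Rightarrow> bool" where
  "has_relaxed_scheme X F l s \<longleftrightarrow>
     (\<exists>P V w. relaxed_scheme X F P V \<and> annotation_length_le X P l \<and>
        verifier_space V w \<and> real w \<le> s)"

section \<open>Graph streams\<close>

text \<open>The vertices are \<open>0, \<dots>, n - 1\<close> and an edge is a set of two distinct vertices.\<close>

type_synonym update = "nat set \<times> int"

definition edge_mult :: "update list \<Rightarrow> nat set \<Rightarrow> int" where
  "edge_mult xs e = (\<Sum>(e', \<delta>)\<leftarrow>xs. if e' = e then \<delta> else 0)"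

definition stream_edges :: "update list \<Rightarrow> nat set set" where
  "stream_edges xs = {e. edge_mult xs e > 0}"

definition strict_turnstile :: "nat \<Rightarrow> update list \<Rightarrow> bool" where
  "strict_turnstile n xs \<longleftrightarrow>
     (\<forall>(e, \<delta>) \<in> set xs. e \<subseteq> {..<n} \<and> card e = 2) \<and>
     (\<forall>i \<le> length xs. \<forall>e. edge_mult (take i xs) e \<ge> 0)"

text \<open>The streams of graphs with \<open>n\<close> vertices and at most \<open>m\<close> edges. The bound \<open>b\<close> on the final
  multiplicities makes explicit the convention that they are polynomial in \<open>n\<close>, so that a
  multiplicity takes \<open>O(log n)\<close> bits. There is no bound on the length of the stream, on the
  individual updates, or on the multiplicities before the end of the stream.\<close>

definition graph_streams :: "nat \<Rightarrow> nat \<Rightarrow> nat \<Rightarrow> update list set" where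
  "graph_streams n m b =
     {xs. strict_turnstile n xs \<and> card (stream_edges xs) \<le> m \<and> (\<forall>e. edge_mult xs e \<le> int b)}"

section \<open>Graph problems\<close>

definition has_perfect_matching :: "nat set \<Rightarrow> nat set set \<Rightarrow> bool" where
  "has_perfect_matching V E \<longleftrightarrow> (\<exists>M \<subseteq> E. \<forall>v \<in> V. \<exists>!e. e \<in> M \<and> v \<in> e)"

definition connected_graph :: "nat set \<Rightarrow> nat set set \<Rightarrow> bool" where
  "connected_graph V E \<longleftrightarrow> (\<forall>u \<in> V. \<forall>v \<in> V. (u, v) \<in> {(x, y). {x, y} \<in> E}\<^sup>*)"

definition bipartite :: "nat set \<Rightarrow> nat set set \<Rightarrow> bool" where
  "bipartite V E \<longleftrightarrow> (\<exists>A \<subseteq> V. \<forall>e \<in> E. \<exists>u \<in> A. \<exists>v \<in> V - A. e = {u, v})"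

definition non_bipartite :: "nat set \<Rightarrow> nat set set \<Rightarrow> bool" where
  "non_bipartite V E \<longleftrightarrow> \<not> bipartite V E"

end

theory Submission
  imports Defs "HOL-Computational_Algebra.Computational_Algebra" "HOL-Number_Theory.Cong"
begin

text \<open>To prove a property of the graph, the prover lists at most \<open>2n\<close> edges: a perfect matching, a walk
  that visits all vertices, or an odd closed walk. The difficulty is to convince the verifier that every
  listed edge \<open>e\<close> has positive multiplicity. The prover knows the whole stream and announces, at its
  start, \<open>L = O(log\<^sub>q m)\<close> hash functions into \<open>O(m q)\<close> buckets, where \<open>q\<close> is about the square root of
  \<open>c\<^sub>v\<close>. For a suitable choice, each of them isolates from the other edges of the graph all but a
  fraction \<open>1/q\<close> of the edges not isolated so far, so that every edge is isolated by one of them. The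
  claim that the bucket of \<open>e\<close> contains \<open>g > 0\<close> copies of \<open>e\<close> and nothing else means that
  \<open>\<Sum> f(x) (x - e)\<^sup>2 + (\<Sum> f(x) - g)\<^sup>2\<close> vanishes, with both sums over the bucket. Since multiplicities
  are nonnegative in the strict turnstile model, all claims hold as soon as these integers add up to 0,
  and they are small enough to compute modulo a prime \<open>p\<close> polynomial in \<open>n\<close>.

  The buckets are arranged in \<open>H = O(m/q)\<close> rows and \<open>q\<^sup>2\<close> columns. Extending each column to a polynomial
  of degree less than \<open>H\<close>, the sum becomes the sum over the rows of a single polynomial of degree less than
  \<open>3H\<close>, the coefficients of which the prover sends. The verifier keeps the value of every column at one
  random point, which is enough to check these coefficients.\<close>

section \<open>Primes of polynomial size\<close>

text \<open>Soundness does not rest on the hash functions: a false claim has positive defect for any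
  seeds. Hence the prover may choose them, the only coin of the verifier is the random point
  \<gamma>, and the honest prover always succeeds. The defects can be added without random weights
  because they are nonnegative integers with total below \<open>p\<close>.

  Expanding the squares separates the stream from the claims: what is needed of a bucket are the
  moments \<open>\<Sum> f(x) x^j\<close> for \<open>j < 3\<close>, which are linear in the stream
  and can be maintained before any claim is known. The mass of the bucket occurs squared and
  multiplied by a polynomial of the claims; these three factors are the origin of \<open>3H\<close>.

  A wrong acceptance requires \<gamma> to be a root of a fixed polynomial of degree at most
  \<open>n\<close> or \<open>3H\<close> that is nonzero modulo \<open>p\<close>. As all checks must
  pass, it suffices to count the roots for one failing check, and \<open>9H \<le> p\<close> and
  \<open>4n < p\<close> keep them below a third of the points.

  The number \<open>4mq\<close> of buckets makes the expected fraction of edges that are not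
  isolated at most \<open>1/q\<close>. Splitting it into about \<open>4m/q\<close> rows and
  \<open>q^2\<close> columns gives the two sides of the tradeoff.\<close>

lemma Suc_div_nat: "d > 0 \<Longrightarrow> Suc n div d = n div d + (if d dvd Suc n then 1 else 0)"
  by (simp add: div_Suc dvd_eq_mod_eq_0)

text \<open>Any range up to some \<open>N \<ge> n\<close> will do, so that one range serves all
  factors of a factorial.\<close>

lemma multiplicity_eq_card_powers:
  fixes p :: nat
  assumes "prime p" "0 < n" "n \<le> N"
  shows "multiplicity p n = card {i \<in> {1..N}. p ^ i dvd n}"
proof -
  have "p ^ i dvd n \<longleftrightarrow> i \<le> multiplicity p n" for i
    using assms by (intro power_dvd_iff_le_multiplicity) auto
  moreover have "multiplicity p n \<le> N"
  proof -
    have "multiplicity p n < p ^ multiplicity p n" using prime_gt_1_nat[OF assms(1)] unfolding One_nat_def by (rule power_gt_expt)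
    also have "\<dots> \<le> n" using assms multiplicity_dvd[of p n] dvd_imp_le by blast
    finally show ?thesis using assms by simp
  qed
  ultimately have "i \<in> {1..N} \<and> p ^ i dvd n \<longleftrightarrow> i \<in> {1..multiplicity p n}" for i
    unfolding atLeastAtMost_iff using le_trans by blast
  hence "{i \<in> {1..N}. p ^ i dvd n} = {1..multiplicity p n}" by blast
  thus ?thesis by simp
qed

text \<open>Legendre's formula. Passing to \<open>Suc n\<close> raises exactly the quotients by
  those powers of \<open>p\<close> that divide \<open>Suc n\<close>.\<close>

lemma multiplicity_fact_eq_sum:
  fixes p :: nat
  assumes "prime p" "n \<le> N"
  shows "multiplicity p (fact n) = (\<Sum>i=1..N. n div p ^ i)"
  using assms(2)
proof (induction n)
  case (Suc n)
  have "multiplicity p (fact (Suc n)) = multiplicity p (Suc n) + multiplicity p (fact n)"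
    using assms(1) by (simp add: prime_elem_multiplicity_mult_distrib del: mult_Suc)
  also have "multiplicity p (Suc n) = (\<Sum>i=1..N. if p ^ i dvd Suc n then 1 else 0)"
    using Suc.prems assms(1) by (subst multiplicity_eq_card_powers[of p _ N]) (auto simp: sum.If_cases Int_def)
  also have "multiplicity p (fact n) = (\<Sum>i=1..N. n div p ^ i)" using Suc by simp
  also have "(\<Sum>i=1..N. if p ^ i dvd Suc n then 1 else 0) + (\<Sum>i=1..N. n div p ^ i)
     = (\<Sum>i=1..N. Suc n div p ^ i)"
    unfolding sum.distrib[symmetric] using prime_gt_0_nat[OF assms(1)]
    by (intro sum.cong) (auto simp: Suc_div_nat)
  finally show ?case .
qed simp

text \<open>By Legendre's formula the exponent is a sum of terms
  \<open>(2*n) div p ^ i - 2 * (n div p ^ i)\<close>. Each is 0 or 1, and it is 0 once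
  \<open>p ^ i > 2 * n\<close>.\<close>

lemma prime_power_central_binomial_le:
  fixes p :: nat
  assumes "prime p" "n > 0"
  shows "p ^ multiplicity p ((2*n) choose n) \<le> 2 * n"
proof -
  have p1: "p > 1" using assms prime_gt_1_nat by blast
  define N where "N = 2 * n"
  have "fact n * fact n * ((2*n) choose n) = (fact (2*n) :: nat)"
    using binomial_fact_lemma[of n "2*n"] by simp
  hence "multiplicity p (fact (2*n)) = 2 * multiplicity p (fact n) + multiplicity p ((2*n) choose n)"
    using assms by (metis prime_elem_multiplicity_mult_distrib fact_nonzero mult_2 mult_eq_0_iff prime_imp_prime_elem
      binomial_eq_0_iff not_less mult_2 le_add1)
  hence "multiplicity p ((2*n) choose n) = (\<Sum>i=1..N. (2*n) div p ^ i) - 2 * (\<Sum>i=1..N. n div p ^ i)"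
    using multiplicity_fact_eq_sum[OF assms(1), of "2*n" N] multiplicity_fact_eq_sum[OF assms(1), of n N]
    by (simp add: N_def)
  also have "\<dots> = (\<Sum>i=1..N. (2*n) div p ^ i - 2 * (n div p ^ i))"
    unfolding sum_distrib_left by (rule sum_subtractf_nat[symmetric]) (metis div_times_less_eq_dividend mult.commute less_eq_div_iff_mult_less_eq p1 zero_less_power less_trans zero_less_one nat_mult_le_cancel_disj mult.left_commute)
  also have "\<dots> \<le> (\<Sum>i=1..N. if p ^ i \<le> 2 * n then 1 else 0)"
  proof (rule sum_mono)
    fix i
    have d: "p ^ i > 0" using p1 by simp
    have "(2*n) div p^i \<le> 2 * (n div p^i) + 1"
    proof -
      have "2 * n < (2 * (n div p^i) + 2) * p^i"
      proof -
        have "n = n div p^i * p^i + n mod p^i" by (rule div_mult_mod_eq[symmetric])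
        thus ?thesis using mod_less_divisor[OF d, of n] unfolding distrib_right mult.assoc by linarith
      qed
      hence "(2*n) div p^i < 2 * (n div p^i) + 2" using d by (simp add: div_less_iff_less_mult)
      thus ?thesis by simp
    qed
    thus "(2*n) div p ^ i - 2 * (n div p ^ i) \<le> (if p ^ i \<le> 2 * n then 1 else 0)" by auto
  qed
  also have "\<dots> = card {i \<in> {1..N}. p ^ i \<le> 2 * n}" by (simp add: sum.If_cases Int_def)
  finally have le: "multiplicity p ((2*n) choose n) \<le> card {i \<in> {1..N}. p ^ i \<le> 2 * n}" .
  define k where "k = multiplicity p ((2*n) choose n)"
  show ?thesis
  proof (rule ccontr)
    assume "\<not> ?thesis"
    hence k: "p ^ k > 2 * n" by (simp add: k_def)
    have "{i \<in> {1..N}. p ^ i \<le> 2 * n} \<subseteq> {1..<k}"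
    proof safe
      fix i assume "p ^ i \<le> 2 * n" "i \<in> {1..N}"
      hence "p ^ i < p ^ k" using k by simp
      thus "i \<in> {1..<k}" using p1 \<open>i \<in> {1..N}\<close> by simp
    qed
    hence "card {i \<in> {1..N}. p ^ i \<le> 2 * n} \<le> k - 1"
      using card_mono[of "{1..<k}"] by (metis card_atLeastLessThan finite_atLeastLessThan)
    moreover have "k > 0" using k assms by (cases k) auto
    ultimately show False using le by (simp add: k_def)
  qed
qed

text \<open>The central coefficient is the largest of the \<open>2*n+1\<close> entries of its
  row.\<close>

lemma four_power_le_central_binomial: "4 ^ n \<le> (2*n+1) * ((2*n) choose n)"
proof -
  have "4 ^ n = (\<Sum>k\<le>2*n. (2*n) choose k)" using choose_row_sum[of "2*n"] by (simp add: power_mult)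
  also have "\<dots> \<le> (\<Sum>k\<le>2*n. (2*n) choose n)" by (intro sum_mono binomial_maximum') 
  finally show ?thesis by simp
qed

text \<open>A weak form of Chebyshev's bound: if all prime factors of the central binomial coefficient
  were at most \<open>N\<close>, it would be at most \<open>(2 N\<^sup>2)\<^sup>N\<close>, which is less than \<open>4\<^bsup>N\<^sup>2\<^esup>\<close> up to a linear factor.\<close>

lemma ex_prime_between:
  fixes N :: nat
  assumes "N \<ge> 16"
  shows "\<exists>p. prime p \<and> N < p \<and> p \<le> 2 * N ^ 2"
proof (rule ccontr)
  assume no: "\<not> ?thesis"
  define n where "n = N ^ 2"
  define B where "B = (2*n) choose n"
  have n0: "n > 0" and B0: "B > 0" using assms by (auto simp: n_def B_def)
  have pf: "prime_factors B \<subseteq> {1..N}"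
  proof
    fix p assume p: "p \<in> prime_factors B"
    hence pp: "prime p" "p dvd B" by auto
    have "p \<le> p ^ multiplicity p B"
      using p prime_factors_multiplicity[of B] by (intro self_le_power) (auto simp: prime_ge_Suc_0_nat)
    also have "\<dots> \<le> 2 * N ^ 2" using prime_power_central_binomial_le[OF pp(1) n0] by (simp add: B_def n_def)
    finally show "p \<in> {1..N}" using no pp prime_gt_0_nat[of p] by (auto simp: not_less Suc_le_eq)
  qed
  have "B = (\<Prod>p\<in>prime_factors B. p ^ multiplicity p B)" using B0 by (rule prime_factorization_nat)
  also have "\<dots> \<le> (\<Prod>p\<in>prime_factors B. 2 * n)"
    using prime_power_central_binomial_le[OF _ n0] by (intro prod_mono) (auto simp: B_def)
  also have "\<dots> \<le> (2*n) ^ N"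
    unfolding prod_constant using card_mono[OF _ pf] n0 by (intro power_increasing) auto
  finally have "4 ^ n \<le> (2*n+1) * (2*n) ^ N"
    using four_power_le_central_binomial[of n] by (metis B_def le_trans mult_le_mono2)
  also have "\<dots> \<le> (2*n+1) * (2*n+1) ^ N" by (intro mult_le_mono2 power_mono) auto
  also have "\<dots> = (2*n+1) ^ Suc N" by (simp only: power_Suc)
  finally have *: "4 ^ n \<le> (2*n+1) ^ Suc N" .
  \<comment> \<open>With \<open>j\<close> the binary logarithm of \<open>N\<close>, only exponents
    of 2 have to be compared: \<open>2*n+1\<close> is below \<open>2 ^ (2*j+4)\<close>, and
    \<open>4 * j \<le> N\<close> makes the total exponent at most \<open>2*n\<close>.\<close>
  obtain j where j: "N \<ge> 2 ^ j" "N < 2 ^ Suc j" 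
    using ex_power_ivl1[of 2 N] assms by auto
  have j4: "j \<ge> 4"
  proof (rule ccontr)
    assume "\<not> j \<ge> 4"
    hence "(2::nat) ^ Suc j \<le> 2 ^ 4" by (intro power_increasing) auto
    thus False using j assms by simp
  qed
  have jN: "4 * j \<le> N"
  proof -
    have "4 * j \<le> 2 ^ j" using j4 by (induction j rule: dec_induct) simp_all
    thus ?thesis using j by simp
  qed
  have "2 * n + 1 \<le> 2 * n + n" using n0 by simp
  also have "\<dots> \<le> 4 * N ^ 2" by (simp add: n_def)
  also have "\<dots> < 4 * (2 ^ Suc j) ^ 2" using j by (intro mult_strict_left_mono power_strict_mono) auto
  also have "\<dots> = 2 ^ (2 * j + 4)" by (simp add: power_add power_even_eq power_mult_distrib)
  finally have "(2*n+1) ^ Suc N < (2 ^ (2 * j + 4)) ^ Suc N" by (rule power_strict_mono) simp_all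
  also have "\<dots> = 2 ^ ((2*j+4) * Suc N)" by (rule power_mult[symmetric])
  also have "\<dots> \<le> 2 ^ (2 * n)"
  proof (rule power_increasing)
    have "(2*j+4) * Suc N \<le> N * (2 * N)"
    proof -
      have "2 * ((2*j+4) * Suc N) \<le> (N + 8) * Suc N" using jN by (simp only: mult.assoc[symmetric], intro mult_le_mono1) simp
      also have "\<dots> = N * N + 9 * N + 8" by (simp add: algebra_simps)
      also have "\<dots> \<le> N * N + 10 * N" using assms by simp
      also have "\<dots> \<le> N * N + N * N" using assms by simp
      finally show ?thesis by (simp add: algebra_simps)
    qed
    thus "(2*j+4) * Suc N \<le> 2 * n" by (simp add: n_def power2_eq_square algebra_simps)
  qed simp
  also have "\<dots> = 4 ^ n" by (simp add: power_mult)
  finally show False using * by (meson leD)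
qed

section \<open>Verifiers from summaries\<close>

lemma ex_inj_bit_strings:
  assumes "finite X" "card X \<le> 2 ^ w"
  shows "\<exists>f :: 'a \<Rightarrow> bool list. inj_on f X \<and> (\<forall>x. length (f x) = w)"
proof -
  define B where "B = {l :: bool list. length l = w}"
  have fB: "finite B" and cB: "card B = 2 ^ w"
    using finite_lists_length_eq[of "UNIV :: bool set" w] card_lists_length_eq[of "UNIV :: bool set" w]
    by (auto simp: B_def)
  then obtain f where f: "f ` X \<subseteq> B" "inj_on f X"
    using card_le_inj[OF assms(1) fB] assms(2) by auto
  let ?g = "\<lambda>x. if x \<in> X then f x else replicate w False"
  have "inj_on ?g X \<and> (\<forall>x. length (?g x) = w)"
    using f by (auto simp: inj_on_def B_def)
  thus ?thesis by blast
qed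

text \<open>Bit strings that encode nothing also decode to an element of \<open>X\<close>, so that
  every dishonest annotation is read as a sequence of residues.\<close>

lemma ex_bit_decoder:
  assumes "finite X" "X \<noteq> {}" "card X \<le> 2 ^ w"
  shows "\<exists>(enc :: 'a \<Rightarrow> bool list) dec. (\<forall>x. length (enc x) = w) \<and> (\<forall>x\<in>X. dec (enc x) = x) \<and> (\<forall>b. dec b \<in> X)"
proof -
  obtain f :: "'a \<Rightarrow> bool list" where f: "inj_on f X" "\<forall>x. length (f x) = w"
    using ex_inj_bit_strings[OF assms(1,3)] by blast
  define d where "d b = (if b \<in> f ` X then inv_into X f b else (SOME x. x \<in> X))" for b
  have "d (f x) = x" if "x \<in> X" for x using f(1) that by (simp add: d_def)
  moreover have "d b \<in> X" for b
  proof (cases "b \<in> f ` X")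
    case True
    thus ?thesis by (simp add: d_def inv_into_into)
  next
    case False
    have "(SOME x. x \<in> X) \<in> X" using assms(2) by (rule some_in_eq[THEN iffD2])
    thus ?thesis using False by (simp add: d_def)
  qed
  ultimately show ?thesis using f(2) by (intro exI[of _ f] exI[of _ d]) simp
qed

text \<open>A streaming algorithm that tosses all its coins at the start is determined, up to the coding
  of its configurations, by what it remembers: a summary \<open>\<sigma> \<gamma> ts\<close> of its coins \<open>\<gamma>\<close> and of the
  tokens read so far, which must determine the summary after one more token.\<close>

lemma verifier_of_summary:
  fixes \<sigma> :: "'c \<Rightarrow> 'a token list \<Rightarrow> 's"
  assumes R: "finite R" "R \<noteq> {}"
    and X: "finite X" "card X \<le> 2 ^ w" "\<And>\<gamma> ts. \<gamma> \<in> R \<Longrightarrow> \<sigma> \<gamma> ts \<in> X"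
    and snoc: "\<And>\<gamma> \<gamma>' ts ts' t. \<gamma> \<in> R \<Longrightarrow> \<gamma>' \<in> R \<Longrightarrow> \<sigma> \<gamma> ts = \<sigma> \<gamma>' ts' \<Longrightarrow> \<sigma> \<gamma> (ts @ [t]) = \<sigma> \<gamma>' (ts' @ [t])"
  shows "\<exists>V. verifier_space V w \<and>
    (\<forall>ts. verifier_output V ts = map_pmf (\<lambda>\<gamma>. accept (\<sigma> \<gamma> ts)) (pmf_of_set R))"
proof -
  obtain enc :: "'s \<Rightarrow> bool list" where enc: "inj_on enc X" "\<And>x. length (enc x) = w"
    using ex_inj_bit_strings[OF X(1,2)] by blast
  \<comment> \<open>By the assumption \<open>snoc\<close> the chosen value does not depend on the
    representative. Strings that code no summary stay put, which preserves the length
    \<open>w\<close>.\<close>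
  define nxt where "nxt s t = (if \<exists>\<gamma>\<in>R. \<exists>ts. s = enc (\<sigma> \<gamma> ts)
     then enc (SOME x. \<exists>\<gamma>\<in>R. \<exists>ts. s = enc (\<sigma> \<gamma> ts) \<and> x = \<sigma> \<gamma> (ts @ [t])) else s)" for s t
  define V where "V = \<lparr>initial = map_pmf (\<lambda>\<gamma>. enc (\<sigma> \<gamma> [])) (pmf_of_set R),
     step = (\<lambda>s t. return_pmf (nxt s t)), out = (\<lambda>s. accept (inv_into X enc s))\<rparr>"
  have nxt: "nxt (enc (\<sigma> \<gamma> ts)) t = enc (\<sigma> \<gamma> (ts @ [t]))" if "\<gamma> \<in> R" for \<gamma> ts t
  proof -
    have "(SOME x. \<exists>\<gamma>'\<in>R. \<exists>ts'. enc (\<sigma> \<gamma> ts) = enc (\<sigma> \<gamma>' ts') \<and> x = \<sigma> \<gamma>' (ts' @ [t])) = \<sigma> \<gamma> (ts @ [t])"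
    proof (rule someI2[of _ "\<sigma> \<gamma> (ts @ [t])"])
      fix x assume "\<exists>\<gamma>'\<in>R. \<exists>ts'. enc (\<sigma> \<gamma> ts) = enc (\<sigma> \<gamma>' ts') \<and> x = \<sigma> \<gamma>' (ts' @ [t])"
      then obtain \<gamma>' ts' where *: "\<gamma>' \<in> R" "enc (\<sigma> \<gamma> ts) = enc (\<sigma> \<gamma>' ts')" "x = \<sigma> \<gamma>' (ts' @ [t])" by blast
      hence "\<sigma> \<gamma> ts = \<sigma> \<gamma>' ts'" using enc(1) X(3) that by (auto simp: inj_on_def)
      thus "x = \<sigma> \<gamma> (ts @ [t])" using snoc[OF that *(1)] *(3) by simp
    qed (use that in blast)
    thus ?thesis using that by (auto simp: nxt_def)
  qed
  have len: "length (nxt s t) = w" if "length s = w" for s t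
    using that enc(2) by (auto simp: nxt_def)
  have "verifier_space V w" using enc(2) len by (auto simp: verifier_space_def V_def)
  moreover have "verifier_output V ts = map_pmf (\<lambda>\<gamma>. accept (\<sigma> \<gamma> ts)) (pmf_of_set R)" for ts
  proof -
    have "foldl (\<lambda>D t. bind_pmf D (\<lambda>s. step V s t)) (initial V) ts = map_pmf (\<lambda>\<gamma>. enc (\<sigma> \<gamma> ts)) (pmf_of_set R)"
    proof (induction ts rule: rev_induct)
      case Nil
      show ?case by (simp add: V_def)
    next
      case (snoc t ts)
      have "bind_pmf (map_pmf (\<lambda>\<gamma>. enc (\<sigma> \<gamma> ts)) (pmf_of_set R)) (\<lambda>s. step V s t)
         = map_pmf (\<lambda>\<gamma>. nxt (enc (\<sigma> \<gamma> ts)) t) (pmf_of_set R)"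
        by (simp add: V_def map_pmf_def bind_assoc_pmf bind_return_pmf)
      also have "\<dots> = map_pmf (\<lambda>\<gamma>. enc (\<sigma> \<gamma> (ts @ [t]))) (pmf_of_set R)"
        using R by (intro map_pmf_cong refl nxt) auto
      finally show ?case using snoc by simp
    qed
    moreover have "map_pmf (\<lambda>\<gamma>. accept (inv_into X enc (enc (\<sigma> \<gamma> ts)))) (pmf_of_set R)
      = map_pmf (\<lambda>\<gamma>. accept (\<sigma> \<gamma> ts)) (pmf_of_set R)"
      using R X(3) enc(1) by (intro map_pmf_cong refl) auto
    ultimately show ?thesis by (simp add: verifier_output_def V_def map_pmf_comp)
  qed
  ultimately show ?thesis by blast
qed

text \<open>The annotation is read in words of \<open>W\<close> bits. A word may be interrupted by stream elements.\<close>

definition scan_step :: "nat \<Rightarrow> (bool list \<Rightarrow> 'w) \<Rightarrow> bool list \<times> ('a + 'w) list \<Rightarrow> 'a token \<Rightarrow> bool list \<times> ('a + 'w) list" where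
  "scan_step W dec = (\<lambda>(buf, ms) t. case t of
     Elem u \<Rightarrow> (buf, ms @ [Inl u])
   | Bit b \<Rightarrow> if length (buf @ [b]) < W then (buf @ [b], ms) else ([], ms @ [Inr (dec (buf @ [b]))]))"

definition scan :: "nat \<Rightarrow> (bool list \<Rightarrow> 'w) \<Rightarrow> 'a token list \<Rightarrow> bool list \<times> ('a + 'w) list" where
  "scan W dec ts = foldl (scan_step W dec) ([], []) ts"

definition lefts :: "('a + 'w) list \<Rightarrow> 'a list" where
  "lefts ms = concat (map (\<lambda>t. case t of Inl u \<Rightarrow> [u] | Inr _ \<Rightarrow> []) ms)"

definition rights :: "('a + 'w) list \<Rightarrow> 'w list" where
  "rights ms = concat (map (\<lambda>t. case t of Inl _ \<Rightarrow> [] | Inr k \<Rightarrow> [k]) ms)"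

lemma lefts_simps [simp]:
  "lefts [] = []" "lefts (Inl u # ms) = u # lefts ms" "lefts (Inr k # ms) = lefts ms"
  "lefts (ms @ ms') = lefts ms @ lefts ms'" "lefts (map Inl us) = us" "lefts (map Inr ks) = []"
proof -
  show "lefts (map Inl us) = us" by (induction us) (auto simp: lefts_def)
  show "lefts (map Inr ks) = []" by (induction ks) (auto simp: lefts_def)
qed (auto simp: lefts_def)

lemma rights_simps [simp]:
  "rights [] = []" "rights (Inl u # ms) = rights ms" "rights (Inr k # ms) = k # rights ms"
  "rights (ms @ ms') = rights ms @ rights ms'" "rights (map Inl us) = []" "rights (map Inr ks) = ks"
proof -
  show "rights (map Inl us) = []" by (induction us) (auto simp: rights_def)
  show "rights (map Inr ks) = ks" by (induction ks) (auto simp: rights_def)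
qed (auto simp: rights_def)

lemma scan_snoc: "scan W dec (ts @ [t]) = scan_step W dec (scan W dec ts) t"
  by (simp add: scan_def)

lemma length_buffer_scan: "W > 0 \<Longrightarrow> length (fst (scan W dec ts)) < W"
  by (induction ts rule: rev_induct) (auto simp: scan_snoc scan_def scan_step_def split: token.splits prod.splits)

lemma lefts_scan: "lefts (snd (scan W dec ts)) = concat (map (\<lambda>t. case t of Elem u \<Rightarrow> [u] | Bit _ \<Rightarrow> []) ts)"
  by (induction ts rule: rev_induct) (auto simp: scan_snoc scan_def scan_step_def split: token.splits prod.splits)

text \<open>Annotation bits never produce stream elements, so even a dishonest prover cannot change
  the stream that the verifier sees.\<close>

lemma lefts_scan_annotated: "lefts (snd (scan W dec (annotated xs a))) = xs"
proof -
  have "concat (map (\<lambda>t. case t of Elem u \<Rightarrow> [u] | Bit _ \<Rightarrow> []) (map Bit bs)) = []" for bs :: "bool list"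
    by (induction bs) auto
  hence "concat (map (\<lambda>t. case t of Elem u \<Rightarrow> [u] | Bit _ \<Rightarrow> []) (concat (map (\<lambda>i. Elem (xs ! i) # map Bit (a i)) is)))
     = map ((!) xs) is" for "is"
    by (induction "is") auto
  thus ?thesis by (simp add: lefts_scan annotated_def map_nth)
qed

lemma foldl_scan_step_bits:
  assumes "length buf + length bs = W" "bs \<noteq> []"
  shows "foldl (scan_step W dec) (buf, ms) (map Bit bs) = ([], ms @ [Inr (dec (buf @ bs))])"
  using assms
proof (induction bs arbitrary: buf)
  case (Cons b bs)
  show ?case
  proof (cases "bs = []")
    case False
    hence "length (buf @ [b]) < W" using Cons.prems by (cases bs) auto
    thus ?thesis using Cons.IH[of "buf @ [b]"] Cons.prems False by (simp add: scan_step_def)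
  qed (use Cons.prems in \<open>auto simp: scan_step_def\<close>)
qed simp

lemma foldl_scan_step_words:
  assumes "W > 0" "\<And>x. length (enc x) = W" "\<And>x. x \<in> set ks \<Longrightarrow> dec (enc x) = x"
  shows "foldl (scan_step W dec) ([], ms) (map Bit (concat (map enc ks))) = ([], ms @ map Inr ks)"
  using assms(3)
proof (induction ks arbitrary: ms)
  case (Cons k ks)
  have "enc k \<noteq> []" using assms(1) assms(2)[of k] by auto
  thus ?case using Cons foldl_scan_step_bits[where buf = "[]" and bs = "enc k" and W = W and dec = dec and ms = ms] assms(2) by simp
qed simp

lemma foldl_scan_step_elems:
  "foldl (scan_step W dec) (buf, ms) (map Elem us) = (buf, ms @ map Inl us)"
  by (induction us arbitrary: ms) (auto simp: scan_step_def)

text \<open>The honest prover sends \<open>a\<close> after the first and \<open>b\<close> after the last of \<open>N\<close> stream elements; these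
  two elements may coincide.\<close>

definition front_back :: "nat \<Rightarrow> bool list \<Rightarrow> bool list \<Rightarrow> nat \<Rightarrow> bool list" where
  "front_back N a b i = (if i = 0 then a else []) @ (if Suc i = N then b else [])"

lemma annotated_front_back:
  assumes "xs \<noteq> []"
  shows "annotated xs (front_back (length xs) a b) =
    Elem (hd xs) # map Bit a @ map Elem (tl xs) @ map Bit b"
proof -
  obtain x ys where xs: "xs = x # ys" using assms by (cases xs) auto
  have gen: "concat (map (\<lambda>i. Elem (zs ! i) # map Bit (if Suc i = length zs then b else [])) [0..<length zs])
    = map Elem zs @ map Bit b" if "zs \<noteq> []" for zs :: "'a list"
  proof -
    obtain us z where zs: "zs = us @ [z]" using \<open>zs \<noteq> []\<close> by (cases zs rule: rev_cases) auto
    have "concat (map (\<lambda>i. Elem (zs ! i) # map Bit (if Suc i = length zs then b else [])) [0..<length us]) = 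
      concat (map (\<lambda>i. [Elem (us ! i)]) [0..<length us])"
      by (intro arg_cong[of _ _ concat] map_cong) (auto simp: zs nth_append)
    also have "\<dots> = map (\<lambda>i. Elem (us ! i)) [0..<length us]" by (rule concat_map_singleton)
    also have "\<dots> = map Elem us" by (rule nth_equalityI) auto
    finally show ?thesis by (simp add: zs)
  qed
  have "concat (map (\<lambda>i. Elem (xs ! i) # map Bit (front_back (length xs) a b i)) [0..<length xs])
     = Elem x # map Bit a @ map Elem ys @ map Bit b"
  proof (cases ys)
    case Nil
    thus ?thesis by (simp add: xs front_back_def)
  next
    case (Cons y zs)
    have "[0..<length xs] = 0 # map Suc [0..<length ys]" by (simp add: xs map_Suc_upt upt_conv_Cons del: upt_Suc)
    hence "concat (map (\<lambda>i. Elem (xs ! i) # map Bit (front_back (length xs) a b i)) [0..<length xs])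
      = (Elem (xs ! 0) # map Bit (front_back (length xs) a b 0)) @
        concat (map (\<lambda>i. Elem (xs ! Suc i) # map Bit (front_back (length xs) a b (Suc i))) [0..<length ys])"
      by (simp only: list.map concat.simps map_map o_def)
    also have "\<dots> = Elem x # map Bit a @
        concat (map (\<lambda>i. Elem (ys ! i) # map Bit (if Suc i = length ys then b else [])) [0..<length ys])"
      using Cons by (simp only: xs front_back_def) simp
    finally show ?thesis using gen[of ys] Cons by simp
  qed
  thus ?thesis by (simp add: annotated_def xs)
qed

lemma sum_length_front_back:
  assumes "N > 0"
  shows "(\<Sum>i<N. length (front_back N a b i)) = length a + length b"
proof -
  have "(\<Sum>i<N. length (front_back N a b i)) = (\<Sum>i<N. if i = 0 then length a else 0) + (\<Sum>i<N. if i = N - 1 then length b else 0)"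
    unfolding sum.distrib[symmetric] using assms by (intro sum.cong) (auto simp: front_back_def)
  thus ?thesis using assms by simp
qed

lemma snd_scan_front_back:
  assumes "xs \<noteq> []" "W > 0" "\<And>x. length (enc x) = W" "\<And>x. x \<in> set ks \<union> set ks' \<Longrightarrow> dec (enc x) = x"
  shows "snd (scan W dec (annotated xs (front_back (length xs) (concat (map enc ks)) (concat (map enc ks')))))
    = Inl (hd xs) # map Inr ks @ map Inl (tl xs) @ map Inr ks'"
proof -
  have "foldl (scan_step W dec) ([], []) (Elem (hd xs) # map Bit (concat (map enc ks)) @ map Elem (tl xs)
      @ map Bit (concat (map enc ks'))) = ([], [Inl (hd xs)] @ map Inr ks @ map Inl (tl xs) @ map Inr ks')"
  proof -
    have w: "foldl (scan_step W dec) ([], ms) (map Bit (concat (map enc l))) = ([], ms @ map Inr l)"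
      if "set l \<subseteq> set ks \<union> set ks'" for l ms
      using that assms by (intro foldl_scan_step_words) auto
    have "scan_step W dec ([], []) (Elem (hd xs)) = ([], [Inl (hd xs)])" by (simp add: scan_step_def)
    thus ?thesis by (simp only: foldl.simps foldl_append w[of ks] w[of ks'] foldl_scan_step_elems Un_upper1 Un_upper2
       append_Cons append_Nil append_assoc)
  qed
  thus ?thesis unfolding scan_def annotated_front_back[OF assms(1)] by simp
qed

section \<open>Polynomials modulo a prime\<close>

text \<open>Division by the monic polynomial \<open>x - a\<close> stays within integer polynomials,
  and if \<open>a\<close> is a root modulo \<open>p\<close>, the remainder vanishes modulo
  \<open>p\<close> while the quotient does not. The degree is that of the integer polynomial, which
  may exceed the degree modulo \<open>p\<close>.\<close>

lemma card_roots_mod_prime_le: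
  fixes f :: "int poly"
  assumes "prime p" "\<not> int p dvd coeff f i"
  shows "card {x \<in> {..<p}. int p dvd poly f (int x)} \<le> degree f"
  using assms(2)
proof (induction "degree f" arbitrary: f i rule: less_induct)
  case less
  show ?case
  proof (cases "\<exists>a<p. int p dvd poly f (int a)")
    case False
    hence "{x \<in> {..<p}. int p dvd poly f (int x)} = {}" by auto
    thus ?thesis by (simp only: card.empty)
  next
    case True
    then obtain a where a: "a < p" "int p dvd poly f (int a)" by blast
    obtain q where q: "f = [:- int a, 1:] * q + [:poly f (int a):]"
      using synthetic_div_correct'[of "int a" f] by metis
    have "q \<noteq> 0"
    proof
      assume "q = 0"
      hence f: "f = [:poly f (int a):]" using q by simp
      have "int p dvd coeff f i" by (subst f) (use a in \<open>cases i, auto\<close>)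
      thus False using less.prems by simp
    qed
    have deg: "degree f = Suc (degree q)"
    proof -
      have "degree ([:- int a, 1:] * q) = Suc (degree q)"
        using \<open>q \<noteq> 0\<close> by (subst degree_mult_eq) auto
      thus ?thesis by (subst q, subst degree_add_eq_left) auto
    qed
    have "\<exists>j. \<not> int p dvd coeff q j"
    proof (rule ccontr)
      assume "\<not> ?thesis"
      hence "int p dvd coeff q j" for j by blast
      hence "int p dvd coeff ([:- int a, 1:] * q) i" by (cases i) (auto intro: dvd_diff dvd_add)
      moreover have "int p dvd coeff [:poly f (int a):] i" using a by (cases i) auto
      ultimately have "int p dvd coeff f i" by (subst q) (simp only: coeff_add dvd_add)
      thus False using less.prems by simp
    qed
    then obtain j where "\<not> int p dvd coeff q j" by blast
    hence IH: "card {x \<in> {..<p}. int p dvd poly q (int x)} \<le> degree q" using less.hyps[of q j] deg by simp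
    have "{x \<in> {..<p}. int p dvd poly f (int x)} \<subseteq> insert a {x \<in> {..<p}. int p dvd poly q (int x)}"
    proof
      fix x assume x: "x \<in> {x \<in> {..<p}. int p dvd poly f (int x)}"
      have "poly f (int x) = (int x - int a) * poly q (int x) + poly f (int a)"
        using arg_cong[OF q, of "\<lambda>g. poly g (int x)"] by (simp add: algebra_simps)
      hence "int p dvd (int x - int a) * poly q (int x)" using x a(2) by (metis dvd_add_left_iff mem_Collect_eq)
      hence "int p dvd int x - int a \<or> int p dvd poly q (int x)"
        using assms(1) by (simp add: prime_dvd_mult_iff)
      thus "x \<in> insert a {x \<in> {..<p}. int p dvd poly q (int x)}"
      proof
        assume "int p dvd int x - int a"
        hence "[x = a] (mod p)" by (simp add: cong_iff_dvd_diff cong_int_iff[symmetric])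
        hence "x = a" using x a(1) by (auto intro: cong_less_modulus_unique_nat)
        thus ?thesis by simp
      qed (use x in auto)
    qed
    hence "card {x \<in> {..<p}. int p dvd poly f (int x)} \<le> card (insert a {x \<in> {..<p}. int p dvd poly q (int x)})"
      by (intro card_mono) auto
    also have "\<dots> \<le> Suc (card {x \<in> {..<p}. int p dvd poly q (int x)})" by (simp add: card_insert_if)
    finally show ?thesis using IH deg by simp
  qed
qed

text \<open>For the comparison of the announced polynomial with the true one, where a difference
  shows up as a value and not as a coefficient.\<close>

lemma card_roots_mod_prime_le_of_value:
  fixes f :: "int poly"
  assumes "prime p" "\<not> int p dvd poly f y"
  shows "card {x \<in> {..<p}. int p dvd poly f (int x)} \<le> degree f"
proof -
  have "\<exists>i. \<not> int p dvd coeff f i"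
  proof (rule ccontr)
    assume "\<not> ?thesis"
    hence "int p dvd poly f y" unfolding poly_altdef by (intro dvd_sum) auto
    thus False using assms(2) by simp
  qed
  thus ?thesis using card_roots_mod_prime_le[OF assms(1)] by blast
qed

text \<open>Lagrange interpolation modulo \<open>p\<close> with nodes \<open>0, \<dots>, H - 1\<close>, carried out with integer polynomials:
  the denominators are replaced by inverses modulo \<open>p\<close>.\<close>

definition lagrange :: "nat \<Rightarrow> nat \<Rightarrow> nat \<Rightarrow> int poly" where
  "lagrange p H y = (let N = (\<Prod>y' \<in> {..<H} - {y}. [:- int y', 1:])
     in smult (SOME c. [c * poly N (int y) = 1] (mod int p)) N)"

lemma degree_lagrange:
  assumes "y < H"
  shows "degree (lagrange p H y) < H"
proof -
  have "degree (\<Prod>y' \<in> {..<H} - {y}. [:- int y', 1:]) = (\<Sum>y' \<in> {..<H} - {y}. degree [:- int y', 1:])"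
    by (rule degree_prod_eq_sum_degree) simp
  also have "\<dots> < H" using assms by simp
  finally show ?thesis unfolding lagrange_def Let_def using degree_smult_le le_less_trans by blast
qed

text \<open>The nodes are below \<open>H \<le> p\<close>, hence distinct modulo \<open>p\<close>,
  and the product of their differences is invertible.\<close>

lemma poly_lagrange:
  assumes "prime p" "H \<le> p" "y < H" "z < H"
  shows "[poly (lagrange p H y) (int z) = (if y = z then 1 else 0)] (mod int p)"
proof -
  define N where "N = (\<Prod>y' \<in> {..<H} - {y}. [:- int y', 1:])"
  have N: "poly N x = (\<Prod>y' \<in> {..<H} - {y}. x - int y')" for x
    unfolding N_def poly_prod by (intro prod.cong) auto
  have "coprime (poly N (int y)) (int p)"
    unfolding N
  proof (rule prod_coprime_left)
    fix y' assume y': "y' \<in> {..<H} - {y}"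
    have "\<not> int p dvd int y - int y'"
      using y' assms by (metis DiffE cong_iff_dvd_diff cong_int_iff cong_less_modulus_unique_nat insertCI lessThan_iff less_le_trans)
    thus "coprime (int y - int y') (int p)" using assms(1)
      by (metis coprime_commute prime_imp_coprime prime_nat_int_transfer)
  qed
  hence "\<exists>c. [c * poly N (int y) = 1] (mod int p)"
    using cong_solve_coprime_int[of "poly N (int y)" "int p"] by (auto simp: mult.commute)
  hence c: "[(SOME c. [c * poly N (int y) = 1] (mod int p)) * poly N (int y) = 1] (mod int p)" by (rule someI_ex)
  show ?thesis
  proof (cases "y = z")
    case True
    thus ?thesis using c by (simp add: lagrange_def Let_def N_def)
  next
    case False
    hence "poly N (int z) = 0" unfolding N using assms by (intro prod_zero) auto
    thus ?thesis using False by (simp add: lagrange_def Let_def N_def)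
  qed
qed

section \<open>Hashing and the sum check\<close>

lemma card_multiples_less_le: "card {t \<in> {..<p}. r dvd t} \<le> p div r + (1::nat)" if "r > 0"
proof -
  have "{t \<in> {..<p}. r dvd t} \<subseteq> (\<lambda>i. r * i) ` {..p div r}"
  proof
    fix t assume "t \<in> {t \<in> {..<p}. r dvd t}"
    then obtain i where i: "t = r * i" "t < p" by auto
    hence "i \<le> p div r" using that by (simp add: less_eq_div_iff_mult_less_eq mult.commute)
    thus "t \<in> (\<lambda>i. r * i) ` {..p div r}" using i by auto
  qed
  hence "card {t \<in> {..<p}. r dvd t} \<le> card ((\<lambda>i. r * i) ` {..p div r})" by (intro card_mono) auto
  also have "\<dots> \<le> card {..p div r}" by (rule card_image_le) simp
  finally show ?thesis by simp
qed

text \<open>\<open>a (x - x')\<close> modulo \<open>p\<close> runs through all residues, and a collision forces this residue \<open>t\<close>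
  or its negative \<open>p - t\<close> to be a multiple of \<open>r\<close>.\<close>

lemma card_collisions_le:
  fixes p r x x' :: nat
  assumes "prime p" "0 < r" "r \<le> p" "x < p" "x' < p" "x \<noteq> x'"
  shows "card {a \<in> {..<p}. (a * x mod p) mod r = (a * x' mod p) mod r} * r \<le> 4 * p"
proof -
  define D where "D = {a \<in> {..<p}. (a * x mod p) mod r = (a * x' mod p) mod r}"
  \<comment> \<open>\<open>p - x'\<close> represents \<open>- x'\<close>, which keeps
    \<open>t\<close> within the naturals.\<close>
  define t where "t a = (a * (x + (p - x'))) mod p" for a
  have p0: "p > 0" using assms prime_gt_0_nat by blast
  have cop: "coprime (x + (p - x')) p"
  proof -
    have "\<not> p dvd x + (p - x')"
    proof
      assume "p dvd x + (p - x')"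
      hence "[x + (p - x') + x' = 0 + x'] (mod p)" by (intro cong_add) (auto simp: cong_0_iff)
      hence "[x = x'] (mod p)" using assms(5) by (simp add: cong_def)
      thus False using assms cong_less_modulus_unique_nat by blast
    qed
    thus ?thesis using assms(1) by (metis coprime_commute prime_imp_coprime_nat)
  qed
  have inj: "inj_on t {..<p}"
  proof (rule inj_onI)
    fix a b assume "a \<in> {..<p}" "b \<in> {..<p}" "t a = t b"
    hence "[a = b] (mod p)" using cop by (simp add: t_def cong_def[symmetric] cong_mult_rcancel_nat)
    thus "a = b" using \<open>a \<in> {..<p}\<close> \<open>b \<in> {..<p}\<close> cong_less_modulus_unique_nat by blast
  qed
  have cover: "t a \<in> {s \<in> {..<p}. r dvd s} \<union> (\<lambda>s. p - s) ` {s \<in> {..<p}. r dvd s}" if "a \<in> D" for a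
  proof -
    define u v where "u = a * x mod p" and "v = a * x' mod p"
    have uv: "u < p" "v < p" "u mod r = v mod r" using that p0 by (auto simp: D_def u_def v_def)
    have tp: "t a < p" using p0 by (simp add: t_def)
    have "int (t a) = (int a * (int x + (int p - int x'))) mod int p"
      using assms by (simp add: t_def zmod_int of_nat_diff add_diff_eq)
    also have "\<dots> = (int a * int x - int a * int x' + int a * int p) mod int p" by (simp add: algebra_simps)
    also have "\<dots> = (int a * int x - int a * int x') mod int p" by simp
    also have "\<dots> = (int u - int v) mod int p" by (simp add: u_def v_def zmod_int mod_diff_eq)
    finally have tuv: "int (t a) = (int u - int v) mod int p" .
    show ?thesis
    proof (cases "v \<le> u")
      case True
      hence "int (t a) = int u - int v" using uv tuv by simp
      hence "t a = u - v" using True by simp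
      moreover have "r dvd u - v" using uv True by (simp add: mod_eq_dvd_iff_nat)
      ultimately show ?thesis using tp by auto
    next
      case False
      hence "(int u - int v + int p) mod int p = int u - int v + int p"
        using uv by (intro mod_pos_pos_trivial) auto
      hence "int (t a) = int u - int v + int p" using tuv by simp
      hence "t a = p - (v - u)" using False uv by simp
      moreover have "r dvd v - u" using uv False by (metis mod_eq_dvd_iff_nat nat_le_linear)
      ultimately show ?thesis using uv by auto
    qed
  qed
  have "card D = card (t ` D)" using inj by (intro card_image[symmetric]) (auto simp: D_def inj_on_def)
  also have "\<dots> \<le> card ({s \<in> {..<p}. r dvd s} \<union> (\<lambda>s. p - s) ` {s \<in> {..<p}. r dvd s})"
  proof (rule card_mono)
    show "t ` D \<subseteq> {s \<in> {..<p}. r dvd s} \<union> (\<lambda>s. p - s) ` {s \<in> {..<p}. r dvd s}"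
      using cover by (rule image_subsetI)
  qed simp
  also have "\<dots> \<le> card {s \<in> {..<p}. r dvd s} + card ((\<lambda>s. p - s) ` {s \<in> {..<p}. r dvd s})" by (rule card_Un_le)
  also have "\<dots> \<le> 2 * card {s \<in> {..<p}. r dvd s}" using card_image_le[of "{s \<in> {..<p}. r dvd s}" "\<lambda>s. p - s"] by simp
  also have "\<dots> \<le> 2 * (p div r + 1)" using card_multiples_less_le[OF assms(2), of p] by simp
  finally have "card D * r \<le> (2 * (p div r + 1)) * r" by (rule mult_le_mono1)
  also have "\<dots> = 2 * (p div r * r) + 2 * r" by (simp only: distrib_right mult.assoc mult_2)
  also have "\<dots> \<le> 4 * p" using assms(3) div_times_less_eq_dividend[of p r] by linarith
  finally show ?thesis by (simp add: D_def)
qed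

section \<open>Linear functionals of an edge stream\<close>

lemma sum_list_stream_eq:
  fixes h :: "nat set \<Rightarrow> int"
  assumes "finite U" "fst ` set xs \<subseteq> U"
  shows "(\<Sum>(e, \<delta>)\<leftarrow>xs. \<delta> * h e) = (\<Sum>e\<in>U. edge_mult xs e * h e)"
  using assms(2)
proof (induction xs)
  case (Cons u xs)
  obtain e \<delta> where u: "u = (e, \<delta>)" by (cases u)
  have "e \<in> U" using Cons.prems u by simp
  have "(\<Sum>e'\<in>U. edge_mult (u # xs) e' * h e') = (\<Sum>e'\<in>U. (if e' = e then \<delta> * h e' else 0) + edge_mult xs e' * h e')"
    by (intro sum.cong) (auto simp: edge_mult_def u algebra_simps)
  also have "\<dots> = \<delta> * h e + (\<Sum>e'\<in>U. edge_mult xs e' * h e')"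
    using \<open>e \<in> U\<close> assms(1) by (simp add: sum.distrib)
  finally show ?case using Cons u by simp
qed (simp add: edge_mult_def)

lemma sum_triple_delta:
  fixes h :: "nat \<Rightarrow> nat \<Rightarrow> nat \<Rightarrow> int"
  assumes "y0 < H" "l0 < L" "t0 < C"
  shows "(\<Sum>y<H. \<Sum>l<L. \<Sum>t<C. if l = l0 \<and> t = t0 \<and> y = y0 then h y l t else 0) = h y0 l0 t0"
proof -
  have "(\<Sum>t<C. if l = l0 \<and> t = t0 \<and> y = y0 then h y l t else 0)
      = (if l = l0 then (if y = y0 then h y l t0 else 0) else 0)" for y l
    using assms(3) by (cases "l = l0"; cases "y = y0") simp_all
  thus ?thesis using assms(1,2) by simp
qed

definition all_edges :: "nat \<Rightarrow> nat set set" where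
  "all_edges n = {e. e \<subseteq> {..<n} \<and> card e = 2}"

lemma all_edgesE:
  assumes "e \<in> all_edges n"
  obtains u v where "e = {u, v}" "u < n" "v < n" "u \<noteq> v"
  using assms unfolding all_edges_def card_2_iff by blast

lemma finite_all_edges: "finite (all_edges n)"
  by (rule finite_subset[of _ "Pow {..<n}"]) (auto simp: all_edges_def)

lemma card_all_edges_le: "card (all_edges n) \<le> n ^ 2"
proof -
  have "all_edges n \<subseteq> (\<lambda>(u, v). {u, v}) ` ({..<n} \<times> {..<n})"
    by (fastforce simp: all_edges_def card_2_iff)
  hence "card (all_edges n) \<le> card ({..<n} \<times> {..<n})"
    by (meson card_image_le card_mono finite_SigmaI finite_imageI finite_lessThan le_trans)
  thus ?thesis by (simp add: power2_eq_square)
qed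

text \<open>\<open>n ^ 2 \<le> p\<close> gives the edges distinct codes,
  \<open>H * C \<le> p\<close> is what the collision bound asks of the number of buckets, and
  \<open>9 * H \<le> p\<close> allows a polynomial of degree at most \<open>3 * H\<close> that is
  nonzero modulo \<open>p\<close> to vanish at no more than a third of the points.\<close>

locale bucket_check =
  fixes n p H C L :: nat
  assumes prime_p: "prime p" and H_pos: "0 < H" and C_pos: "0 < C"
    and H_le: "9 * H \<le> p" and HC_le: "H * C \<le> p" and n_le: "n ^ 2 \<le> p"
begin

text \<open>The reduction modulo \<open>p\<close> does not change the codes of edges. It keeps the
  memory bounded also on streams with malformed updates.\<close>

definition code :: "nat set \<Rightarrow> nat" where "code e = (Min e * n + Max e) mod p"
definition bucket :: "nat \<Rightarrow> nat \<Rightarrow> nat" where "bucket s x = (s * x mod p) mod (H * C)"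
definition row :: "nat \<Rightarrow> nat \<Rightarrow> nat" where "row s x = bucket s x div C"
definition col :: "nat \<Rightarrow> nat \<Rightarrow> nat" where "col s x = bucket s x mod C"

lemma p_gt_0: "p > 0" using prime_p prime_gt_0_nat by blast
lemma code_less: "code e < p" using p_gt_0 by (simp add: code_def)
lemma col_less: "col s x < C" using C_pos by (simp add: col_def)

lemma row_less: "row s x < H"
proof -
  have "bucket s x < H * C" using H_pos C_pos by (simp add: bucket_def)
  thus ?thesis by (simp add: row_def less_mult_imp_div_less)
qed

lemma code_pair_less:
  assumes "u < n" "v < n"
  shows "code {u, v} = min u v * n + max u v" "code {u, v} < n ^ 2"
proof -
  have "min u v * n + max u v < (min u v + 1) * n" using assms by simp
  also have "\<dots> \<le> n * n" using assms by (intro mult_le_mono1) simp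
  finally have "min u v * n + max u v < n ^ 2" by (simp add: power2_eq_square)
  moreover from this show "code {u, v} = min u v * n + max u v" using n_le by (simp add: code_def)
  ultimately show "code {u, v} < n ^ 2" by simp
qed

lemma code_pair_eq_iff:
  assumes "u < n" "v < n" "u' < n" "v' < n"
  shows "code {u, v} = code {u', v'} \<longleftrightarrow> {u, v} = {u', v'}"
proof
  assume "code {u, v} = code {u', v'}"
  hence *: "min u v * n + max u v = min u' v' * n + max u' v'" using assms by (simp add: code_pair_less(1))
  have "max u v < n" "max u' v' < n" using assms by auto
  hence "max u v = max u' v'" "min u v = min u' v'"
    using arg_cong[OF *, of "\<lambda>x. x mod n"] arg_cong[OF *, of "\<lambda>x. x div n"] by auto
  thus "{u, v} = {u', v'}" by (auto simp: max_def min_def split: if_splits)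
qed simp

text \<open>For hash function \<open>l\<close> and column \<open>t\<close>, this interpolates the
  \<open>j\<close>-th moments of the cells over the rows, modulo \<open>p\<close>. It is linear in
  the stream.\<close>

definition Apoly :: "nat list \<Rightarrow> (nat \<times> int) list \<Rightarrow> nat \<Rightarrow> nat \<Rightarrow> nat \<Rightarrow> int poly" where
  "Apoly sd es j l t = (\<Sum>(x, d)\<leftarrow>es. if col (sd ! l) x = t
     then smult (d * int x ^ j) (lagrange p H (row (sd ! l) x)) else 0)"

text \<open>Indices 0 to 2 hold the moments of the claimed codes, index 3 the claimed
  multiplicities. Claims that share a cell add up.\<close>

definition Bpoly :: "nat list \<Rightarrow> (nat \<times> nat \<times> nat) list \<Rightarrow> nat \<Rightarrow> nat \<Rightarrow> nat \<Rightarrow> int poly" where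
  "Bpoly sd cs j l t = (\<Sum>(l', x, g)\<leftarrow>cs. if l' = l \<and> col (sd ! l) x = t
     then smult (if j < 3 then int x ^ j else int g) (lagrange p H (row (sd ! l) x)) else 0)"

text \<open>The two squares of the defect, expanded in moments. The term \<open>g\<^sup>2\<close>
  involves the claim alone and is accounted for separately. Linearity in \<open>Bpoly\<close> keeps
  several claims on one cell independent of each other.\<close>

definition Qpoly :: "nat list \<Rightarrow> (nat \<times> int) list \<Rightarrow> (nat \<times> nat \<times> nat) list \<Rightarrow> int poly" where
  "Qpoly sd es cs = (\<Sum>l<L. \<Sum>t<C.
     Apoly sd es 2 l t * Bpoly sd cs 0 l t - 2 * Apoly sd es 1 l t * Bpoly sd cs 1 l t
     + Apoly sd es 0 l t * Bpoly sd cs 2 l t + (Apoly sd es 0 l t)\<^sup>2 * Bpoly sd cs 0 l t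
     - 2 * Apoly sd es 0 l t * Bpoly sd cs 3 l t)"

text \<open>The claim \<open>(l, x, g)\<close> says that, under the \<open>l\<close>-th hash function, the bucket of \<open>x\<close> contains
  \<open>g\<close> copies of \<open>x\<close> and nothing else. If all multiplicities are nonnegative, the defect is a sum of
  nonnegative terms that vanishes exactly for a true claim.\<close>

definition defect :: "nat list \<Rightarrow> (nat \<times> int) list \<Rightarrow> nat \<times> nat \<times> nat \<Rightarrow> int" where
  "defect sd es = (\<lambda>(l, x, g).
     (\<Sum>(x', d)\<leftarrow>es. if col (sd ! l) x' = col (sd ! l) x \<and> row (sd ! l) x' = row (sd ! l) x
        then d * (int x' - int x)\<^sup>2 else 0) +
     ((\<Sum>(x', d)\<leftarrow>es. if col (sd ! l) x' = col (sd ! l) x \<and> row (sd ! l) x' = row (sd ! l) x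
        then d else 0) - int g)\<^sup>2)"

lemma poly_Apoly_cong:
  assumes "y < H"
  shows "[poly (Apoly sd es j l t) (int y) =
    (\<Sum>(x, d)\<leftarrow>es. if col (sd ! l) x = t \<and> row (sd ! l) x = y then d * int x ^ j else 0)] (mod int p)"
proof (induction es)
  case (Cons e es)
  obtain x d where e: "e = (x, d)" by (cases e)
  have "[poly (if col (sd ! l) x = t then smult (d * int x ^ j) (lagrange p H (row (sd ! l) x)) else 0) (int y)
     = (if col (sd ! l) x = t \<and> row (sd ! l) x = y then d * int x ^ j else 0)] (mod int p)"
    using cong_scalar_left[OF poly_lagrange[OF prime_p _ row_less assms, of "sd ! l" x], of "d * int x ^ j"] H_le
    by (auto split: if_splits)
  from cong_add[OF this Cons.IH] show ?case by (simp only: Apoly_def e list.map sum_list.Cons prod.case poly_add)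
qed (simp add: Apoly_def)

lemma poly_Bpoly_cong:
  assumes "y < H"
  shows "[poly (Bpoly sd cs j l t) (int y) =
    (\<Sum>(l', x, g)\<leftarrow>cs. if l' = l \<and> col (sd ! l) x = t \<and> row (sd ! l) x = y
       then (if j < 3 then int x ^ j else int g) else 0)] (mod int p)"
proof (induction cs)
  case (Cons c cs)
  obtain l' x g where c: "c = (l', x, g)" by (cases c)
  define a where "a = (if j < 3 then int x ^ j else int g)"
  have "[poly (if l' = l \<and> col (sd ! l) x = t then smult a (lagrange p H (row (sd ! l) x)) else 0) (int y)
     = (if l' = l \<and> col (sd ! l) x = t \<and> row (sd ! l) x = y then a else 0)] (mod int p)"
    using cong_scalar_left[OF poly_lagrange[OF prime_p _ row_less assms, of "sd ! l" x], of a] H_le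
    by (auto split: if_splits)
  from cong_add[OF this Cons.IH] show ?case by (simp only: Bpoly_def c a_def list.map sum_list.Cons prod.case poly_add)
qed (simp add: Bpoly_def)

lemma degree_Apoly: "degree (Apoly sd es j l t) \<le> H - 1"
proof (induction es)
  case (Cons e es)
  obtain x d where e: "e = (x, d)" by (cases e)
  have "degree (if col (sd ! l) x = t then smult (d * int x ^ j) (lagrange p H (row (sd ! l) x)) else 0) \<le> H - 1"
    using degree_lagrange[OF row_less[of "sd ! l" x], of p] degree_smult_le[of "d * int x ^ j" "lagrange p H (row (sd ! l) x)"]
    by auto
  from degree_add_le[OF this Cons.IH] show ?case by (simp only: Apoly_def e list.map sum_list.Cons prod.case poly_add)
qed (simp add: Apoly_def)

lemma degree_Bpoly: "degree (Bpoly sd cs j l t) \<le> H - 1"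
proof (induction cs)
  case (Cons c cs)
  obtain l' x g where c: "c = (l', x, g)" by (cases c)
  define a where "a = (if j < 3 then int x ^ j else int g)"
  have "degree (if l' = l \<and> col (sd ! l) x = t then smult a (lagrange p H (row (sd ! l) x)) else 0) \<le> H - 1"
    using degree_lagrange[OF row_less[of "sd ! l" x], of p] degree_smult_le[of a "lagrange p H (row (sd ! l) x)"]
    by auto
  from degree_add_le[OF this Cons.IH] show ?case by (simp only: Bpoly_def c a_def list.map sum_list.Cons prod.case poly_add)
qed (simp add: Bpoly_def)

text \<open>No term has more than three factors \<open>Apoly\<close> or \<open>Bpoly\<close>, each
  of degree at most \<open>H - 1\<close>.\<close>

lemma degree_Qpoly: "degree (Qpoly sd es cs) < 3 * H"
proof -
  have m: "degree (f * g) \<le> a + b" if "degree f \<le> a" "degree g \<le> b" for f g :: "int poly" and a b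
    using degree_mult_le[of f g] that by linarith
  have two: "degree (2 * f) \<le> a" if "degree f \<le> a" for f :: "int poly" and a
    using m[of 2 0 f a] that by simp
  let ?k = "(H - 1) + (H - 1)"
  have "degree (Qpoly sd es cs) \<le> ?k + (H - 1)"
    unfolding Qpoly_def
  proof (intro degree_sum_le finite_lessThan)
    fix l t
    let ?A = "\<lambda>j. Apoly sd es j l t" and ?B = "\<lambda>j. Bpoly sd cs j l t"
    have ab: "degree (?A i * ?B j) \<le> ?k + (H - 1)" for i j
      using m[OF degree_Apoly degree_Bpoly, of sd es i l t sd cs j l t] by linarith
    have ab2: "degree (2 * ?A i * ?B j) \<le> ?k + (H - 1)" for i j
      using two[OF ab[of i j]] by (simp add: mult.assoc)
    have "degree ((?A 0)\<^sup>2 * ?B 0) \<le> ?k + (H - 1)"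
      unfolding power2_eq_square by (intro m degree_Apoly degree_Bpoly)
    thus "degree (?A 2 * ?B 0 - 2 * ?A 1 * ?B 1 + ?A 0 * ?B 2 + (?A 0)\<^sup>2 * ?B 0 - 2 * ?A 0 * ?B 3) \<le> ?k + (H - 1)"
      by (intro degree_diff_le degree_add_le ab ab2)
  qed
  thus ?thesis using H_pos by linarith
qed

text \<open>At an integer \<open>y < H\<close> the interpolation returns the moments of the cells in
  row \<open>y\<close>. As \<open>Qpoly\<close> is linear in the claims, an induction over them
  remains: a new claim contributes only at its own row, hash function and column.\<close>

lemma sum_Qpoly_cong:
  assumes "\<And>l x g. (l, x, g) \<in> set cs \<Longrightarrow> l < L"
  shows "[(\<Sum>y<H. poly (Qpoly sd es cs) (int y)) + (\<Sum>(l, x, g)\<leftarrow>cs. (int g)\<^sup>2) = (\<Sum>c\<leftarrow>cs. defect sd es c)] (mod int p)"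
proof -
  define a where "a j l t y = (\<Sum>(x, d)\<leftarrow>es. if col (sd ! l) x = t \<and> row (sd ! l) x = y then d * int x ^ j else 0)" for j l t y
  define b where "b cs j l t y = (\<Sum>(l', x, g)\<leftarrow>cs. if l' = l \<and> col (sd ! l) x = t \<and> row (sd ! l) x = y
       then (if j < (3::nat) then int x ^ j else int g) else 0)" for cs :: "(nat \<times> nat \<times> nat) list" and j l t y
  define E where "E cs y l t = a 2 l t y * b cs 0 l t y - 2 * a 1 l t y * b cs 1 l t y + a 0 l t y * b cs 2 l t y
     + (a 0 l t y)\<^sup>2 * b cs 0 l t y - 2 * a 0 l t y * b cs 3 l t y" for cs y l t
  have "[poly (Qpoly sd es cs) (int y) = (\<Sum>l<L. \<Sum>t<C. E cs y l t)] (mod int p)" if "y < H" for y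
    unfolding Qpoly_def E_def poly_sum poly_diff poly_add poly_mult poly_power poly_numeral a_def b_def
    by (intro cong_sum cong_add cong_diff cong_mult cong_pow cong_refl poly_Apoly_cong poly_Bpoly_cong that)
  hence 1: "[(\<Sum>y<H. poly (Qpoly sd es cs) (int y)) = (\<Sum>y<H. \<Sum>l<L. \<Sum>t<C. E cs y l t)] (mod int p)"
    by (intro cong_sum) auto
  have "(\<Sum>y<H. \<Sum>l<L. \<Sum>t<C. E cs y l t) + (\<Sum>(l, x, g)\<leftarrow>cs. (int g)\<^sup>2) = (\<Sum>c\<leftarrow>cs. defect sd es c)"
    using assms
  proof (induction cs)
    case Nil
    thus ?case by (simp add: E_def b_def)
  next
    case (Cons c cs)
    obtain l0 x g where c: "c = (l0, x, g)" by (cases c)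
    define t0 y0 where "t0 = col (sd ! l0) x" and "y0 = row (sd ! l0) x"
    \<comment> \<open>The contribution of the new claim to its cell, which is its defect without
      \<open>g\<^sup>2\<close>.\<close>
    define h where "h y l t = a 2 l t y - 2 * a 1 l t y * int x + a 0 l t y * (int x)\<^sup>2 + (a 0 l t y)\<^sup>2 - 2 * a 0 l t y * int g" for y l t
    have E_Cons: "E (c # cs) y l t = (if l = l0 \<and> t = t0 \<and> y = y0 then h y l t else 0) + E cs y l t" for y l t
      by (auto simp: E_def b_def c h_def t0_def y0_def algebra_simps)
    hence "(\<Sum>y<H. \<Sum>l<L. \<Sum>t<C. E (c # cs) y l t) = h y0 l0 t0 + (\<Sum>y<H. \<Sum>l<L. \<Sum>t<C. E cs y l t)"
    proof -
      have "l0 < L" using Cons.prems[of l0 x g] c by simp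
      from sum_triple_delta[OF _ this, of y0 H t0 C h] row_less col_less show ?thesis
        unfolding E_Cons sum.distrib by (simp add: t0_def y0_def)
    qed
    moreover have "h y0 l0 t0 + (int g)\<^sup>2 = defect sd es c"
    proof -
      have "a 2 l0 t0 y0 - 2 * a 1 l0 t0 y0 * int x + a 0 l0 t0 y0 * (int x)\<^sup>2
        = (\<Sum>(x', d)\<leftarrow>es. if col (sd ! l0) x' = t0 \<and> row (sd ! l0) x' = y0 then d * (int x' - int x)\<^sup>2 else 0)"
        unfolding a_def by (induction es) (auto simp: power2_eq_square algebra_simps)
      moreover have "a 0 l0 t0 y0 = (\<Sum>(x', d)\<leftarrow>es. if col (sd ! l0) x' = t0 \<and> row (sd ! l0) x' = y0 then d else 0)"
        unfolding a_def power_0 mult_1_right ..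
      ultimately show ?thesis by (simp add: defect_def c h_def t0_def y0_def power2_diff)
    qed
    moreover have "(\<Sum>y<H. \<Sum>l<L. \<Sum>t<C. E cs y l t) + (\<Sum>(l, x, g)\<leftarrow>cs. (int g)\<^sup>2) = (\<Sum>c\<leftarrow>cs. defect sd es c)"
      using Cons.prems by (intro Cons.IH) auto
    ultimately show ?case unfolding c list.map sum_list.Cons prod.case by linarith
  qed
  thus ?thesis using cong_add[OF 1 cong_refl[of "\<Sum>(l, x, g)\<leftarrow>cs. (int g)\<^sup>2"]] by simp
qed

text \<open>A stream element that arrives before the seeds is stored with its increment reduced
  modulo \<open>p\<close>; its later effect on the registers is the same.\<close>

lemma poly_Apoly_mod:
  "poly (Apoly sd (map (\<lambda>(x, d). (x, d mod int p)) es) j l t) z mod int p = poly (Apoly sd es j l t) z mod int p"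
proof (induction es)
  case (Cons e es)
  obtain x d where e: "e = (x, d)" by (cases e)
  define f where "f d = poly (if col (sd ! l) x = t then smult (d * int x ^ j) (lagrange p H (row (sd ! l) x)) else 0) z" for d
  have "f (d mod int p) mod int p = f d mod int p" by (auto simp: f_def mod_simps mult.assoc)
  hence "(f (d mod int p) + poly (Apoly sd (map (\<lambda>(x, d). (x, d mod int p)) es) j l t) z) mod int p
     = (f d + poly (Apoly sd es j l t) z) mod int p" by (rule mod_add_cong) (rule Cons.IH)
  thus ?case by (simp add: Apoly_def e f_def)
qed simp

section \<open>Defects of claims about an edge stream\<close>

definition same_cell :: "nat \<Rightarrow> nat \<Rightarrow> nat \<Rightarrow> bool" where
  "same_cell s x x' \<longleftrightarrow> col s x = col s x' \<and> row s x = row s x'"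

definition coded :: "update list \<Rightarrow> (nat \<times> int) list" where
  "coded xs = map (\<lambda>(e, d). (code e, d)) xs"

lemma code_edge_less: "e \<in> all_edges n \<Longrightarrow> code e < n ^ 2"
  by (erule all_edgesE) (simp add: code_pair_less(2))

lemma code_edge_eq_iff: "e \<in> all_edges n \<Longrightarrow> u < n \<Longrightarrow> v < n \<Longrightarrow> code e = code {u, v} \<longleftrightarrow> e = {u, v}"
  by (erule all_edgesE) (simp add: code_pair_eq_iff)

text \<open>By linearity the defect depends on the final multiplicities only; here the list of
  updates gives way to the graph.\<close>

lemma defect_coded:
  assumes "fst ` set xs \<subseteq> all_edges n"
  shows "defect sd (coded xs) (l, x, g) =
    (\<Sum>e\<in>all_edges n. edge_mult xs e * (if same_cell (sd ! l) (code e) x then (int (code e) - int x)\<^sup>2 else 0)) +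
    ((\<Sum>e\<in>all_edges n. edge_mult xs e * (if same_cell (sd ! l) (code e) x then 1 else 0)) - int g)\<^sup>2"
proof -
  have "(\<Sum>(x', d)\<leftarrow>coded xs. if col (sd ! l) x' = col (sd ! l) x \<and> row (sd ! l) x' = row (sd ! l) x then d * h x' else 0)
     = (\<Sum>e\<in>all_edges n. edge_mult xs e * (if same_cell (sd ! l) (code e) x then h (code e) else 0))" for h :: "nat \<Rightarrow> int"
  proof -
    have "(\<Sum>(x', d)\<leftarrow>coded xs. if col (sd ! l) x' = col (sd ! l) x \<and> row (sd ! l) x' = row (sd ! l) x then d * h x' else 0)
       = (\<Sum>(e, d)\<leftarrow>xs. d * (if same_cell (sd ! l) (code e) x then h (code e) else 0))"
      unfolding coded_def map_map by (intro arg_cong[of _ _ sum_list] map_cong) (auto simp: same_cell_def)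
    thus ?thesis using sum_list_stream_eq[OF finite_all_edges assms] by simp
  qed
  from this[of "\<lambda>x'. (int x' - int x)\<^sup>2"] this[of "\<lambda>x'. 1", unfolded mult_1_right] show ?thesis by (simp add: defect_def)
qed

lemma defect_nonneg:
  assumes "fst ` set xs \<subseteq> all_edges n" "\<And>e. edge_mult xs e \<ge> 0"
  shows "defect sd (coded xs) c \<ge> 0"
  using assms(2) by (cases c) (auto simp: defect_coded[OF assms(1)] intro!: add_nonneg_nonneg sum_nonneg)

text \<open>There are at most \<open>n ^ 2\<close> edges, and their codes are below
  \<open>n ^ 2\<close>, so squared differences are at most \<open>n ^ 4\<close>. A polynomial bound
  is enough: a prime of polynomial size then exceeds the sum of all defects.\<close>

lemma defect_le:
  assumes xs: "fst ` set xs \<subseteq> all_edges n" "\<And>e. edge_mult xs e \<ge> 0" "\<And>e. edge_mult xs e \<le> int b"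
    and "x < n ^ 2" "g \<le> b"
  shows "defect sd (coded xs) (l, x, g) \<le> int (n ^ 2 * b * n ^ 4 + (n ^ 2 * b + b) ^ 2)"
proof -
  have mass: "(\<Sum>e\<in>all_edges n. edge_mult xs e * h e) \<le> int (n ^ 2 * b * k)"
    if "\<And>e. e \<in> all_edges n \<Longrightarrow> h e \<le> int k" "\<And>e. h e \<ge> 0" for h :: "nat set \<Rightarrow> int" and k
  proof -
    have "(\<Sum>e\<in>all_edges n. edge_mult xs e * h e) \<le> (\<Sum>e\<in>all_edges n. int b * int k)"
      using that xs(2,3) by (intro sum_mono mult_mono) auto
    also have "\<dots> = int (card (all_edges n)) * (int b * int k)" by simp
    also have "\<dots> \<le> int (n ^ 2) * (int b * int k)" using card_all_edges_le by (intro mult_right_mono) (auto simp del: of_nat_power)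
    finally show ?thesis by (simp add: mult.assoc)
  qed
  have "(int (code e) - int x)\<^sup>2 \<le> int (n ^ 4)" if "e \<in> all_edges n" for e
  proof -
    have "\<bar>int (code e) - int x\<bar> \<le> int (n ^ 2)"
      using code_edge_less[OF that] assms(4) by linarith
    hence "(int (code e) - int x)\<^sup>2 \<le> (int (n ^ 2))\<^sup>2" by (rule abs_le_square_iff[THEN iffD1, of _ "int (n ^ 2)", simplified abs_of_nat])
    thus ?thesis by (simp add: power_mult[symmetric])
  qed
  hence 1: "(\<Sum>e\<in>all_edges n. edge_mult xs e * (if same_cell (sd ! l) (code e) x then (int (code e) - int x)\<^sup>2 else 0)) \<le> int (n ^ 2 * b * n ^ 4)"
    by (intro mass) auto
  define w where "w = (\<Sum>e\<in>all_edges n. edge_mult xs e * (if same_cell (sd ! l) (code e) x then 1 else 0))"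
  have "0 \<le> w" unfolding w_def using xs(2) by (intro sum_nonneg) auto
  moreover have "w \<le> int (n ^ 2 * b * 1)" unfolding w_def by (intro mass) auto
  ultimately have "\<bar>w - int g\<bar> \<le> int (n ^ 2 * b + b)" using assms(5) by (simp add: abs_le_iff)
  hence "(w - int g)\<^sup>2 \<le> (int (n ^ 2 * b + b))\<^sup>2" by (rule abs_le_square_iff[THEN iffD1, of _ "int (n ^ 2 * b + b)", simplified abs_of_nat])
  hence "(w - int g)\<^sup>2 \<le> int ((n ^ 2 * b + b) ^ 2)" by simp
  from add_mono[OF 1 this] show ?thesis unfolding defect_coded[OF xs(1)] w_def by simp
qed

text \<open>The bucket has mass \<open>g > 0\<close> and thus contains an edge of positive
  multiplicity. The vanishing second moment about \<open>code {u, v}\<close> forces this edge to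
  have that code. A claim with \<open>u = v\<close> is refuted as well, since no edge shares the
  code of a singleton.\<close>

lemma edge_of_defect_eq_0:
  assumes xs: "fst ` set xs \<subseteq> all_edges n" "\<And>e. edge_mult xs e \<ge> 0"
    and "defect sd (coded xs) (l, code {u, v}, g) = 0" "u < n" "v < n" "g > 0"
  shows "{u, v} \<in> stream_edges xs"
proof -
  let ?x = "code {u, v}"
  define S where "S = (\<Sum>e\<in>all_edges n. edge_mult xs e * (if same_cell (sd ! l) (code e) ?x then (int (code e) - int ?x)\<^sup>2 else 0))"
  define w where "w = (\<Sum>e\<in>all_edges n. edge_mult xs e * (if same_cell (sd ! l) (code e) ?x then 1 else 0))"
  have "S \<ge> 0" unfolding S_def using xs(2) by (intro sum_nonneg) auto
  moreover have "S + (w - int g)\<^sup>2 = 0" using assms(3) unfolding defect_coded[OF xs(1)] S_def w_def .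
  ultimately have S0: "S = 0" and "(w - int g)\<^sup>2 = 0" by (smt (verit) zero_le_power2)+
  hence "w > 0" using assms(6) by simp
  then obtain e where e: "e \<in> all_edges n" "edge_mult xs e * (if same_cell (sd ! l) (code e) ?x then 1 else 0) \<noteq> 0"
    unfolding w_def by (metis (no_types, lifting) less_irrefl sum.neutral)
  have "edge_mult xs e * (if same_cell (sd ! l) (code e) ?x then (int (code e) - int ?x)\<^sup>2 else 0) = 0"
    using S0 e(1) xs(2) unfolding S_def by (subst (asm) sum_nonneg_eq_0_iff) (auto simp: finite_all_edges)
  hence "code e = ?x" using e(2) by (auto split: if_splits)
  hence "e = {u, v}" using code_edge_eq_iff[OF e(1) assms(4,5)] by simp
  thus ?thesis using e(2) xs(2)[of e] by (auto simp: stream_edges_def split: if_splits)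
qed

lemma defect_eq_0_of_isolated:
  assumes xs: "fst ` set xs \<subseteq> all_edges n" "\<And>e. edge_mult xs e \<ge> 0"
    and e: "e \<in> all_edges n" "edge_mult xs e = int g"
    and isolated: "\<And>e'. e' \<in> stream_edges xs \<Longrightarrow> e' \<noteq> e \<Longrightarrow> \<not> same_cell (sd ! l) (code e') (code e)"
  shows "defect sd (coded xs) (l, code e, g) = 0"
proof -
  have z: "edge_mult xs e' * (if same_cell (sd ! l) (code e') (code e) then h e' else 0) = (if e' = e then int g * h e else 0)"
    for e' and h :: "nat set \<Rightarrow> int"
  proof (cases "e' = e")
    case True
    thus ?thesis using e(2) by (simp add: same_cell_def)
  next
    case False
    thus ?thesis using isolated[of e'] xs(2)[of e'] by (auto simp: stream_edges_def)
  qed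
  show ?thesis
    unfolding defect_coded[OF xs(1)] z[of _ "\<lambda>e'. (int (code e') - int (code e))\<^sup>2"] z[of _ "\<lambda>_. 1"]
    using finite_all_edges[of n] e by simp
qed

section \<open>Existence of isolating hash functions\<close>

lemma same_cell_imp_bucket_eq: "same_cell s x x' \<Longrightarrow> bucket s x = bucket s x'"
  unfolding same_cell_def row_def col_def by (metis div_mult_mod_eq)

definition crowded :: "nat set set \<Rightarrow> nat \<Rightarrow> nat set \<Rightarrow> bool" where
  "crowded E s e \<longleftrightarrow> (\<exists>e'\<in>E. e' \<noteq> e \<and> same_cell s (code e') (code e))"

text \<open>Averaging over the seeds: two edges collide for a fraction of at most
  \<open>4 / (H * C)\<close> of them, so by the union bound an edge is crowded with probability at
  most \<open>4 * m / (H * C)\<close>, which is at most \<open>1 / q\<close>.\<close>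

lemma ex_seed_few_crowded:
  assumes E: "E \<subseteq> all_edges n" "card E \<le> m" "4 * m * q \<le> H * C" "m > 0" and S: "S \<subseteq> E"
  shows "\<exists>s<p. card {e\<in>S. crowded E s e} * q \<le> card S"
proof (rule ccontr)
  assume no: "\<not> ?thesis"
  have "card S + 1 \<le> card {e\<in>S. crowded E s e} * q" if "s < p" for s
  proof -
    have "\<not> card {e\<in>S. crowded E s e} * q \<le> card S" using no that by blast
    thus ?thesis by linarith
  qed
  hence "(\<Sum>s<p. card S + 1) \<le> (\<Sum>s<p. card {e\<in>S. crowded E s e} * q)" by (intro sum_mono) auto
  hence many: "p * (card S + 1) \<le> (\<Sum>s<p. card {e\<in>S. crowded E s e}) * q" by (simp add: sum_distrib_right)
  have fE: "finite E" using E(1) finite_all_edges by (rule finite_subset)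
  have fS: "finite S" using S fE by (rule finite_subset)
  have "(\<Sum>s<p. card {e\<in>S. crowded E s e}) = (\<Sum>s<p. \<Sum>e\<in>S. if crowded E s e then 1 else 0)"
    using fS by (intro sum.cong) (auto simp: sum.If_cases Int_def)
  also have "\<dots> \<le> (\<Sum>s<p. \<Sum>e\<in>S. \<Sum>e'\<in>E - {e}. if bucket s (code e') = bucket s (code e) then 1 else 0)"
  proof (intro sum_mono)
    fix s e
    show "(if crowded E s e then 1 else 0) \<le> (\<Sum>e'\<in>E - {e}. if bucket s (code e') = bucket s (code e) then 1 else (0::nat))"
    proof (cases "crowded E s e")
      case True
      then obtain e' where "e' \<in> E - {e}" "bucket s (code e') = bucket s (code e)"
        by (auto simp: crowded_def dest: same_cell_imp_bucket_eq)
      thus ?thesis using True fE member_le_sum[of e' "E - {e}" "\<lambda>e'. if bucket s (code e') = bucket s (code e) then 1 else (0::nat)"] by simp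
    qed simp
  qed
  also have "\<dots> = (\<Sum>e\<in>S. \<Sum>s<p. \<Sum>e'\<in>E - {e}. if bucket s (code e') = bucket s (code e) then 1 else 0)"
    by (rule sum.swap)
  also have "\<dots> = (\<Sum>e\<in>S. \<Sum>e'\<in>E - {e}. \<Sum>s<p. if bucket s (code e') = bucket s (code e) then 1 else 0)"
    by (intro sum.cong refl sum.swap)
  also have "\<dots> = (\<Sum>e\<in>S. \<Sum>e'\<in>E - {e}. card {s\<in>{..<p}. bucket s (code e') = bucket s (code e)})"
    by (intro sum.cong) (auto simp: sum.If_cases Int_def)
  finally have "(\<Sum>s<p. card {e\<in>S. crowded E s e}) * (H * C)
     \<le> (\<Sum>e\<in>S. \<Sum>e'\<in>E - {e}. card {s\<in>{..<p}. bucket s (code e') = bucket s (code e)}) * (H * C)" by (rule mult_le_mono1)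
  also have "\<dots> = (\<Sum>e\<in>S. \<Sum>e'\<in>E - {e}. card {s\<in>{..<p}. bucket s (code e') = bucket s (code e)} * (H * C))"
    by (simp only: sum_distrib_right)
  also have "\<dots> \<le> (\<Sum>e\<in>S. \<Sum>e'\<in>E - {e}. 4 * p)"
  proof (intro sum_mono)
    fix e e' assume *: "e \<in> S" "e' \<in> E - {e}"
    hence ee: "e \<in> all_edges n" "e' \<in> all_edges n" using S E by auto
    then obtain u v where uv: "e = {u, v}" "u < n" "v < n" using all_edgesE[of e] by metis
    hence "code e' \<noteq> code e" using code_edge_eq_iff[OF ee(2) uv(2,3)] * by auto
    thus "card {s\<in>{..<p}. bucket s (code e') = bucket s (code e)} * (H * C) \<le> 4 * p"
      unfolding bucket_def using prime_p H_pos C_pos HC_le code_less by (intro card_collisions_le) auto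
  qed
  also have "\<dots> \<le> (\<Sum>e\<in>S. m * (4 * p))"
  proof (intro sum_mono)
    fix e
    have "card (E - {e}) \<le> m" using E(2) fE by (meson Diff_subset card_mono le_trans)
    thus "(\<Sum>e'\<in>E - {e}. 4 * p) \<le> m * (4 * p)" by (simp only: sum_constant of_nat_id mult_le_mono1)
  qed
  finally have few: "(\<Sum>s<p. card {e\<in>S. crowded E s e}) * (H * C) \<le> card S * (m * (4 * p))" by simp
  define K where "K = (\<Sum>s<p. card {e\<in>S. crowded E s e})"
  \<comment> \<open>After scaling by \<open>4 * m\<close> the hypothesis on \<open>4 * m * q\<close>
    applies without any division.\<close>
  have "(4 * m) * (p * (card S + 1)) \<le> (4 * m) * (K * q)" using many unfolding K_def by (rule mult_le_mono2)
  also have "\<dots> = K * (4 * m * q)" by (simp add: algebra_simps)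
  also have "\<dots> \<le> K * (H * C)" using E(3) by (rule mult_le_mono2)
  also have "\<dots> \<le> card S * (m * (4 * p))" using few unfolding K_def .
  also have "\<dots> = (4 * m) * (p * card S)" by (simp add: algebra_simps)
  finally show False using p_gt_0 E(4) by simp
qed

text \<open>Crowding is always measured against all of \<open>E\<close>, but a new seed has to serve
  only the edges crowded under all earlier seeds. The factor \<open>q ^ k\<close> avoids rounding,
  and \<open>m < q ^ L\<close> leaves no room for a remaining edge.\<close>

lemma ex_isolating_seeds:
  assumes E: "E \<subseteq> all_edges n" "card E \<le> m" "4 * m * q \<le> H * C" "0 < m" "m < q ^ L"
  shows "\<exists>sd. length sd = L \<and> set sd \<subseteq> {..<p} \<and> (\<forall>e\<in>E. \<exists>l<L. \<not> crowded E (sd ! l) e)"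
proof -
  have fE: "finite E" using E(1) finite_all_edges by (rule finite_subset)
  have "\<exists>sd. length sd = k \<and> set sd \<subseteq> {..<p} \<and> card {e\<in>E. \<forall>l<k. crowded E (sd ! l) e} * q ^ k \<le> card E" for k
  proof (induction k)
    case (Suc k)
    then obtain sd where sd: "length sd = k" "set sd \<subseteq> {..<p}" "card {e\<in>E. \<forall>l<k. crowded E (sd ! l) e} * q ^ k \<le> card E" by blast
    define S where "S = {e\<in>E. \<forall>l<k. crowded E (sd ! l) e}"
    obtain s where s: "s < p" "card {e\<in>S. crowded E s e} * q \<le> card S"
      using ex_seed_few_crowded[OF E(1-4), of S] by (auto simp: S_def)
    have "{e\<in>E. \<forall>l<Suc k. crowded E ((sd @ [s]) ! l) e} = {e\<in>S. crowded E s e}"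
      using sd(1) by (auto simp: S_def less_Suc_eq nth_append)
    moreover have "card {e\<in>S. crowded E s e} * q ^ Suc k \<le> card E"
    proof -
      have "card {e\<in>S. crowded E s e} * q ^ Suc k = card {e\<in>S. crowded E s e} * q * q ^ k" by simp
      also have "\<dots> \<le> card S * q ^ k" using s(2) by (rule mult_le_mono1)
      also have "\<dots> \<le> card E" using sd(3) unfolding S_def .
      finally show ?thesis .
    qed
    ultimately show ?case using sd s by (intro exI[of _ "sd @ [s]"]) auto
  qed simp
  then obtain sd where sd: "length sd = L" "set sd \<subseteq> {..<p}" "card {e\<in>E. \<forall>l<L. crowded E (sd ! l) e} * q ^ L \<le> card E" by blast
  have "card {e\<in>E. \<forall>l<L. crowded E (sd ! l) e} = 0"
  proof (rule ccontr)
    assume "card {e\<in>E. \<forall>l<L. crowded E (sd ! l) e} \<noteq> 0"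
    hence "1 * q ^ L \<le> card {e\<in>E. \<forall>l<L. crowded E (sd ! l) e} * q ^ L" by (intro mult_le_mono1) simp
    thus False using sd(3) E(2,5) by linarith
  qed
  hence "{e\<in>E. \<forall>l<L. crowded E (sd ! l) e} = {}" using fE by simp
  thus ?thesis using sd by blast
qed

end

section \<open>The protocol\<close>

lemma dvd_cong_iff: "[a = b] (mod m) \<Longrightarrow> m dvd a \<longleftrightarrow> m dvd (b :: int)"
  by (simp add: cong_def dvd_eq_mod_eq_0)

lemma sum_powers_le: "2 \<le> (a::nat) \<Longrightarrow> (\<Sum>i\<le>k. a ^ i) \<le> a ^ (k + 1)"
proof (induction k)
  case (Suc k)
  have "(\<Sum>i\<le>Suc k. a ^ i) \<le> a ^ (k + 1) + a ^ (k + 1)" using Suc by simp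
  also have "\<dots> = 2 * a ^ (k + 1)" by simp
  also have "\<dots> \<le> a * a ^ (k + 1)" using Suc.prems by (rule mult_le_mono1)
  finally show ?case by simp
qed simp

lemma card_short_lists_le:
  assumes "finite A" "card A \<le> a" "2 \<le> a"
  shows "finite {xs. set xs \<subseteq> A \<and> length xs \<le> k}" "card {xs. set xs \<subseteq> A \<and> length xs \<le> k} \<le> a ^ (k + 1)"
proof -
  show "finite {xs. set xs \<subseteq> A \<and> length xs \<le> k}" using assms(1) by (rule finite_lists_length_le)
  have "card {xs. set xs \<subseteq> A \<and> length xs \<le> k} = (\<Sum>i\<le>k. card A ^ i)" using assms(1) by (rule card_lists_length_le)
  also have "\<dots> \<le> (\<Sum>i\<le>k. a ^ i)" using assms(2) by (intro sum_mono power_mono) auto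
  finally show "card {xs. set xs \<subseteq> A \<and> length xs \<le> k} \<le> a ^ (k + 1)" using sum_powers_le[OF assms(3)] le_trans by blast
qed

text \<open>A certificate for \<open>F\<close> is a list of oriented and possibly flagged edges of the graph that is accepted
  by a finite automaton and in which the marked vertices are those of \<open>T\<close>, each marked once. The
  automaton is small enough to be run by the verifier, and the marks are compared with \<open>T\<close> by evaluating
  a polynomial at the random point.\<close>

locale certificate =
  fixes n :: nat and F :: "nat set set \<Rightarrow> bool"
    and z0 :: 'z and zstep :: "'z \<Rightarrow> nat \<times> nat \<times> bool \<Rightarrow> 'z" and zacc :: "'z \<Rightarrow> bool" and Z :: "'z set"
    and marks :: "nat \<times> nat \<times> bool \<Rightarrow> nat list" and T :: "nat set"
  assumes finite_Z: "finite Z" and z0_in: "z0 \<in> Z"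
    and zstep_in: "\<And>z u v c. z \<in> Z \<Longrightarrow> u < n \<Longrightarrow> v < n \<Longrightarrow> zstep z (u, v, c) \<in> Z"
    and marks_less: "\<And>u v c x. u < n \<Longrightarrow> v < n \<Longrightarrow> x \<in> set (marks (u, v, c)) \<Longrightarrow> x < n"
    and length_marks: "\<And>a. length (marks a) \<le> 2"
    and T_less: "T \<subseteq> {..<n}"
    and certificate_sound: "\<And>E ps. E \<subseteq> all_edges n \<Longrightarrow> (\<And>u v c. (u, v, c) \<in> set ps \<Longrightarrow> {u, v} \<in> E) \<Longrightarrow>
      zacc (foldl zstep z0 ps) \<Longrightarrow>
      (\<And>v. count_list (concat (map marks ps)) v = (if v \<in> T then 1 else 0)) \<Longrightarrow> F E"
    and certificate_complete: "\<And>E. E \<subseteq> all_edges n \<Longrightarrow> F E \<Longrightarrow> \<exists>ps. ps \<noteq> [] \<and> length ps \<le> 2 * n \<and>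
      (\<forall>u v c. (u, v, c) \<in> set ps \<longrightarrow> {u, v} \<in> E) \<and> zacc (foldl zstep z0 ps) \<and>
      (\<forall>v. count_list (concat (map marks ps)) v = (if v \<in> T then 1 else 0))"

text \<open>A word carries at most one claim; the empty list is the padding that lets every
  certificate fill exactly \<open>2 * n\<close> words. Multiplicity 0 is excluded because a claim
  has to prove that its edge exists.\<close>

definition claim_words :: "nat \<Rightarrow> nat \<Rightarrow> nat \<Rightarrow> (nat \<times> nat \<times> nat \<times> nat \<times> bool) list set" where
  "claim_words n b L = insert [] ((\<lambda>c. [c]) ` ({..<L} \<times> {..<n} \<times> {..<n} \<times> {1..b} \<times> UNIV))"

text \<open>\<open>dcl\<close> and \<open>dec\<close> stay in range on all inputs, so a dishonest
  annotation is still a list of well-typed claims. By \<open>big\<close>, the sum of all defects and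
  the numbers of marks are below \<open>p\<close>, where zero modulo \<open>p\<close> means zero.
  \<open>card_Z\<close> and \<open>words\<close> let the automaton state and the word counter fit
  into one residue each, and \<open>cells\<close> provides isolating seeds.\<close>

locale protocol = bucket_check n p H C L + certificate n F z0 zstep zacc Z marks T
  for n p H C L :: nat and F :: "nat set set \<Rightarrow> bool"
    and z0 :: 'z and zstep :: "'z \<Rightarrow> nat \<times> nat \<times> bool \<Rightarrow> 'z" and zacc :: "'z \<Rightarrow> bool" and Z :: "'z set"
    and marks :: "nat \<times> nat \<times> bool \<Rightarrow> nat list" and T :: "nat set" +
  fixes b m q W :: nat and dcl :: "nat \<Rightarrow> (nat \<times> nat \<times> nat \<times> nat \<times> bool) list"
    and ecl :: "(nat \<times> nat \<times> nat \<times> nat \<times> bool) list \<Rightarrow> nat"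
    and enc :: "nat \<Rightarrow> bool list" and dec :: "bool list \<Rightarrow> nat"
  assumes W_pos: "W > 0" and p_le: "p \<le> 2 ^ W"
    and dcl_in: "\<And>k. dcl k \<in> claim_words n b L"
    and dcl_ecl: "\<And>c. c \<in> claim_words n b L \<Longrightarrow> ecl c < p \<and> dcl (ecl c) = c"
    and length_enc: "\<And>x. length (enc x) = W" and dec_enc: "\<And>x. x < p \<Longrightarrow> dec (enc x) = x"
    and dec_less: "\<And>bs. dec bs < p"
    and big: "2 * n * (n ^ 2 * b * n ^ 4 + (n ^ 2 * b + b) ^ 2) < p" "4 * n < p"
    and card_Z: "card Z \<le> p"
    and cells: "4 * m * q \<le> H * C" "0 < m" "m < q ^ L"
    and words: "L + 2 * n + 3 * H < p"
begin

definition seeds :: "nat list \<Rightarrow> nat list" where "seeds bs = take L bs"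
definition claims :: "nat list \<Rightarrow> (nat \<times> nat \<times> nat \<times> nat \<times> bool) list" where
  "claims bs = concat (map dcl (take (2 * n) (drop L bs)))"
definition coefs :: "nat list \<Rightarrow> nat list" where "coefs bs = drop (L + 2 * n) bs"

definition keyed :: "(nat \<times> nat \<times> nat \<times> nat \<times> bool) list \<Rightarrow> (nat \<times> nat \<times> nat) list" where
  "keyed cs = map (\<lambda>(l, u, v, g, c). (l, code {u, v}, g)) cs"
definition path :: "(nat \<times> nat \<times> nat \<times> nat \<times> bool) list \<Rightarrow> (nat \<times> nat \<times> bool) list" where
  "path cs = map (\<lambda>(l, u, v, g, c). (u, v, c)) cs"

definition marked :: "nat \<Rightarrow> (nat \<times> nat \<times> nat \<times> nat \<times> bool) list \<Rightarrow> int" where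
  "marked \<gamma> cs = (\<Sum>v\<leftarrow>concat (map marks (path cs)). int \<gamma> ^ v)"
definition squares :: "(nat \<times> nat \<times> nat \<times> nat \<times> bool) list \<Rightarrow> int" where
  "squares cs = (\<Sum>(l, x, g)\<leftarrow>keyed cs. (int g)\<^sup>2)"
text \<open>Used for two functionals of the announced polynomial while its coefficients arrive:
  powers of \<gamma> give its value at the random point, and the power sums
  \<open>\<Sum>y<H. int y ^ i\<close> give its sum over all rows.\<close>

definition combine :: "(nat \<Rightarrow> int) \<Rightarrow> nat list \<Rightarrow> int" where
  "combine h ks = (\<Sum>i<length ks. int (ks ! i) * h i)"

text \<open>The first annotation bit comes after the first stream element. Hence this one element has to be
  kept until the seeds of the hash functions are known, and all others must come after the seeds.\<close>

definition well_formed :: "(update + nat) list \<Rightarrow> bool" where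
  "well_formed ms \<longleftrightarrow> length (rights ms) \<le> L + 2 * n + 3 * H \<and>
     (\<forall>ms1 u ms2. ms = ms1 @ Inl u # ms2 \<longrightarrow> lefts ms1 = [] \<or> L \<le> length (rights ms1))"

text \<open>In a well-formed sequence at most one stream element precedes the last seed, so this
  costs a constant number of residues.\<close>

definition pending :: "(update + nat) list \<Rightarrow> (nat \<times> int) list" where
  "pending ms = (if length (rights ms) < L then map (\<lambda>(x, d). (x, d mod int p)) (coded (lefts ms)) else [])"

text \<open>Without all the seeds an element cannot be placed in a cell; until then the registers
  are 0 and \<open>pending\<close> stands in for them.\<close>

definition Areg :: "nat \<Rightarrow> (update + nat) list \<Rightarrow> nat \<times> nat \<times> nat \<Rightarrow> int" where
  "Areg \<gamma> ms = restrict (\<lambda>(j, l, t). if length (rights ms) < L then 0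
     else poly (Apoly (seeds (rights ms)) (coded (lefts ms)) j l t) (int \<gamma>) mod int p) ({..<3} \<times> {..<L} \<times> {..<C})"

definition Breg :: "nat \<Rightarrow> (update + nat) list \<Rightarrow> nat \<times> nat \<times> nat \<Rightarrow> int" where
  "Breg \<gamma> ms = restrict (\<lambda>(j, l, t).
     poly (Bpoly (seeds (rights ms)) (keyed (claims (rights ms))) j l t) (int \<gamma>) mod int p) ({..<4} \<times> {..<L} \<times> {..<C})"

text \<open>\<open>None\<close> is absorbing and rejects. The random point is part of the summary
  because later updates use it, and so it is charged to the space.\<close>

definition summary where
  "summary \<gamma> ms = (if well_formed ms then Some
     ((\<gamma>, length (rights ms), seeds (rights ms), pending ms),
      (foldl zstep z0 (path (claims (rights ms))), Areg \<gamma> ms, Breg \<gamma> ms),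
      (marked \<gamma> (claims (rights ms)) mod int p,
       squares (claims (rights ms)) mod int p,
       combine (\<lambda>i. int \<gamma> ^ i) (coefs (rights ms)) mod int p,
       combine (\<lambda>i. \<Sum>y<H. int y ^ i) (coefs (rights ms)) mod int p)) else None)"

section \<open>Updating the summary\<close>

lemma well_formed_snoc:
  "well_formed (ms @ [t]) \<longleftrightarrow> well_formed ms \<and> (case t of
     Inl u \<Rightarrow> lefts ms = [] \<or> L \<le> length (rights ms)
   | Inr k \<Rightarrow> length (rights ms) < L + 2 * n + 3 * H)"
proof -
  have split: "ms @ [t] = ms1 @ Inl u # ms2 \<longleftrightarrow>
     (ms2 = [] \<and> ms1 = ms \<and> t = Inl u) \<or> (\<exists>ms3. ms2 = ms3 @ [t] \<and> ms = ms1 @ Inl u # ms3)" for ms1 u ms2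
    by (cases ms2 rule: rev_cases) auto
  have "(\<forall>ms1 u ms2. ms @ [t] = ms1 @ Inl u # ms2 \<longrightarrow> lefts ms1 = [] \<or> L \<le> length (rights ms1)) \<longleftrightarrow>
    (\<forall>ms1 u ms2. ms = ms1 @ Inl u # ms2 \<longrightarrow> lefts ms1 = [] \<or> L \<le> length (rights ms1)) \<and>
    (\<forall>u. t = Inl u \<longrightarrow> lefts ms = [] \<or> L \<le> length (rights ms))"
    unfolding split by blast
  thus ?thesis unfolding well_formed_def by (cases t) auto
qed

lemma length_lefts_le_1:
  "well_formed ms \<Longrightarrow> length (rights ms) < L \<Longrightarrow> length (lefts ms) \<le> 1"
proof (induction ms rule: rev_induct)
  case (snoc t ms)
  thus ?case by (cases t) (auto simp: well_formed_snoc)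
qed simp

lemma claims_snoc: "claims (bs @ [k]) = claims bs @ (if L \<le> length bs \<and> length bs < L + 2 * n then dcl k else [])"
  by (auto simp: claims_def not_le not_less less_diff_conv2)

lemma claims_short: "length bs \<le> L \<Longrightarrow> claims bs = []"
  by (simp add: claims_def)

lemma coefs_snoc: "coefs (bs @ [k]) = coefs bs @ (if L + 2 * n \<le> length bs then [k] else [])"
  by (auto simp: coefs_def)

lemma seeds_snoc: "seeds (bs @ [k]) = (if length bs < L then seeds bs @ [k] else seeds bs)"
  by (auto simp: seeds_def)

lemma combine_snoc: "combine h (ks @ [k]) = combine h ks + int k * h (length ks)"
proof -
  have "(\<Sum>i<length ks. int ((ks @ [k]) ! i) * h i) = (\<Sum>i<length ks. int (ks ! i) * h i)"
    by (intro sum.cong) (auto simp: nth_append)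
  thus ?thesis by (simp add: combine_def)
qed

lemma Apoly_append: "Apoly sd (es @ es') j l t = Apoly sd es j l t + Apoly sd es' j l t"
  by (simp add: Apoly_def)

lemma Bpoly_append: "Bpoly sd (cs @ cs') j l t = Bpoly sd cs j l t + Bpoly sd cs' j l t"
  by (simp add: Bpoly_def)

lemma Areg_eq_iff: "Areg \<gamma> ms = Areg \<gamma>' ms' \<longleftrightarrow> (\<forall>j<3. \<forall>l<L. \<forall>t<C.
   (if length (rights ms) < L then 0 else poly (Apoly (seeds (rights ms)) (coded (lefts ms)) j l t) (int \<gamma>) mod int p) =
   (if length (rights ms') < L then 0 else poly (Apoly (seeds (rights ms')) (coded (lefts ms')) j l t) (int \<gamma>') mod int p))"
  unfolding Areg_def restrict_def fun_eq_iff by auto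

lemma Breg_eq_iff: "Breg \<gamma> ms = Breg \<gamma>' ms' \<longleftrightarrow> (\<forall>j<4. \<forall>l<L. \<forall>t<C.
   poly (Bpoly (seeds (rights ms)) (keyed (claims (rights ms))) j l t) (int \<gamma>) mod int p =
   poly (Bpoly (seeds (rights ms')) (keyed (claims (rights ms'))) j l t) (int \<gamma>') mod int p)"
  unfolding Breg_def restrict_def fun_eq_iff by auto

text \<open>The delicate update is the last seed, where the registers are computed from
  \<open>pending\<close>. Afterwards a stream element is added by linearity, and an annotation word
  changes nothing.\<close>

lemma Areg_snoc:
  assumes "length (rights ms) = length (rights ms')" "seeds (rights ms) = seeds (rights ms')"
    "pending ms = pending ms'" "Areg \<gamma> ms = Areg \<gamma> ms'"
  shows "Areg \<gamma> (ms @ [t]) = Areg \<gamma> (ms' @ [t])"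
proof (cases t)
  case (Inl u)
  obtain e d where u: "u = (e, d)" by (cases u)
  show ?thesis
  proof (cases "length (rights ms) < L")
    case False
    hence "poly (Apoly (seeds (rights ms)) (coded (lefts ms)) j l t) (int \<gamma>) mod int p =
      poly (Apoly (seeds (rights ms)) (coded (lefts ms')) j l t) (int \<gamma>) mod int p" if "j < 3" "l < L" "t < C" for j l t
      using assms that unfolding Areg_eq_iff by simp
    from mod_add_cong[OF this refl] show ?thesis
      using False assms(1,2) unfolding Areg_eq_iff by (simp add: Inl coded_def Apoly_append)
  qed (use assms(1) in \<open>simp add: Areg_eq_iff Inl\<close>)
next
  case (Inr k)
  show ?thesis
  proof (cases "length (rights ms) < L")
    case True
    hence "map (\<lambda>(x, d). (x, d mod int p)) (coded (lefts ms)) = map (\<lambda>(x, d). (x, d mod int p)) (coded (lefts ms'))"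
      using assms(1,3) by (simp add: pending_def)
    hence "poly (Apoly sd (coded (lefts ms)) j l t) z mod int p = poly (Apoly sd (coded (lefts ms')) j l t) z mod int p" for sd j l t z
      by (metis poly_Apoly_mod)
    thus ?thesis using True assms(1,2) unfolding Areg_eq_iff by (simp add: Inr seeds_snoc)
  next
    case False
    thus ?thesis using assms(1,2,4) unfolding Areg_eq_iff by (simp add: Inr seeds_snoc)
  qed
qed

text \<open>While seeds arrive there are no claims; afterwards the seeds are fixed and the registers
  are linear in the claims.\<close>

lemma Breg_snoc:
  assumes "length (rights ms) = length (rights ms')" "seeds (rights ms) = seeds (rights ms')" "Breg \<gamma> ms = Breg \<gamma> ms'"
  shows "Breg \<gamma> (ms @ [t]) = Breg \<gamma> (ms' @ [t])"
proof (cases t)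
  case (Inl u)
  thus ?thesis using assms unfolding Breg_eq_iff by simp
next
  case (Inr k)
  show ?thesis
  proof (cases "length (rights ms) < L")
    case True
    thus ?thesis using assms(1) unfolding Breg_eq_iff by (simp add: Inr claims_short keyed_def Bpoly_def)
  next
    case False
    have "poly (Bpoly (seeds (rights ms)) (keyed (claims (rights ms))) j l t) (int \<gamma>) mod int p =
      poly (Bpoly (seeds (rights ms)) (keyed (claims (rights ms'))) j l t) (int \<gamma>) mod int p" if "j < 4" "l < L" "t < C" for j l t
      using assms that unfolding Breg_eq_iff by simp
    from this mod_add_cong[OF this refl] show ?thesis
      using False assms(1,2) unfolding Breg_eq_iff by (simp add: Inr seeds_snoc claims_snoc keyed_def Bpoly_append)
  qed
qed

text \<open>This is what makes the summary a streaming algorithm. Even \<open>well_formed\<close>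
  can be maintained: while seeds are missing, \<open>pending\<close> is empty exactly if no stream
  element has been read.\<close>

lemma summary_snoc:
  assumes "summary \<gamma> ms = summary \<gamma>' ms'"
  shows "summary \<gamma> (ms @ [t]) = summary \<gamma>' (ms' @ [t])"
proof (cases "well_formed ms")
  case False
  hence "\<not> well_formed ms'" using assms by (auto simp: summary_def split: if_splits)
  thus ?thesis using False by (simp add: summary_def well_formed_snoc)
next
  case True
  hence wf': "well_formed ms'" using assms by (auto simp: summary_def split: if_splits)
  note eqs = assms[unfolded summary_def if_P[OF True] if_P[OF wf'] option.inject prod.inject]
  have g: "\<gamma>' = \<gamma>" and len: "length (rights ms) = length (rights ms')" and sd: "seeds (rights ms) = seeds (rights ms')"
    and pe: "pending ms = pending ms'" and A: "Areg \<gamma> ms = Areg \<gamma> ms'" and B: "Breg \<gamma> ms = Breg \<gamma> ms'"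
    using eqs by auto
  have "lefts ms = [] \<or> L \<le> length (rights ms) \<longleftrightarrow> lefts ms' = [] \<or> L \<le> length (rights ms')"
    using pe len by (auto simp: pending_def coded_def split: if_splits)
  hence wf: "well_formed (ms @ [t]) \<longleftrightarrow> well_formed (ms' @ [t])"
    using True wf' len by (cases t) (simp_all add: well_formed_snoc)
  have len': "length (rights (ms @ [t])) = length (rights (ms' @ [t]))"
    using len by (cases t) auto
  have sd': "seeds (rights (ms @ [t])) = seeds (rights (ms' @ [t]))"
    using len sd by (cases t) (auto simp: seeds_snoc)
  have pe': "pending (ms @ [t]) = pending (ms' @ [t])"
    using len pe by (cases t) (auto simp: pending_def coded_def split: if_splits)
  have z': "foldl zstep z0 (path (claims (rights (ms @ [t])))) = foldl zstep z0 (path (claims (rights (ms' @ [t]))))"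
    using eqs len by (cases t) (auto simp: claims_snoc path_def)
  have m': "marked \<gamma> (claims (rights (ms @ [t]))) mod int p = marked \<gamma> (claims (rights (ms' @ [t]))) mod int p"
    using eqs len by (cases t) (auto simp: claims_snoc path_def marked_def intro: mod_add_cong)
  have s': "squares (claims (rights (ms @ [t]))) mod int p = squares (claims (rights (ms' @ [t]))) mod int p"
    using eqs len by (cases t) (auto simp: claims_snoc keyed_def squares_def intro: mod_add_cong)
  have c': "combine h (coefs (rights (ms @ [t]))) mod int p = combine h (coefs (rights (ms' @ [t]))) mod int p"
    if "combine h (coefs (rights ms)) mod int p = combine h (coefs (rights ms')) mod int p" for h
    using that len by (cases t) (auto simp: coefs_snoc combine_snoc coefs_def[of "rights ms"] coefs_def[of "rights ms'"] intro: mod_add_cong)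
  have v': "combine (\<lambda>i. int \<gamma> ^ i) (coefs (rights (ms @ [t]))) mod int p = combine (\<lambda>i. int \<gamma> ^ i) (coefs (rights (ms' @ [t]))) mod int p"
    by (rule c') (use eqs g in simp)
  have w': "combine (\<lambda>i. \<Sum>y<H. int y ^ i) (coefs (rights (ms @ [t]))) mod int p = combine (\<lambda>i. \<Sum>y<H. int y ^ i) (coefs (rights (ms' @ [t]))) mod int p"
    by (rule c') (use eqs in simp)
  show ?thesis
  proof (cases "well_formed (ms @ [t])")
    case True
    hence True': "well_formed (ms' @ [t])" using wf by blast
    show ?thesis
      unfolding summary_def if_P[OF True] if_P[OF True'] g
      by (simp only: len' sd' pe' z' Areg_snoc[OF len sd pe A, of t] Breg_snoc[OF len sd B, of t] m' s' v' w')
  next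
    case False
    thus ?thesis using wf by (simp only: summary_def if_False)
  qed
qed

lemma claims_in:
  assumes "(l, u, v, g, c) \<in> set (claims bs)"
  shows "l < L" "u < n" "v < n" "1 \<le> g" "g \<le> b"
proof -
  obtain k where "(l, u, v, g, c) \<in> set (dcl k)" using assms by (auto simp: claims_def)
  thus "l < L" "u < n" "v < n" "1 \<le> g" "g \<le> b" using dcl_in[of k] by (auto simp: claim_words_def)
qed

lemma length_claims_le: "length (claims bs) \<le> 2 * n"
proof -
  have "length (dcl k) \<le> 1" for k using dcl_in[of k] by (auto simp: claim_words_def)
  hence "length (concat (map dcl ks)) \<le> length ks" for ks
    by (induction ks) (auto intro: order.trans[OF add_mono])
  from order.trans[OF this] show ?thesis by (simp add: claims_def)
qed

lemma foldl_zstep_in: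
  assumes "\<And>u v c. (u, v, c) \<in> set ps \<Longrightarrow> u < n \<and> v < n"
  shows "foldl zstep z0 ps \<in> Z"
  using assms
proof (induction ps rule: rev_induct)
  case (snoc a ps)
  obtain u v c where a: "a = (u, v, c)" by (cases a)
  have "u < n" "v < n" using snoc.prems[of u v c] a by auto
  moreover have "foldl zstep z0 ps \<in> Z" using snoc.prems by (intro snoc.IH) auto
  ultimately show ?case using zstep_in a by simp
qed (simp add: z0_in)

lemma path_claims_in:
  assumes "(u, v, c) \<in> set (path (claims bs))"
  shows "u < n \<and> v < n"
  using assms claims_in(2,3) by (fastforce simp: path_def)

section \<open>Counting the configurations\<close>

abbreviation "residues \<equiv> {0..<int p}"

definition configurations where
  "configurations = insert None (Some `
    (({..<p} \<times> {..<p} \<times> {xs. set xs \<subseteq> {..<p} \<and> length xs \<le> L} \<times> {xs. set xs \<subseteq> {..<p} \<times> residues \<and> length xs \<le> 1}) \<times>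
     (Z \<times> (({..<3::nat} \<times> {..<L} \<times> {..<C}) \<rightarrow>\<^sub>E residues) \<times> (({..<4::nat} \<times> {..<L} \<times> {..<C}) \<rightarrow>\<^sub>E residues)) \<times>
     (residues \<times> residues \<times> residues \<times> residues)))"

lemma summary_in_configurations:
  assumes "\<gamma> < p" "set (rights ms) \<subseteq> {..<p}"
  shows "summary \<gamma> ms \<in> configurations"
proof (cases "well_formed ms")
  case True
  have r: "x mod int p \<in> residues" for x using p_gt_0 by simp
  have 1: "length (rights ms) \<in> {..<p}" using True words by (auto simp: well_formed_def)
  have 2: "seeds (rights ms) \<in> {xs. set xs \<subseteq> {..<p} \<and> length xs \<le> L}"
    using assms(2) by (auto simp: seeds_def dest: in_set_takeD)
  have 3: "pending ms \<in> {xs. set xs \<subseteq> {..<p} \<times> residues \<and> length xs \<le> 1}"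
    using length_lefts_le_1[OF True] code_less r p_gt_0 by (auto simp: pending_def coded_def)
  have 4: "foldl zstep z0 (path (claims (rights ms))) \<in> Z"
    by (rule foldl_zstep_in) (rule path_claims_in)
  have 5: "Areg \<gamma> ms \<in> ({..<3::nat} \<times> {..<L} \<times> {..<C}) \<rightarrow>\<^sub>E residues"
    using p_gt_0 unfolding Areg_def by (auto simp: restrict_def PiE_def extensional_def)
  have 6: "Breg \<gamma> ms \<in> ({..<4::nat} \<times> {..<L} \<times> {..<C}) \<rightarrow>\<^sub>E residues"
    using p_gt_0 unfolding Breg_def by (auto simp: restrict_def PiE_def extensional_def)
  show ?thesis
    unfolding summary_def if_P[OF True] configurations_def
    by (intro insertI2 imageI SigmaI 1 2 3 4 5 6 r) (use assms(1) in simp)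
qed (simp add: summary_def configurations_def)

lemma finite_configurations: "finite configurations"
  unfolding configurations_def using finite_Z
  by (intro finite.insertI finite_imageI finite_cartesian_product finite_PiE finite_lists_length_le) auto

text \<open>The exponent counts residues of \<open>W\<close> bits: \<open>7 * (L * C)\<close> for
  the registers, \<open>L + 1\<close> for the seeds, 3 for the pending element, 2 for the random
  point and the word counter, 1 for the automaton, 4 for the accumulators and 1 for the extra value
  \<open>None\<close>.\<close>

lemma card_configurations: "card configurations \<le> 2 ^ (W * (7 * (L * C) + L + 12))"
proof -
  have p2: "2 \<le> p" using prime_p prime_ge_2_nat by blast
  define S1 where "S1 = {xs. set xs \<subseteq> {..<p} \<and> length xs \<le> L}"
  define S2 where "S2 = {xs. set xs \<subseteq> {..<p} \<times> residues \<and> length xs \<le> 1}"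
  define P3 where "P3 = (({..<3::nat} \<times> {..<L} \<times> {..<C}) \<rightarrow>\<^sub>E residues)"
  define P4 where "P4 = (({..<4::nat} \<times> {..<L} \<times> {..<C}) \<rightarrow>\<^sub>E residues)"
  have c1: "card S1 \<le> p ^ (L + 1)" unfolding S1_def using p2 by (intro card_short_lists_le(2)) auto
  have "{xs. set xs \<subseteq> {..<p} \<times> residues \<and> length xs \<le> 1} \<subseteq> insert [] ((\<lambda>x. [x]) ` ({..<p} \<times> residues))"
  proof
    fix xs assume "xs \<in> {xs. set xs \<subseteq> {..<p} \<times> residues \<and> length xs \<le> 1}"
    thus "xs \<in> insert [] ((\<lambda>x. [x]) ` ({..<p} \<times> residues))" by (cases xs) auto
  qed
  hence "card S2 \<le> card (insert [] ((\<lambda>x. [x]) ` ({..<p} \<times> residues)))"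
    unfolding S2_def by (intro card_mono) auto
  also have "\<dots> \<le> Suc (card ((\<lambda>x. [x]) ` ({..<p} \<times> residues)))" by (rule card_insert_le_m1) auto
  also have "\<dots> \<le> Suc (card ({..<p} \<times> residues))" by (intro Suc_le_mono[THEN iffD2] card_image_le) auto
  also have "\<dots> = Suc (p * p)" by simp
  also have "\<dots> \<le> p ^ 3"
  proof -
    have "Suc (p * p) \<le> 2 * (p * p)" using p2 by simp
    also have "\<dots> \<le> p * (p * p)" using p2 by (rule mult_le_mono1)
    finally show ?thesis by (simp add: power3_eq_cube)
  qed
  finally have c2: "card S2 \<le> p ^ 3" .
  have c3: "card P3 = p ^ (3 * (L * C))" unfolding P3_def by (subst card_PiE) auto
  have c4: "card P4 = p ^ (4 * (L * C))" unfolding P4_def by (subst card_PiE) auto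
  have "card configurations \<le> Suc (card (({..<p} \<times> {..<p} \<times> S1 \<times> S2) \<times> (Z \<times> P3 \<times> P4) \<times> (residues \<times> residues \<times> residues \<times> residues)))"
    unfolding configurations_def S1_def S2_def P3_def P4_def
  proof (rule order.trans[OF card_insert_le_m1 Suc_le_mono[THEN iffD2, OF card_image_le]])
    show "finite (({..<p} \<times> {..<p} \<times> {xs. set xs \<subseteq> {..<p} \<and> length xs \<le> L} \<times> {xs. set xs \<subseteq> {..<p} \<times> residues \<and> length xs \<le> 1}) \<times>
     (Z \<times> (({..<3::nat} \<times> {..<L} \<times> {..<C}) \<rightarrow>\<^sub>E residues) \<times> (({..<4::nat} \<times> {..<L} \<times> {..<C}) \<rightarrow>\<^sub>E residues)) \<times>
     (residues \<times> residues \<times> residues \<times> residues))"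
      using finite_Z by (intro finite_cartesian_product finite_PiE finite_lists_length_le) auto
  qed auto
  also have "\<dots> = Suc (p * (p * (card S1 * card S2)) * (card Z * (card P3 * card P4)) * (p * (p * (p * p))))"
    by (simp only: card_cartesian_product card_lessThan card_atLeastLessThan_int) simp
  also have "\<dots> \<le> Suc (p * (p * (p ^ (L + 1) * p ^ 3)) * (p * (p ^ (3 * (L * C)) * p ^ (4 * (L * C)))) * (p * (p * (p * p))))"
    unfolding c3 c4 by (intro Suc_le_mono[THEN iffD2] mult_le_mono order.refl c1 c2 card_Z)
  also have "\<dots> = Suc (p ^ (7 * (L * C) + L + 11))"
  proof -
    have "p ^ (3 * (L * C)) * p ^ (4 * (L * C)) = p ^ (7 * (L * C))" by (simp only: power_add[symmetric] distrib_right[symmetric]) simp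
    moreover have "p ^ 11 = p * (p * (p * p ^ 3)) * p * (p * (p * (p * p)))"
      by (simp add: numeral_eq_Suc mult.assoc)
    ultimately show ?thesis unfolding power_add power_one_right by (simp only: mult_ac)
  qed
  also have "\<dots> \<le> 2 * p ^ (7 * (L * C) + L + 11)" using p_gt_0 by (simp add: Suc_le_eq)
  also have "\<dots> \<le> p * p ^ (7 * (L * C) + L + 11)" using p2 by (rule mult_le_mono1)
  also have "\<dots> = p ^ (7 * (L * C) + L + 12)" by (simp add: eval_nat_numeral)
  also have "\<dots> \<le> (2 ^ W) ^ (7 * (L * C) + L + 12)" using p_le by (rule power_mono) simp
  finally show ?thesis by (simp add: power_mult)
qed

section \<open>Acceptance and soundness\<close>

definition fpoly :: "(nat \<times> nat \<times> bool) list \<Rightarrow> int poly" where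
  "fpoly ps = (\<Sum>v\<leftarrow>concat (map marks ps). monom 1 v) - (\<Sum>v\<in>T. monom 1 v)"

definition Vpoly :: "nat list \<Rightarrow> int poly" where
  "Vpoly ks = (\<Sum>i<length ks. monom (int (ks ! i)) i)"

lemma poly_fpoly: "poly (fpoly (path cs)) (int \<gamma>) = marked \<gamma> cs - (\<Sum>v\<in>T. int \<gamma> ^ v)"
proof -
  have "poly (\<Sum>v\<leftarrow>vs. monom 1 v) x = (\<Sum>v\<leftarrow>vs. x ^ v)" for vs and x :: int
    by (induction vs) (auto simp: poly_monom)
  thus ?thesis by (simp add: fpoly_def marked_def poly_sum poly_monom)
qed

lemma poly_Vpoly: "poly (Vpoly ks) x = (\<Sum>i<length ks. int (ks ! i) * x ^ i)"
  by (simp add: Vpoly_def poly_sum poly_monom)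

text \<open>Thus \<open>fpoly\<close> is a fingerprint of the multiset of marks: it is zero exactly
  if every vertex of \<open>T\<close> is marked once and nothing else is.\<close>

lemma coeff_fpoly: "coeff (fpoly ps) v = int (count_list (concat (map marks ps)) v) - (if v \<in> T then 1 else 0)"
proof -
  have "coeff (\<Sum>w\<leftarrow>ws. monom 1 w) v = int (count_list ws v)" for ws
    by (induction ws) auto
  moreover have "finite T" using T_less finite_subset by blast
  ultimately show ?thesis by (simp add: fpoly_def coeff_sum)
qed

text \<open>The first two divisibility checks compare polynomials at the random point. The last one
  tests the sum of all defects, computed from the announced coefficients.\<close>

definition accept where
  "accept s = Some (case s of None \<Rightarrow> False
    | Some ((\<gamma>, k, sd, pe), (z, A, B), (mk, sq, v, w)) \<Rightarrow>
      k = L + 2 * n + 3 * H \<and> zacc z \<and>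
      int p dvd mk - (\<Sum>v\<in>T. int \<gamma> ^ v) \<and>
      int p dvd (\<Sum>l<L. \<Sum>t<C. A (2, l, t) * B (0, l, t) - 2 * A (1, l, t) * B (1, l, t) + A (0, l, t) * B (2, l, t)
        + (A (0, l, t))\<^sup>2 * B (0, l, t) - 2 * A (0, l, t) * B (3, l, t)) - v \<and>
      int p dvd w + sq)"

lemma accept_summary_iff:
  "accept (summary \<gamma> ms) = Some True \<longleftrightarrow>
    well_formed ms \<and> length (rights ms) = L + 2 * n + 3 * H \<and>
    zacc (foldl zstep z0 (path (claims (rights ms)))) \<and>
    int p dvd poly (fpoly (path (claims (rights ms)))) (int \<gamma>) \<and>
    int p dvd poly (Qpoly (seeds (rights ms)) (coded (lefts ms)) (keyed (claims (rights ms))) - Vpoly (coefs (rights ms))) (int \<gamma>) \<and>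
    int p dvd (\<Sum>y<H. poly (Vpoly (coefs (rights ms))) (int y)) + squares (claims (rights ms))"
proof (cases "well_formed ms \<and> length (rights ms) = L + 2 * n + 3 * H")
  case False
  thus ?thesis by (auto simp: accept_def summary_def)
next
  case True
  let ?bs = "rights ms" and ?A = "Areg \<gamma> ms" and ?B = "Breg \<gamma> ms"
  let ?Q = "Qpoly (seeds ?bs) (coded (lefts ms)) (keyed (claims ?bs))"
  have A: "[?A (j, l, t) = poly (Apoly (seeds ?bs) (coded (lefts ms)) j l t) (int \<gamma>)] (mod int p)"
    if "j < 3" "l < L" "t < C" for j l t using True that by (simp add: Areg_def)
  have B: "[?B (j, l, t) = poly (Bpoly (seeds ?bs) (keyed (claims ?bs)) j l t) (int \<gamma>)] (mod int p)"
    if "j < 4" "l < L" "t < C" for j l t using True that by (simp add: Breg_def)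
  have Q: "[(\<Sum>l<L. \<Sum>t<C. ?A (2, l, t) * ?B (0, l, t) - 2 * ?A (1, l, t) * ?B (1, l, t) + ?A (0, l, t) * ?B (2, l, t)
        + (?A (0, l, t))\<^sup>2 * ?B (0, l, t) - 2 * ?A (0, l, t) * ?B (3, l, t)) = poly ?Q (int \<gamma>)] (mod int p)"
    unfolding Qpoly_def poly_sum poly_diff poly_add poly_mult poly_power poly_numeral
    by (intro cong_sum cong_add cong_diff cong_mult cong_pow cong_refl A B) auto
  have V: "[combine (\<lambda>i. int \<gamma> ^ i) (coefs ?bs) mod int p = poly (Vpoly (coefs ?bs)) (int \<gamma>)] (mod int p)"
    by (simp add: combine_def poly_Vpoly)
  have W: "combine (\<lambda>i. \<Sum>y<H. int y ^ i) (coefs ?bs) = (\<Sum>y<H. poly (Vpoly (coefs ?bs)) (int y))"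
    unfolding combine_def poly_Vpoly sum_distrib_left by (rule sum.swap)
  have 1: "int p dvd marked \<gamma> (claims ?bs) mod int p - (\<Sum>v\<in>T. int \<gamma> ^ v) \<longleftrightarrow> int p dvd poly (fpoly (path (claims ?bs))) (int \<gamma>)"
    unfolding poly_fpoly by (intro dvd_cong_iff cong_diff cong_refl) simp
  have 2: "int p dvd (\<Sum>l<L. \<Sum>t<C. ?A (2, l, t) * ?B (0, l, t) - 2 * ?A (1, l, t) * ?B (1, l, t) + ?A (0, l, t) * ?B (2, l, t)
        + (?A (0, l, t))\<^sup>2 * ?B (0, l, t) - 2 * ?A (0, l, t) * ?B (3, l, t)) - combine (\<lambda>i. int \<gamma> ^ i) (coefs ?bs) mod int p
     \<longleftrightarrow> int p dvd poly (?Q - Vpoly (coefs ?bs)) (int \<gamma>)"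
    unfolding poly_diff by (intro dvd_cong_iff cong_diff Q V)
  have 3: "int p dvd combine (\<lambda>i. \<Sum>y<H. int y ^ i) (coefs ?bs) mod int p + squares (claims ?bs) mod int p
     \<longleftrightarrow> int p dvd (\<Sum>y<H. poly (Vpoly (coefs ?bs)) (int y)) + squares (claims ?bs)"
    unfolding W by (intro dvd_cong_iff cong_add) auto
  show ?thesis
    unfolding accept_def summary_def if_P[OF conjunct1[OF True]] option.case prod.case 1 2 3
    using True by simp
qed

lemma degree_fpoly:
  assumes "\<And>u v c. (u, v, c) \<in> set ps \<Longrightarrow> u < n \<and> v < n"
  shows "degree (fpoly ps) \<le> n"
proof (rule degree_le, intro allI impI)
  fix i assume "n < i"
  have "x < n" if x: "x \<in> set (concat (map marks ps))" for x
  proof -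
    obtain u v c where "(u, v, c) \<in> set ps" "x \<in> set (marks (u, v, c))" using x by auto
    thus ?thesis using assms[of u v c] marks_less by blast
  qed
  hence "i \<notin> set (concat (map marks ps))" using \<open>n < i\<close> by (meson less_asym)
  hence "count_list (concat (map marks ps)) i = 0" by (rule count_notin)
  thus "coeff (fpoly ps) i = 0" using \<open>n < i\<close> T_less by (auto simp: coeff_fpoly)
qed

lemma degree_Vpoly: "length ks \<le> 3 * H \<Longrightarrow> degree (Vpoly ks) \<le> 3 * H"
  unfolding Vpoly_def by (intro degree_sum_le) (auto intro: order.trans[OF degree_monom_le])

lemma count_marks_le:
  assumes "length ps \<le> 2 * n"
  shows "count_list (concat (map marks ps)) v \<le> 4 * n"
proof -
  have "length (concat (map marks ps)) \<le> 2 * length ps"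
  proof (induction ps)
    case (Cons a ps)
    thus ?case using length_marks[of a] by simp
  qed simp
  thus ?thesis using count_le_length[of "concat (map marks ps)" v] assms by linarith
qed

text \<open>The annotation does not depend on the coin, so \<open>fpoly\<close> and the difference
  of \<open>Qpoly\<close> and \<open>Vpoly\<close> are fixed polynomials. If one of them does not
  vanish modulo \<open>p\<close>, its roots bound the accepting coins. If both vanish and the other
  checks pass, all defects are 0 and the listed edges form a valid certificate, a contradiction. The
  cases exclude each other, so errors do not add up.\<close>

lemma few_accepting_coins:
  assumes xs: "fst ` set xs \<subseteq> all_edges n" "\<And>e. edge_mult xs e \<ge> 0" "\<And>e. edge_mult xs e \<le> int b"
    and E: "stream_edges xs \<subseteq> all_edges n" and F: "\<not> F (stream_edges xs)" and ms: "lefts ms = xs"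
  shows "3 * card {\<gamma>\<in>{..<p}. accept (summary \<gamma> ms) = Some True} \<le> p"
proof -
  define bs where "bs = rights ms"
  let ?cs = "claims bs" and ?sd = "seeds bs" and ?V = "Vpoly (coefs bs)"
  let ?Q = "Qpoly ?sd (coded xs) (keyed ?cs)"
  let ?acc = "{\<gamma>\<in>{..<p}. accept (summary \<gamma> ms) = Some True}"
  note acc = accept_summary_iff[of _ ms, unfolded ms bs_def[symmetric]]
  have few: "3 * card ?acc \<le> p" if "?acc \<subseteq> {\<gamma>\<in>{..<p}. int p dvd poly f (int \<gamma>)}"
    "card {\<gamma>\<in>{..<p}. int p dvd poly f (int \<gamma>)} \<le> degree f" "3 * degree f \<le> p" for f
  proof -
    have "card ?acc \<le> card {\<gamma>\<in>{..<p}. int p dvd poly f (int \<gamma>)}" using that(1) by (intro card_mono) auto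
    thus ?thesis using that(2,3) by linarith
  qed
  show ?thesis
  proof (cases "length bs = L + 2 * n + 3 * H \<and> zacc (foldl zstep z0 (path ?cs)) \<and>
      int p dvd (\<Sum>y<H. poly ?V (int y)) + squares ?cs")
    case False
    hence "?acc = {}" unfolding acc by auto
    thus ?thesis by (simp only: card.empty)
  next
    case True
    show ?thesis
    proof (cases "\<exists>v. \<not> int p dvd coeff (fpoly (path ?cs)) v")
      case True
      have "degree (fpoly (path ?cs)) \<le> n" by (rule degree_fpoly) (rule path_claims_in)
      thus ?thesis using True big(2) card_roots_mod_prime_le[OF prime_p]
        by (intro few[of "fpoly (path ?cs)"]) (auto simp: acc)
    next
      case no_f: False
      show ?thesis
      proof (cases "\<exists>y. \<not> int p dvd poly (?Q - ?V) y")
        case True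
        have "degree (?Q - ?V) \<le> 3 * H"
          using degree_Qpoly[of ?sd "coded xs" "keyed ?cs"] degree_Vpoly[of "coefs bs"] \<open>length bs = _ \<and> _\<close>
          by (intro degree_diff_le) (auto simp: coefs_def)
        hence deg: "3 * degree (?Q - ?V) \<le> p" using H_le by linarith
        obtain y where "\<not> int p dvd poly (?Q - ?V) y" using True by blast
        from few[OF _ card_roots_mod_prime_le_of_value[OF prime_p this] deg] show ?thesis by (auto simp: acc)
      next
        case False
        hence "[poly ?V y = poly ?Q y] (mod int p)" for y
          by (simp add: cong_iff_dvd_diff dvd_diff_commute)
        hence "[(\<Sum>y<H. poly ?V (int y)) + squares ?cs = (\<Sum>y<H. poly ?Q (int y)) + squares ?cs] (mod int p)"
          by (intro cong_add cong_sum cong_refl)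
        moreover have "[(\<Sum>y<H. poly ?Q (int y)) + squares ?cs = (\<Sum>c\<leftarrow>keyed ?cs. defect ?sd (coded xs) c)] (mod int p)"
          unfolding squares_def by (rule sum_Qpoly_cong) (auto simp: keyed_def claims_in(1))
        ultimately have "int p dvd (\<Sum>c\<leftarrow>keyed ?cs. defect ?sd (coded xs) c)"
          using True dvd_cong_iff cong_trans by blast
        \<comment> \<open>There are at most \<open>2 * n\<close> claims, each with defect at most
          \<open>M\<close>; a multiple of \<open>p\<close> in this range is 0.\<close>
        moreover have "(\<Sum>c\<leftarrow>keyed ?cs. defect ?sd (coded xs) c) < int p"
        proof -
          define M where "M = n ^ 2 * b * n ^ 4 + (n ^ 2 * b + b) ^ 2"
          have "(\<Sum>c\<leftarrow>keyed ?cs. defect ?sd (coded xs) c) \<le> (\<Sum>c\<leftarrow>keyed ?cs. int M)"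
          proof (rule sum_list_mono)
            fix c assume "c \<in> set (keyed ?cs)"
            then obtain l u v g d where c: "c = (l, code {u, v}, g)" "(l, u, v, g, d) \<in> set ?cs"
              by (auto simp: keyed_def)
            thus "defect ?sd (coded xs) c \<le> int M"
              unfolding c(1) M_def using claims_in[OF c(2)] code_pair_less(2) by (intro defect_le xs) auto
          qed
          also have "\<dots> = int (length ?cs * M)" by (simp add: keyed_def sum_list_triv)
          also have "\<dots> \<le> int (2 * n * M)" using length_claims_le[of bs] by (simp only: of_nat_le_iff mult_le_mono1)
          also have "\<dots> < int p" using big(1) unfolding M_def by (simp only: of_nat_less_iff)
          finally show ?thesis .
        qed
        moreover have nonneg: "\<And>c. 0 \<le> defect ?sd (coded xs) c" by (rule defect_nonneg[OF xs(1,2)])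
        moreover have "0 \<le> (\<Sum>c\<leftarrow>keyed ?cs. defect ?sd (coded xs) c)" by (intro sum_list_nonneg) (auto simp: nonneg)
        ultimately have "(\<Sum>c\<leftarrow>keyed ?cs. defect ?sd (coded xs) c) = 0"
          by (meson linorder_not_less zdvd_not_zless order_le_less)
        hence defect0: "defect ?sd (coded xs) c = 0" if "c \<in> set (keyed ?cs)" for c
          using that nonneg by (subst (asm) sum_list_nonneg_eq_0_iff) auto
        have "{u, v} \<in> stream_edges xs" if "(u, v, d) \<in> set (path ?cs)" for u v d
        proof -
          obtain l g where c: "(l, u, v, g, d) \<in> set ?cs" using \<open>(u, v, d) \<in> set (path ?cs)\<close> by (auto simp: path_def)
          hence "(l, code {u, v}, g) \<in> set (keyed ?cs)" by (force simp: keyed_def)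
          thus ?thesis using claims_in[OF c] by (intro edge_of_defect_eq_0[OF xs(1,2) defect0]) auto
        qed
        moreover have "count_list (concat (map marks (path ?cs))) v = (if v \<in> T then 1 else 0)" for v
        proof -
          have "length (path ?cs) \<le> 2 * n" using length_claims_le by (simp add: path_def)
          hence "count_list (concat (map marks (path ?cs))) v \<le> 4 * n" by (rule count_marks_le)
          \<comment> \<open>A count of at most \<open>4 * n < p\<close> is determined by its
            residue.\<close>
          hence "\<bar>coeff (fpoly (path ?cs)) v\<bar> < int p" using big(2) prime_gt_1_nat[OF prime_p] unfolding coeff_fpoly by auto
          moreover have "int p dvd coeff (fpoly (path ?cs)) v" using no_f by blast
          ultimately have "coeff (fpoly (path ?cs)) v = 0"
            using dvd_imp_le_int[of "coeff (fpoly (path ?cs)) v" "int p"] by linarith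
          thus ?thesis unfolding coeff_fpoly by (auto split: if_splits)
        qed
        ultimately have "F (stream_edges xs)" using True by (intro certificate_sound[OF E]) auto
        thus ?thesis using F by simp
      qed
    qed
  qed
qed

section \<open>The honest annotation\<close>

lemma well_formed_append_Inl:
  "well_formed ms \<Longrightarrow> L \<le> length (rights ms) \<Longrightarrow> well_formed (ms @ map Inl us)"
proof (induction us rule: rev_induct)
  case (snoc u us)
  hence "well_formed ((ms @ map Inl us) @ [Inl u])" by (subst well_formed_snoc) auto
  thus ?case by simp
qed simp

lemma well_formed_append_Inr:
  "well_formed ms \<Longrightarrow> length (rights ms) + length ks \<le> L + 2 * n + 3 * H \<Longrightarrow> well_formed (ms @ map Inr ks)"
proof (induction ks rule: rev_induct)
  case (snoc k ks)
  hence "well_formed ((ms @ map Inr ks) @ [Inr k])" by (subst well_formed_snoc) auto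
  thus ?case by simp
qed simp

text \<open>The seeds follow the first stream element, all other words the last. A nonempty
  certificate forces a nonempty stream, without which there would be no place for the
  annotation.\<close>

lemma ex_honest_words:
  assumes xs: "fst ` set xs \<subseteq> all_edges n" "\<And>e. edge_mult xs e \<ge> 0" "\<And>e. edge_mult xs e \<le> int b"
    and E: "stream_edges xs \<subseteq> all_edges n" "card (stream_edges xs) \<le> m" and F: "F (stream_edges xs)"
  shows "\<exists>ks ks'. set ks \<union> set ks' \<subseteq> {..<p} \<and> length ks + length ks' = L + 2 * n + 3 * H \<and>
    (\<forall>\<gamma>. accept (summary \<gamma> (Inl (hd xs) # map Inr ks @ map Inl (tl xs) @ map Inr ks')) = Some True) \<and> xs \<noteq> []"
proof -
  let ?E = "stream_edges xs"
  obtain ps where ps: "ps \<noteq> []" "length ps \<le> 2 * n" "\<And>u v c. (u, v, c) \<in> set ps \<Longrightarrow> {u, v} \<in> ?E"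
    "zacc (foldl zstep z0 ps)" "\<And>v. count_list (concat (map marks ps)) v = (if v \<in> T then 1 else 0)"
    using certificate_complete[OF E(1) F] by blast
  obtain sd where sd: "length sd = L" "set sd \<subseteq> {..<p}" "\<And>e. e \<in> ?E \<Longrightarrow> \<exists>l<L. \<not> crowded ?E (sd ! l) e"
    using ex_isolating_seeds[OF E(1,2) cells] by blast
  obtain lev where lev: "\<And>e. e \<in> ?E \<Longrightarrow> lev e < L \<and> \<not> crowded ?E (sd ! lev e) e" using sd(3) by metis
  define cl where "cl = map (\<lambda>(u, v, c). (lev {u, v}, u, v, nat (edge_mult xs {u, v}), c)) ps"
  define Q where "Q = Qpoly sd (coded xs) (keyed cl)"
  \<comment> \<open>By \<open>degree_Qpoly\<close> these are all coefficients; they are reduced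
    modulo \<open>p\<close> to fit into words.\<close>
  define cf where "cf = map (\<lambda>i. nat (coeff Q i mod int p)) [0..<3 * H]"
  \<comment> \<open>The padding makes the coefficients start at a fixed position.\<close>
  define ks where "ks = map (\<lambda>c. ecl [c]) cl @ replicate (2 * n - length ps) (ecl []) @ cf"
  define ms where "ms = Inl (hd xs) # map Inr sd @ map Inl (tl xs) @ map Inr ks"
  have xs_ne: "xs \<noteq> []"
  proof
    assume "xs = []"
    hence "?E = {}" by (simp add: stream_edges_def edge_mult_def)
    thus False using ps(1,3) by (cases ps) auto
  qed
  have cl_in: "[c] \<in> claim_words n b L" if c: "c \<in> set cl" for c
  proof -
    obtain u v d where uv: "(u, v, d) \<in> set ps" "c = (lev {u, v}, u, v, nat (edge_mult xs {u, v}), d)"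
      using c by (auto simp: cl_def)
    have "{u, v} \<in> ?E" using ps(3) uv(1) by blast
    moreover have "u < n" "v < n" using calculation E(1) by (auto simp: all_edges_def)
    moreover have "1 \<le> nat (edge_mult xs {u, v})" "nat (edge_mult xs {u, v}) \<le> b"
      using calculation(1) xs(3)[of "{u, v}"] by (auto simp: stream_edges_def)
    ultimately show ?thesis using lev[of "{u, v}"] by (auto simp: uv(2) claim_words_def)
  qed
  have nil_in: "[] \<in> claim_words n b L" by (simp add: claim_words_def)
  have cf_less: "set cf \<subseteq> {..<p}" using p_gt_0 by (auto simp: cf_def nat_less_iff)
  have "set ks \<subseteq> {..<p}"
    using cl_in nil_in dcl_ecl cf_less by (auto simp: ks_def)
  hence range: "set sd \<union> set ks \<subseteq> {..<p}" using sd(2) by blast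
  have len_cl: "length cl = length ps" by (simp add: cl_def)
  have len: "length sd + length ks = L + 2 * n + 3 * H"
    using sd(1) ps(2) by (simp add: ks_def len_cl cf_def)
  have rights: "rights ms = sd @ ks" by (simp add: ms_def)
  have lefts: "lefts ms = xs" using xs_ne by (simp add: ms_def)
  have seeds: "seeds (rights ms) = sd" using sd(1) by (simp add: rights seeds_def)
  have "take (2 * n) ks = map (\<lambda>c. ecl [c]) cl @ replicate (2 * n - length ps) (ecl [])"
    using ps(2) by (simp add: ks_def len_cl)
  moreover have "concat (map dcl (map (\<lambda>c. ecl [c]) cl)) = cl"
    using cl_in dcl_ecl by (induction cl) auto
  moreover have "dcl (ecl []) = []" using nil_in dcl_ecl by blast
  ultimately have claims: "claims (rights ms) = cl" using sd(1) by (simp add: claims_def rights)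
  have coefs: "coefs (rights ms) = cf" using sd(1) ps(2) by (simp add: coefs_def rights ks_def len_cl)
  have path: "path cl = ps" unfolding path_def cl_def map_map by (rule map_idI) auto
  have wf: "well_formed ms"
  proof -
    have "well_formed []" by (simp add: well_formed_def)
    hence "well_formed ([] @ [Inl (hd xs)])" unfolding well_formed_snoc by simp
    hence "well_formed ([Inl (hd xs)] @ map Inr sd)" using len by (intro well_formed_append_Inr) auto
    hence "well_formed (([Inl (hd xs)] @ map Inr sd) @ map Inl (tl xs))" using sd(1) by (intro well_formed_append_Inl) auto
    hence "well_formed ((([Inl (hd xs)] @ map Inr sd) @ map Inl (tl xs)) @ map Inr ks)"
      using len by (intro well_formed_append_Inr) auto
    thus ?thesis by (simp add: ms_def)
  qed
  have "fpoly ps = 0" by (intro poly_eqI) (simp add: coeff_fpoly ps(5))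
  hence f0: "int p dvd poly (fpoly ps) x" for x by simp
  have "int p dvd coeff (Q - Vpoly cf) i" for i
  proof -
    have V: "coeff (Vpoly cf) i = (if i < 3 * H then coeff Q i mod int p else 0)"
      using p_gt_0 by (auto simp: Vpoly_def coeff_sum cf_def)
    show ?thesis
    proof (cases "i < 3 * H")
      case True
      thus ?thesis by (simp add: V mod_eq_dvd_iff[symmetric])
    next
      case False
      hence "coeff Q i = 0" using degree_Qpoly unfolding Q_def by (intro coeff_eq_0) (meson less_le_trans linorder_not_less)
      thus ?thesis using False by (simp add: V)
    qed
  qed
  hence QV: "int p dvd poly (Q - Vpoly cf) x" for x unfolding poly_altdef by (intro dvd_sum) auto
  hence "[poly (Vpoly cf) x = poly Q x] (mod int p)" for x
    by (simp add: cong_iff_dvd_diff dvd_diff_commute)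
  hence "[(\<Sum>y<H. poly (Vpoly cf) (int y)) + squares cl = (\<Sum>y<H. poly Q (int y)) + squares cl] (mod int p)"
    by (intro cong_add cong_sum cong_refl)
  moreover have "[(\<Sum>y<H. poly Q (int y)) + squares cl = (\<Sum>c\<leftarrow>keyed cl. defect sd (coded xs) c)] (mod int p)"
    unfolding squares_def Q_def
    by (rule sum_Qpoly_cong) (use lev ps(3) in \<open>auto simp: keyed_def cl_def\<close>)
  moreover have "defect sd (coded xs) c = 0" if c: "c \<in> set (keyed cl)" for c
  proof -
    obtain u v d where uv: "(u, v, d) \<in> set ps" "c = (lev {u, v}, code {u, v}, nat (edge_mult xs {u, v}))"
      using c by (auto simp: cl_def keyed_def)
    hence e: "{u, v} \<in> ?E" using ps(3) by blast
    show ?thesis unfolding uv(2)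
      using e E(1) xs(2) lev[OF e] by (intro defect_eq_0_of_isolated[OF xs(1,2)]) (auto simp: crowded_def)
  qed
  hence "map (defect sd (coded xs)) (keyed cl) = map (\<lambda>_. 0) (keyed cl)" by (intro map_cong) auto
  hence "(\<Sum>c\<leftarrow>keyed cl. defect sd (coded xs) c) = (\<Sum>c\<leftarrow>keyed cl. 0)" by (rule arg_cong)
  hence "(\<Sum>c\<leftarrow>keyed cl. defect sd (coded xs) c) = 0" by (simp only: sum_list_0)
  ultimately have S0: "int p dvd (\<Sum>y<H. poly (Vpoly cf) (int y)) + squares cl"
    using dvd_cong_iff cong_trans dvd_0_right by metis
  have "accept (summary \<gamma> ms) = Some True" for \<gamma>
    unfolding accept_summary_iff seeds claims coefs path lefts Q_def[symmetric]
    using wf len ps(4) f0 QV S0 by (simp add: rights)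
  thus ?thesis using range len xs_ne unfolding ms_def by blast
qed

end

section \<open>From the protocol to a scheme\<close>

lemma fst_image_strict_turnstile: "strict_turnstile n xs \<Longrightarrow> fst ` set xs \<subseteq> all_edges n"
proof
  fix e assume "strict_turnstile n xs" "e \<in> fst ` set xs"
  then obtain d where "(e, d) \<in> set xs" "\<forall>(e, \<delta>)\<in>set xs. e \<subseteq> {..<n} \<and> card e = 2"
    by (auto simp: strict_turnstile_def)
  thus "e \<in> all_edges n" unfolding all_edges_def by blast
qed

lemma edge_mult_nonneg: "strict_turnstile n xs \<Longrightarrow> edge_mult xs e \<ge> 0"
  unfolding strict_turnstile_def by (metis order_refl take_all)

lemma stream_edges_subset: "strict_turnstile n xs \<Longrightarrow> stream_edges xs \<subseteq> all_edges n"
proof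
  fix e assume "strict_turnstile n xs" "e \<in> stream_edges xs"
  have "edge_mult xs e = 0" if "e \<notin> fst ` set xs"
    using that
  proof (induction xs)
    case (Cons u xs)
    thus ?case by (cases u) (simp add: edge_mult_def, metis)
  qed (simp add: edge_mult_def)
  hence "e \<in> fst ` set xs" using \<open>e \<in> stream_edges xs\<close> by (auto simp: stream_edges_def)
  thus "e \<in> all_edges n" using fst_image_strict_turnstile[OF \<open>strict_turnstile n xs\<close>] by blast
qed

lemma has_relaxed_scheme_mono:
  assumes "has_relaxed_scheme X F l s" "Y \<subseteq> X" "l \<le> l'" "s \<le> s'"
  shows "has_relaxed_scheme Y F l' s'"
proof -
  obtain P V w where *: "relaxed_scheme X F P V" "annotation_length_le X P l" "verifier_space V w" "real w \<le> s"
    using assms(1) by (auto simp: has_relaxed_scheme_def)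
  have "relaxed_scheme Y F P V" using *(1) assms(2) unfolding relaxed_scheme_def by blast
  moreover have "annotation_length_le Y P l'" using *(2) assms(2,3) unfolding annotation_length_le_def by (meson order_trans subsetD)
  ultimately show ?thesis using *(3,4) assms(4) unfolding has_relaxed_scheme_def by (meson order_trans)
qed

context protocol
begin

lemma summary_snoc_scan:
  assumes "(fst (scan W dec ts), summary \<gamma> (snd (scan W dec ts))) = (fst (scan W dec ts'), summary \<gamma>' (snd (scan W dec ts')))"
  shows "(fst (scan W dec (ts @ [t])), summary \<gamma> (snd (scan W dec (ts @ [t]))))
       = (fst (scan W dec (ts' @ [t])), summary \<gamma>' (snd (scan W dec (ts' @ [t]))))"
  using assms summary_snoc[of \<gamma> "snd (scan W dec ts)" \<gamma>' "snd (scan W dec ts')"]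
  unfolding scan_snoc scan_step_def by (cases t) (simp_all add: case_prod_unfold)

lemma set_rights_scan: "set (rights (snd (scan W dec ts))) \<subseteq> {..<p}"
  by (induction ts rule: rev_induct)
     (auto simp: scan_snoc scan_step_def scan_def dec_less case_prod_unfold split: token.splits)

text \<open>The \<open>W\<close> bits beyond those of the summary hold the incomplete word, a string
  of fewer than \<open>W\<close> bits.\<close>

lemma ex_verifier:
  "\<exists>V. verifier_space V (W * (7 * (L * C) + L + 13)) \<and> (\<forall>ts. verifier_output V ts =
     map_pmf (\<lambda>\<gamma>. accept (summary \<gamma> (snd (scan W dec ts)))) (pmf_of_set {..<p}))"
proof -
  define B where "B = {l :: bool list. set l \<subseteq> UNIV \<and> length l \<le> W - 1}"
  have fB: "finite B" and cB: "card B \<le> 2 ^ W"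
    using card_short_lists_le[of "UNIV :: bool set" 2 "W - 1"] W_pos by (auto simp: B_def)
  have "\<exists>V. verifier_space V (W * (7 * (L * C) + L + 13)) \<and> (\<forall>ts. verifier_output V ts =
     map_pmf (\<lambda>\<gamma>. (accept \<circ> snd) (fst (scan W dec ts), summary \<gamma> (snd (scan W dec ts)))) (pmf_of_set {..<p}))"
  proof (rule verifier_of_summary[of "{..<p}" "B \<times> configurations"])
    show "card (B \<times> configurations) \<le> 2 ^ (W * (7 * (L * C) + L + 13))"
    proof -
      have "card (B \<times> configurations) \<le> 2 ^ W * 2 ^ (W * (7 * (L * C) + L + 12))"
        unfolding card_cartesian_product using cB card_configurations by (rule mult_le_mono)
      also have "\<dots> = 2 ^ (W * (7 * (L * C) + L + 13))" by (simp add: power_add[symmetric] algebra_simps)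
      finally show ?thesis .
    qed
    show "(fst (scan W dec ts), summary \<gamma> (snd (scan W dec ts))) \<in> B \<times> configurations" if "\<gamma> \<in> {..<p}" for \<gamma> ts
      using length_buffer_scan[OF W_pos, of dec ts] summary_in_configurations[OF _ set_rights_scan] that
      by (auto simp: B_def)
    show "finite (B \<times> configurations)" using fB finite_configurations by (rule finite_cartesian_product)
    show "{..<p} \<noteq> {}" using p_gt_0 by auto
  qed (rule finite_lessThan summary_snoc_scan, assumption?)+
  thus ?thesis by simp
qed

theorem protocol_scheme:
  "has_relaxed_scheme (graph_streams n m b) (\<lambda>xs. F (stream_edges xs))
     (real ((L + 2 * n + 3 * H) * W)) (real (W * (7 * (L * C) + L + 13)))"
proof -
  obtain V where V: "verifier_space V (W * (7 * (L * C) + L + 13))"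
    "\<And>ts. verifier_output V ts = map_pmf (\<lambda>\<gamma>. accept (summary \<gamma> (snd (scan W dec ts)))) (pmf_of_set {..<p})"
    using ex_verifier by blast
  define good where "good xs \<longleftrightarrow> xs \<in> graph_streams n m b \<and> F (stream_edges xs)" for xs
  define R where "R xs kk \<longleftrightarrow> set (fst kk) \<union> set (snd kk) \<subseteq> {..<p} \<and> length (fst kk) + length (snd kk) = L + 2 * n + 3 * H \<and>
    (\<forall>\<gamma>. accept (summary \<gamma> (Inl (hd xs) # map Inr (fst kk) @ map Inl (tl xs) @ map Inr (snd kk))) = Some True) \<and> xs \<noteq> []" for xs kk
  have "\<exists>kk. good xs \<longrightarrow> R xs kk" for xs
  proof (cases "good xs")
    case True
    hence "strict_turnstile n xs" "card (stream_edges xs) \<le> m" "\<And>e. edge_mult xs e \<le> int b" "F (stream_edges xs)"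
      by (auto simp: good_def graph_streams_def)
    from ex_honest_words[OF fst_image_strict_turnstile[OF this(1)] edge_mult_nonneg[OF this(1)] this(3) stream_edges_subset[OF this(1)] this(2,4)]
    obtain k k' where "R xs (k, k')" unfolding R_def fst_conv snd_conv by blast
    thus ?thesis by blast
  qed blast
  hence "\<forall>xs. \<exists>kk. good xs \<longrightarrow> R xs kk" by blast
  from choice[OF this] obtain K where K: "\<And>xs. good xs \<Longrightarrow> R xs (K xs)" by blast
  define ks ks' where "ks xs = fst (K xs)" and "ks' xs = snd (K xs)" for xs
  note honest = K[unfolded R_def, folded ks_def ks'_def, THEN conjunct1]
    K[unfolded R_def, folded ks_def ks'_def, THEN conjunct2, THEN conjunct1]
    K[unfolded R_def, folded ks_def ks'_def, THEN conjunct2, THEN conjunct2, THEN conjunct1, rule_format]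
    K[unfolded R_def, folded ks_def ks'_def, THEN conjunct2, THEN conjunct2, THEN conjunct2]
  define P :: "update prover" where "P = \<lparr>coins = return_pmf 0, annotation = (\<lambda>i xs r. if good xs
     then front_back (length xs) (concat (map enc (ks xs))) (concat (map enc (ks' xs))) i else [])\<rparr>"
  have "relaxed_scheme (graph_streams n m b) (\<lambda>xs. F (stream_edges xs)) P V"
    unfolding relaxed_scheme_def
  proof (intro conjI ballI impI allI)
    fix xs assume "xs \<in> graph_streams n m b" "F (stream_edges xs)"
    hence g: "good xs" by (simp add: good_def)
    have "honest_output P V xs = verifier_output V (annotated xs (front_back (length xs) (concat (map enc (ks xs))) (concat (map enc (ks' xs)))))"
      using g by (simp add: honest_output_def P_def bind_return_pmf)
    also have "\<dots> = map_pmf (\<lambda>\<gamma>. accept (summary \<gamma> (Inl (hd xs) # map Inr (ks xs) @ map Inl (tl xs) @ map Inr (ks' xs)))) (pmf_of_set {..<p})"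
      unfolding V(2) using honest[OF g] W_pos length_enc dec_enc by (subst snd_scan_front_back) auto
    also have "\<dots> = map_pmf (\<lambda>_. Some True) (pmf_of_set {..<p})" using honest(3)[OF g] by simp
    finally show "measure_pmf.prob (honest_output P V xs) {v. v \<noteq> Some True} \<le> 1 / 3" by (simp add: map_pmf_const)
  next
    fix xs a assume *: "xs \<in> graph_streams n m b" "\<not> F (stream_edges xs)"
    let ?ms = "snd (scan W dec (annotated xs a))"
    have "3 * card {\<gamma>\<in>{..<p}. accept (summary \<gamma> ?ms) = Some True} \<le> p"
    proof -
      have "strict_turnstile n xs" "\<And>e. edge_mult xs e \<le> int b" using *(1) by (auto simp: graph_streams_def)
      from few_accepting_coins[OF fst_image_strict_turnstile[OF this(1)] edge_mult_nonneg[OF this(1)] this(2)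
        stream_edges_subset[OF this(1)] *(2) lefts_scan_annotated] show ?thesis .
    qed
    hence le: "3 * real (card {\<gamma>\<in>{..<p}. accept (summary \<gamma> ?ms) = Some True}) \<le> real p"
      using of_nat_mono by fastforce
    have "measure_pmf.prob (verifier_output V (annotated xs a)) {v. v = Some True}
       = real (card ({..<p} \<inter> {\<gamma>. accept (summary \<gamma> ?ms) = Some True})) / real p"
      unfolding V(2) measure_map_pmf using p_gt_0
      by (subst measure_pmf_of_set) (auto simp: vimage_def)
    also have "{..<p} \<inter> {\<gamma>. accept (summary \<gamma> ?ms) = Some True} = {\<gamma>\<in>{..<p}. accept (summary \<gamma> ?ms) = Some True}" by blast
    also have "real (card {\<gamma>\<in>{..<p}. accept (summary \<gamma> ?ms) = Some True}) / real p \<le> 1 / 3"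
      using le p_gt_0 by (simp add: divide_simps)
    finally show "measure_pmf.prob (verifier_output V (annotated xs a)) {v. v = Some True} \<le> 1 / 3" .
  qed
  moreover have "annotation_length_le (graph_streams n m b) P (real ((L + 2 * n + 3 * H) * W))"
    unfolding annotation_length_le_def
  proof (intro ballI)
    fix xs r
    have len: "length (concat (map enc k)) = length k * W" for k
      using length_enc by (induction k) auto
    have "(\<Sum>i<length xs. length (annotation P i xs r)) \<le> (L + 2 * n + 3 * H) * W"
    proof (cases "good xs")
      case True
      hence "(\<Sum>i<length xs. length (annotation P i xs r)) = length (ks xs) * W + length (ks' xs) * W"
        using honest(4)[OF True] by (simp add: P_def sum_length_front_back len)
      also have "\<dots> = (L + 2 * n + 3 * H) * W" using honest(2)[OF True] by (metis distrib_right)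
      finally show ?thesis by simp
    qed (simp add: P_def)
    thus "real (\<Sum>i<length xs. length (annotation P i xs r)) \<le> real ((L + 2 * n + 3 * H) * W)" by (rule of_nat_mono)
  qed
  ultimately show ?thesis using V(1) unfolding has_relaxed_scheme_def by blast
qed

end

section \<open>Certificates for the three problems\<close>

lemma edge_less:
  assumes "E \<subseteq> all_edges n" "{u, v} \<in> E"
  shows "u < n" "v < n" "u \<noteq> v"
proof -
  have "{u, v} \<subseteq> {..<n}" "card {u, v} = 2" using assms by (auto simp: all_edges_def)
  thus "u < n" "v < n" "u \<noteq> v" by (auto simp: card_insert_if split: if_splits)
qed

lemma count_concat_marks: "count_list (concat (map f as)) v = (\<Sum>a\<leftarrow>as. count_list (f a) v)"
  by (induction as) auto

definition arcs :: "nat set set \<Rightarrow> (nat \<times> nat) set" where "arcs E = {(x, y). {x, y} \<in> E}"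

lemma sym_arcs: "sym (arcs E)"
  by (auto simp: sym_def arcs_def insert_commute)

section \<open>Perfect matchings\<close>

definition pm_marks :: "nat \<times> nat \<times> bool \<Rightarrow> nat list" where
  "pm_marks = (\<lambda>(u, v, c). [u, v])"

text \<open>Two different entries through the same vertex would mark it twice, so all listed edges
  through a vertex coincide; the mark provides one.\<close>

lemma perfect_matching_sound:
  assumes "\<And>u v c. (u, v, c) \<in> set ps \<Longrightarrow> {u, v} \<in> E"
    and count: "\<And>v. count_list (concat (map pm_marks ps)) v = (if v \<in> {..<n} then 1 else 0)"
  shows "has_perfect_matching {..<n} E"
proof -
  define M where "M = (\<lambda>(u, v, c). {u, v}) ` set ps"
  have "\<exists>!e. e \<in> M \<and> x \<in> e" if x: "x \<in> {..<n}" for x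
  proof (rule ex_ex1I)
    have "x \<in> set (concat (map pm_marks ps))" using count[of x] x by (metis count_notin zero_neq_one)
    then obtain u v c where "(u, v, c) \<in> set ps" "x \<in> {u, v}" by (auto simp: pm_marks_def)
    thus "\<exists>e. e \<in> M \<and> x \<in> e" unfolding M_def by force
  next
    fix e e' assume e: "e \<in> M \<and> x \<in> e" "e' \<in> M \<and> x \<in> e'"
    have *: "\<exists>a \<in> set ps. e = (\<lambda>(u, v, c). {u, v}) a \<and> count_list (pm_marks a) x > 0" if "e \<in> M \<and> x \<in> e" for e
      using that by (force simp: M_def pm_marks_def)
    obtain a where a: "a \<in> set ps" "e = (\<lambda>(u, v, c). {u, v}) a" "count_list (pm_marks a) x > 0" using *[OF e(1)] by blast
    obtain a' where a': "a' \<in> set ps" "e' = (\<lambda>(u, v, c). {u, v}) a'" "count_list (pm_marks a') x > 0" using *[OF e(2)] by blast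
    have "a = a'"
    proof (rule ccontr)
      assume ne: "a \<noteq> a'"
      obtain qs rs where qr: "ps = qs @ a # rs" using split_list[OF a(1)] by blast
      have "a' \<in> set (qs @ rs)" using a'(1) ne qr by auto
      hence "count_list (pm_marks a') x \<le> (\<Sum>a\<leftarrow>qs @ rs. count_list (pm_marks a) x)"
        by (intro member_le_sum_list) auto
      hence "2 \<le> count_list (concat (map pm_marks ps)) x"
        using a(3) a'(3) unfolding count_concat_marks qr by simp
      thus False using count[of x] by (simp split: if_splits)
    qed
    thus "e = e'" using a(2) a'(2) by simp
  qed
  hence "\<forall>x\<in>{..<n}. \<exists>!e. e \<in> M \<and> x \<in> e" by (rule ballI)
  moreover have "M \<subseteq> E" unfolding M_def using assms(1) by auto
  ultimately show ?thesis unfolding has_perfect_matching_def by (intro exI[of _ M] conjI)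
qed

lemma perfect_matching_complete:
  assumes E: "E \<subseteq> all_edges n" and n: "n \<ge> 2" and pm: "has_perfect_matching {..<n} E"
  shows "\<exists>ps. ps \<noteq> [] \<and> length ps \<le> 2 * n \<and> (\<forall>u v c. (u, v, c) \<in> set ps \<longrightarrow> {u, v} \<in> E) \<and>
    (\<forall>v. count_list (concat (map pm_marks ps)) v = (if v \<in> {..<n} then 1 else 0))"
proof -
  obtain M where M: "M \<subseteq> E" "\<And>v. v < n \<Longrightarrow> \<exists>!e. e \<in> M \<and> v \<in> e"
    using pm unfolding has_perfect_matching_def by auto
  have fM: "finite M" using M(1) E finite_all_edges by (meson finite_subset subset_trans)
  have edge: "e = {Min e, Max e} \<and> Min e < n \<and> Max e < n \<and> Min e \<noteq> Max e" if e: "e \<in> M" for e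
  proof -
    obtain u v where "e = {u, v}" "u \<noteq> v" "u < n" "v < n"
      using all_edgesE[of e n] e M(1) E by (metis subsetD)
    thus ?thesis by (auto simp: min_def max_def)
  qed
  obtain es where es: "set es = M" "distinct es" using finite_distinct_list[OF fM] by blast
  define ps where "ps = map (\<lambda>e. (Min e, Max e, False)) es"
  \<comment> \<open>Matching edges with the same minimum share a vertex; this bounds their number by
    \<open>n\<close>.\<close>
  have "inj_on Min M"
  proof (rule inj_onI)
    fix e e' assume "e \<in> M" "e' \<in> M" "Min e = Min e'"
    moreover have "Min e \<in> e" "Min e' \<in> e'" using edge calculation(1,2) by blast+
    ultimately show "e = e'" using M(2)[of "Min e"] edge by metis
  qed
  hence "card M \<le> n" using card_inj_on_le[of Min M "{..<n}"] edge by auto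
  hence "length ps \<le> 2 * n" using es distinct_card[OF es(2)] by (simp add: ps_def)
  moreover have "ps \<noteq> []"
  proof -
    have "M \<noteq> {}" using M(2)[of 0] n by auto
    thus ?thesis using es(1) by (auto simp: ps_def)
  qed
  moreover have "{u, v} \<in> E" if "(u, v, c) \<in> set ps" for u v c
    using that edge M(1) es(1) by (auto simp: ps_def)
  moreover have "count_list (concat (map pm_marks ps)) x = (if x \<in> {..<n} then 1 else 0)" for x
  proof -
    have "count_list (concat (map pm_marks ps)) x = (\<Sum>e\<leftarrow>es. count_list [Min e, Max e] x)"
      unfolding count_concat_marks ps_def map_map o_def pm_marks_def by simp
    also have "\<dots> = (\<Sum>e\<in>M. count_list [Min e, Max e] x)"
      using es by (simp add: sum_list_distinct_conv_sum_set)
    also have "\<dots> = (\<Sum>e\<in>M. if x \<in> e then 1 else 0)"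
    proof (rule sum.cong)
      fix e assume "e \<in> M"
      hence "x \<in> e \<longleftrightarrow> x = Min e \<or> x = Max e" "Min e \<noteq> Max e" using edge by blast+
      thus "count_list [Min e, Max e] x = (if x \<in> e then 1 else 0)" by auto
    qed simp
    also have "\<dots> = card {e\<in>M. x \<in> e}" using fM by (simp add: sum.If_cases Int_def)
    also have "\<dots> = (if x \<in> {..<n} then 1 else 0)"
    proof (cases "x < n")
      case True
      then obtain e where e: "e \<in> M \<and> x \<in> e" "\<And>e'. e' \<in> M \<and> x \<in> e' \<Longrightarrow> e' = e" using M(2)[of x] by blast
      hence "{e\<in>M. x \<in> e} = {e}" by blast
      thus ?thesis using True by simp
    next
      case False
      have "x \<notin> e" if "e \<in> M" for e
        using edge[OF that] False by (metis insert_iff singletonD)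
      hence none: "{e\<in>M. x \<in> e} = {}" by blast
      show ?thesis unfolding none using False by simp
    qed
    finally show ?thesis .
  qed
  ultimately show ?thesis by blast
qed

section \<open>Connectivity\<close>

text \<open>The state \<open>n\<close>, which is not a vertex, stands for a broken walk.\<close>

definition walk_step :: "nat \<Rightarrow> nat \<Rightarrow> nat \<times> nat \<times> bool \<Rightarrow> nat" where
  "walk_step n z = (\<lambda>(u, v, c). if u = z then v else n)"
text \<open>The flag singles out one of the steps entering a vertex, so a walk may pass a vertex
  repeatedly and still mark it once.\<close>

definition walk_marks :: "nat \<times> nat \<times> bool \<Rightarrow> nat list" where
  "walk_marks = (\<lambda>(u, v, c). if c then [v] else [])"

lemma walk_step_simp [simp]: "walk_step n z (u, v, c) = (if u = z then v else n)"
  by (simp add: walk_step_def)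

text \<open>No edge starts at \<open>n\<close>, so a broken walk stays broken, and a walk that ends
  in a vertex was never broken.\<close>

lemma walk_reaches:
  assumes "\<And>u v c. (u, v, c) \<in> set ps \<Longrightarrow> {u, v} \<in> E \<and> u < n" "foldl (walk_step n) 0 ps \<noteq> n"
  shows "(0, foldl (walk_step n) 0 ps) \<in> (arcs E)\<^sup>* \<and> (\<forall>(u, v, c) \<in> set ps. (0, v) \<in> (arcs E)\<^sup>*)"
  using assms
proof (induction ps rule: rev_induct)
  case (snoc a ps)
  obtain u v c where a: "a = (u, v, c)" by (cases a)
  have u: "{u, v} \<in> E" "u < n" using snoc.prems(1)[of u v c] a by auto
  have z: "u = foldl (walk_step n) 0 ps" using snoc.prems(2) by (auto simp: a split: if_splits)
  have IH: "(0, foldl (walk_step n) 0 ps) \<in> (arcs E)\<^sup>* \<and> (\<forall>(u, v, c) \<in> set ps. (0, v) \<in> (arcs E)\<^sup>*)"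
  proof (rule snoc.IH)
    show "\<And>u v c. (u, v, c) \<in> set ps \<Longrightarrow> {u, v} \<in> E \<and> u < n" using snoc.prems(1) by (metis Un_iff set_append)
    show "foldl (walk_step n) 0 ps \<noteq> n" using u(2) z by simp
  qed
  have "(u, v) \<in> arcs E" using u by (simp add: arcs_def)
  hence "(0, v) \<in> (arcs E)\<^sup>*" using IH z by (metis rtrancl.rtrancl_into_rtrancl)
  thus ?case using IH z by (auto simp: a)
qed simp

lemma connected_sound:
  assumes E: "E \<subseteq> all_edges n" and ps: "\<And>u v c. (u, v, c) \<in> set ps \<Longrightarrow> {u, v} \<in> E"
    and "foldl (walk_step n) 0 ps \<noteq> n"
    and count: "\<And>v. count_list (concat (map walk_marks ps)) v = (if v \<in> {1..<n} then 1 else 0)"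
  shows "connected_graph {..<n} E"
proof -
  have reach: "(0, v) \<in> (arcs E)\<^sup>*" if "v < n" for v
  proof (cases "v = 0")
    case False
    hence "v \<in> set (concat (map walk_marks ps))" using count[of v] that by (metis One_nat_def Suc_leI atLeastLessThan_iff count_notin not_gr_zero zero_neq_one)
    then obtain u c where "(u, v, c) \<in> set ps" by (auto simp: walk_marks_def split: if_splits)
    moreover have "{u, v} \<in> E \<and> u < n" if "(u, v, c) \<in> set ps" for u v c
      using ps[OF that] edge_less(1)[OF E] by blast
    ultimately show ?thesis using walk_reaches[of ps E n] assms(3) by blast
  qed simp
  have "(v, 0) \<in> (arcs E)\<^sup>*" if "v < n" for v
    using reach[OF that] sym_rtrancl[OF sym_arcs, of E] by (meson symD)
  hence "(u, v) \<in> (arcs E)\<^sup>*" if "u < n" "v < n" for u v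
    using reach that by (meson rtrancl_trans)
  thus ?thesis unfolding connected_graph_def arcs_def by auto
qed

lemma rtrancl_leaves:
  assumes "(a, b) \<in> R\<^sup>*" "a \<in> S" "b \<notin> S"
  shows "\<exists>x\<in>S. \<exists>y. y \<notin> S \<and> (x, y) \<in> R"
  using assms by (induction rule: rtrancl_induct) blast+

text \<open>A walk around a growing tree: for an edge from a visited \<open>x\<close> to a new
  \<open>y\<close>, the detour to \<open>y\<close> and back is inserted at a visit of
  \<open>x\<close>. The last conjunct provides this visit.\<close>

lemma ex_spanning_walk:
  assumes E: "E \<subseteq> all_edges n" and con: "connected_graph {..<n} E"
  shows "j < n \<Longrightarrow> \<exists>S ps. S \<subseteq> {..<n} \<and> 0 \<in> S \<and> card S = Suc j \<and> length ps = 2 * j \<and> foldl (walk_step n) 0 ps = 0 \<and>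
    (\<forall>u v c. (u, v, c) \<in> set ps \<longrightarrow> {u, v} \<in> E) \<and>
    (\<forall>v. count_list (concat (map walk_marks ps)) v = (if v \<in> S - {0} then 1 else 0)) \<and>
    (\<forall>s\<in>S. \<exists>ps1 ps2. ps = ps1 @ ps2 \<and> foldl (walk_step n) 0 ps1 = s)"
proof (induction j)
  case 0
  show ?case by (rule exI[of _ "{0}"], rule exI[of _ "[]"]) (use 0 in auto)
next
  case (Suc j)
  then obtain S ps where S: "S \<subseteq> {..<n}" "0 \<in> S" "card S = Suc j" and ps: "length ps = 2 * j" "foldl (walk_step n) 0 ps = 0"
    "\<And>u v c. (u, v, c) \<in> set ps \<Longrightarrow> {u, v} \<in> E"
    and count: "\<And>v. count_list (concat (map walk_marks ps)) v = (if v \<in> S - {0} then 1 else 0)"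
    and visit: "\<And>s. s \<in> S \<Longrightarrow> \<exists>ps1 ps2. ps = ps1 @ ps2 \<and> foldl (walk_step n) 0 ps1 = s"
    by (metis Suc_lessD)
  have "S \<noteq> {..<n}" using S(3) Suc.prems by auto
  then obtain b where "b < n" "b \<notin> S" using S(1) by blast
  moreover have "(0, b) \<in> (arcs E)\<^sup>*" using con \<open>b < n\<close> Suc.prems unfolding connected_graph_def arcs_def by auto
  ultimately obtain x y where xy: "x \<in> S" "y \<notin> S" "{x, y} \<in> E"
    using rtrancl_leaves[of 0 b "arcs E" S] S(2) by (auto simp: arcs_def)
  have yn: "y < n" using edge_less(2)[OF E xy(3)] .
  obtain ps1 ps2 where split: "ps = ps1 @ ps2" "foldl (walk_step n) 0 ps1 = x" using visit[OF xy(1)] by blast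
  define d where "d = [(x, y, True), (y, x, False)]"
  have d: "foldl (walk_step n) x d = x" by (simp add: d_def)
  have visit': "\<exists>qs1 qs2. ps1 @ d @ ps2 = qs1 @ qs2 \<and> foldl (walk_step n) 0 qs1 = s" if s: "s \<in> insert y S" for s
  proof (cases "s = y")
    case True
    have "foldl (walk_step n) 0 (ps1 @ [(x, y, True)]) = y" using split(2) by simp
    moreover have "ps1 @ d @ ps2 = (ps1 @ [(x, y, True)]) @ (y, x, False) # ps2" by (simp add: d_def)
    ultimately show ?thesis using True by blast
  next
    case False
    then obtain rs1 rs2 where rs: "ps = rs1 @ rs2" "foldl (walk_step n) 0 rs1 = s" using visit[of s] s by blast
    then consider us where "rs1 @ us = ps1" | us where "rs1 = ps1 @ us" "us @ rs2 = ps2"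
      using split(1) by (auto simp: append_eq_append_conv2)
    thus ?thesis
    proof cases
      case 1
      hence "ps1 @ d @ ps2 = rs1 @ (us @ d @ ps2)" by auto
      thus ?thesis using rs(2) by blast
    next
      case 2
      hence "ps1 @ d @ ps2 = (ps1 @ d @ us) @ rs2" by simp
      moreover have "foldl (walk_step n) 0 (ps1 @ d @ us) = s" using rs(2) 2(1) split(2) d by simp
      ultimately show ?thesis by blast
    qed
  qed
  have "foldl (walk_step n) 0 (ps1 @ d @ ps2) = 0" using ps(2) split d by simp
  moreover have "length (ps1 @ d @ ps2) = 2 * Suc j" using ps(1) split(1) by (simp add: d_def)
  moreover have edges': "{u, v} \<in> E" if "(u, v, c) \<in> set (ps1 @ d @ ps2)" for u v c
    using that ps(3) split(1) xy(3) by (auto simp: d_def insert_commute)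
  moreover have "\<forall>v. count_list (concat (map walk_marks (ps1 @ d @ ps2))) v = (if v \<in> insert y S - {0} then 1 else 0)"
  proof
    fix v
    have "count_list (concat (map walk_marks (ps1 @ d @ ps2))) v = (if v = y then 1 else 0) + count_list (concat (map walk_marks ps)) v"
      by (auto simp: d_def walk_marks_def split)
    moreover have "y \<noteq> 0" using xy(2) S(2) by metis
    ultimately show "count_list (concat (map walk_marks (ps1 @ d @ ps2))) v = (if v \<in> insert y S - {0} then 1 else 0)"
      using count[of v] xy(2) by auto
  qed
  moreover have "card (insert y S) = Suc (Suc j)" using S(1,3) xy(2) finite_subset[OF S(1)] by simp
  moreover have "insert y S \<subseteq> {..<n}" "0 \<in> insert y S" using S yn by auto
  ultimately show ?case
    by - (rule exI[of _ "insert y S"], rule exI[of _ "ps1 @ d @ ps2"], intro conjI,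
      (assumption | (intro allI impI, erule edges') | rule ballI, erule visit')+)
qed

lemma connected_complete:
  assumes E: "E \<subseteq> all_edges n" and n: "n \<ge> 2" and con: "connected_graph {..<n} E"
  shows "\<exists>ps. ps \<noteq> [] \<and> length ps \<le> 2 * n \<and> (\<forall>u v c. (u, v, c) \<in> set ps \<longrightarrow> {u, v} \<in> E) \<and>
    foldl (walk_step n) 0 ps \<noteq> n \<and> (\<forall>v. count_list (concat (map walk_marks ps)) v = (if v \<in> {1..<n} then 1 else 0))"
proof -
  have "n - 1 < n" using n by simp
  from ex_spanning_walk[OF E con this] obtain S ps where S: "S \<subseteq> {..<n}" "card S = Suc (n - 1)" and ps: "length ps = 2 * (n - 1)" "foldl (walk_step n) 0 ps = 0"
    "\<forall>u v c. (u, v, c) \<in> set ps \<longrightarrow> {u, v} \<in> E"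
    and count: "\<forall>v. count_list (concat (map walk_marks ps)) v = (if v \<in> S - {0} then 1 else 0)"
    by blast
  have "S = {..<n}" using S n by (intro card_subset_eq) auto
  hence "S - {0} = {1..<n}" by auto
  moreover have "ps \<noteq> []" "length ps \<le> 2 * n" using ps(1) n by auto
  ultimately show ?thesis using ps(2,3) count n by (intro exI[of _ ps]) auto
qed

section \<open>Non-bipartiteness\<close>

text \<open>A state consists of the start, the current vertex and the parity of a walk. The start is \<open>n\<close>
  before the first step, and the current vertex is \<open>n\<close> after the walk has been broken.\<close>

definition parity_step :: "nat \<Rightarrow> nat \<times> nat \<times> bool \<Rightarrow> nat \<times> nat \<times> bool \<Rightarrow> nat \<times> nat \<times> bool" where
  "parity_step n = (\<lambda>(s, z, b) (u, v, c).
     if s = n then (u, v, True) else if u = z then (s, v, \<not> b) else (s, n, b))"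

lemma parity_step_simp [simp]: "parity_step n (s, z, b) (u, v, c) =
    (if s = n then (u, v, True) else if u = z then (s, v, \<not> b) else (s, n, b))"
  by (simp add: parity_step_def)

text \<open>Every edge changes sides, so the parity of an unbroken walk tells whether its ends lie
  on different sides. An accepted walk would end where it started, with odd parity.\<close>

lemma parity_of_bipartition:
  assumes E: "E \<subseteq> all_edges n" and A: "\<And>e. e \<in> E \<Longrightarrow> \<exists>u\<in>A. \<exists>v\<in>{..<n} - A. e = {u, v}"
    and ps: "\<And>u v c. (u, v, c) \<in> set ps \<Longrightarrow> {u, v} \<in> E"
  shows "case foldl (parity_step n) (n, n, False) ps of (s, z, b) \<Rightarrow>
    (s = n \<and> z = n \<and> \<not> b) \<or> (s < n \<and> (z = n \<or> (z < n \<and> (b \<longleftrightarrow> (s \<in> A) \<noteq> (z \<in> A)))))"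
  using ps
proof (induction ps rule: rev_induct)
  case (snoc a ps)
  obtain u v c where a: "a = (u, v, c)" by (cases a)
  have uv: "{u, v} \<in> E" using snoc.prems[of u v c] a by simp
  have "u < n" "v < n" using edge_less[OF E uv] by auto
  moreover have "(u \<in> A) \<noteq> (v \<in> A)" using A[OF uv] by (auto simp: doubleton_eq_iff)
  moreover obtain s z b where f: "foldl (parity_step n) (n, n, False) ps = (s, z, b)" by (metis prod_cases3)
  moreover have "(s = n \<and> z = n \<and> \<not> b) \<or> (s < n \<and> (z = n \<or> (z < n \<and> (b \<longleftrightarrow> (s \<in> A) \<noteq> (z \<in> A)))))"
  proof -
    have "{u, v} \<in> E" if "(u, v, c) \<in> set ps" for u v c using snoc.prems[of u v c] that by simp
    from snoc.IH[OF this] show ?thesis using f by simp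
  qed
  ultimately show ?case by (auto simp: a)
qed simp

lemma non_bipartite_sound:
  assumes E: "E \<subseteq> all_edges n" and ps: "\<And>u v c. (u, v, c) \<in> set ps \<Longrightarrow> {u, v} \<in> E"
    and acc: "(case foldl (parity_step n) (n, n, False) ps of (s, z, b) \<Rightarrow> s = z \<and> b)"
  shows "non_bipartite {..<n} E"
  unfolding non_bipartite_def bipartite_def
proof
  assume "\<exists>A\<subseteq>{..<n}. \<forall>e\<in>E. \<exists>u\<in>A. \<exists>v\<in>{..<n} - A. e = {u, v}"
  then obtain A where A: "\<And>e. e \<in> E \<Longrightarrow> \<exists>u\<in>A. \<exists>v\<in>{..<n} - A. e = {u, v}" by blast
  obtain s z b where f: "foldl (parity_step n) (n, n, False) ps = (s, z, b)" by (metis prod_cases3)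
  have "(s = n \<and> z = n \<and> \<not> b) \<or> (s < n \<and> (z = n \<or> (z < n \<and> (b \<longleftrightarrow> (s \<in> A) \<noteq> (z \<in> A)))))"
    using parity_of_bipartition[of E n A ps, OF E A ps] unfolding f by simp
  thus False using acc unfolding f by auto
qed

lemma relpow_arcs_sym: "(x, y) \<in> arcs E ^^ k \<Longrightarrow> (y, x) \<in> arcs E ^^ k"
proof (induction k arbitrary: y)
  case (Suc k)
  then obtain z where "(x, z) \<in> arcs E ^^ k" "(z, y) \<in> arcs E" by auto
  hence "(z, x) \<in> arcs E ^^ k" "(y, z) \<in> arcs E" using Suc.IH sym_arcs[of E] by (auto dest: symD)
  thus ?case by (meson relpow_Suc_I2)
qed simp

lemma relpow_trans: "(x, y) \<in> R ^^ j \<Longrightarrow> (y, z) \<in> R ^^ k \<Longrightarrow> (x, z) \<in> R ^^ (j + k)"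
  unfolding relpow_add by (rule relcompI)

text \<open>Without odd closed walks, all walks from a representative of the component to
  \<open>v\<close> have the same parity, and this parity is a 2-colouring.\<close>

lemma ex_odd_closed_walk:
  assumes E: "E \<subseteq> all_edges n" and nb: "non_bipartite {..<n} E"
  shows "\<exists>k x. odd k \<and> (x, x) \<in> arcs E ^^ k"
proof (rule ccontr)
  assume no: "\<not> ?thesis"
  define rep where "rep v = (LEAST u. (v, u) \<in> (arcs E)\<^sup>*)" for v
  have rep: "(rep v, v) \<in> (arcs E)\<^sup>*" for v
  proof -
    have "(v, rep v) \<in> (arcs E)\<^sup>*" unfolding rep_def by (rule LeastI[of _ v]) simp
    thus ?thesis using sym_rtrancl[OF sym_arcs, of E] by (meson symD)
  qed
  define A where "A = {v \<in> {..<n}. \<exists>k. even k \<and> (rep v, v) \<in> arcs E ^^ k}"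
  have flip: "(u \<in> A) \<noteq> (v \<in> A)" if uv: "{u, v} \<in> E" for u v
  proof -
    have arc: "(u, v) \<in> arcs E" "(v, u) \<in> arcs E" using uv by (auto simp: arcs_def insert_commute)
    have "(u, w) \<in> (arcs E)\<^sup>* \<longleftrightarrow> (v, w) \<in> (arcs E)\<^sup>*" for w
      using arc by (meson converse_rtrancl_into_rtrancl)
    hence r: "rep u = rep v" by (simp add: rep_def)
    have lt: "u < n" "v < n" using edge_less[OF E uv] by auto
    obtain k where k: "(rep u, u) \<in> arcs E ^^ k" using rep[of u] rtrancl_imp_relpow by blast
    have kv: "(rep v, v) \<in> arcs E ^^ Suc k" using k arc(1) r by auto
    have parity: "even i \<longleftrightarrow> even j" if "(x, y) \<in> arcs E ^^ i" "(x, y) \<in> arcs E ^^ j" for x y i j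
      using no relpow_trans[OF that(1) relpow_arcs_sym[OF that(2)]] by (metis even_add)
    have "u \<in> A \<longleftrightarrow> even k" using parity[OF k] k lt(1) unfolding A_def by blast
    moreover have "v \<in> A \<longleftrightarrow> even (Suc k)" using parity[OF kv] kv lt(2) unfolding A_def by blast
    ultimately show ?thesis by simp
  qed
  have "bipartite {..<n} E"
    unfolding bipartite_def
  proof (intro exI[of _ A] conjI ballI)
    show "A \<subseteq> {..<n}" by (auto simp: A_def)
    fix e assume e: "e \<in> E"
    then obtain u v where uv: "e = {u, v}" "u < n" "v < n" using all_edgesE[of e n] E by (metis subsetD)
    from flip[of u v] e uv(1) consider "u \<in> A" "v \<notin> A" | "v \<in> A" "u \<notin> A" by blast
    thus "\<exists>u\<in>A. \<exists>v\<in>{..<n} - A. e = {u, v}"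
    proof cases
      case 1
      thus ?thesis using uv by (intro bexI[of _ u] bexI[of _ v]) auto
    next
      case 2
      thus ?thesis using uv by (intro bexI[of _ v] bexI[of _ u]) auto
    qed
  qed
  thus False using nb by (simp add: non_bipartite_def)
qed

text \<open>A shortest odd closed walk does not repeat a vertex, since it could be split there into two
  closed walks, one of which is odd.\<close>

lemma ex_short_odd_closed_walk:
  assumes E: "E \<subseteq> all_edges n" and nb: "non_bipartite {..<n} E"
  shows "\<exists>k f. odd k \<and> k \<le> n \<and> f k = f 0 \<and> (\<forall>i<k. {f i, f (Suc i)} \<in> E)"
proof -
  define P where "P k \<longleftrightarrow> odd k \<and> (\<exists>x. (x, x) \<in> arcs E ^^ k)" for k
  have "\<exists>k. P k" using ex_odd_closed_walk[OF E nb] by (auto simp: P_def)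
  define k where "k = (LEAST k. P k)"
  have "P k" unfolding k_def using \<open>\<exists>k. P k\<close> by (rule LeastI_ex)
  then obtain x where k: "odd k" "(x, x) \<in> arcs E ^^ k" by (auto simp: P_def)
  then obtain f where f: "f 0 = x" "f k = x" "\<And>i. i < k \<Longrightarrow> (f i, f (Suc i)) \<in> arcs E"
    by (auto simp: relpow_fun_conv)
  have seg: "(f i, f j) \<in> arcs E ^^ (j - i)" if "i \<le> j" "j \<le> k" for i j
    unfolding relpow_fun_conv using that f(3) by (intro exI[of _ "\<lambda>t. f (i + t)"]) auto
  have "inj_on f {..<k}"
  proof (rule linorder_inj_onI)
    fix i j assume "i < j" "i \<in> {..<k}" "j \<in> {..<k}"
    hence ij: "i < j" "j < k" by auto
    show "f i \<noteq> f j"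
    proof
      assume eq: "f i = f j"
      have in1: "(f i, f i) \<in> arcs E ^^ (j - i)" using seg[of i j] ij eq by simp
      have "(f 0, f i) \<in> arcs E ^^ (i - 0)" "(f i, f k) \<in> arcs E ^^ (k - j)"
        using seg[of 0 i] seg[of j k] ij eq by auto
      from relpow_trans[OF this] have in2: "(x, x) \<in> arcs E ^^ (i + (k - j))" using f by simp
      have "P (j - i) \<or> P (i + (k - j))"
      proof -
        have "(j - i) + (i + (k - j)) = k" using ij by simp
        hence "odd (j - i) \<or> odd (i + (k - j))" using k(1) by (metis even_add)
        thus ?thesis using in1 in2 by (auto simp: P_def)
      qed
      thus False
      proof
        assume "P (j - i)"
        hence "k \<le> j - i" unfolding k_def by (rule Least_le)
        thus False using ij by linarith
      next
        assume "P (i + (k - j))"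
        hence "k \<le> i + (k - j)" unfolding k_def by (rule Least_le)
        thus False using ij by linarith
      qed
    qed
  qed auto
  moreover have "f ` {..<k} \<subseteq> {..<n}"
  proof
    fix y assume "y \<in> f ` {..<k}"
    then obtain i where "y = f i" "{f i, f (Suc i)} \<in> E" using f(3) by (auto simp: arcs_def)
    thus "y \<in> {..<n}" using edge_less(1)[OF E] by blast
  qed
  ultimately have "k \<le> n" using card_inj_on_le[of f "{..<k}" "{..<n}"] by simp
  thus ?thesis using k(1) f by (intro exI[of _ k] exI[of _ f]) (auto simp: arcs_def)
qed

lemma non_bipartite_complete:
  assumes E: "E \<subseteq> all_edges n" and nb: "non_bipartite {..<n} E"
  shows "\<exists>ps. ps \<noteq> [] \<and> length ps \<le> 2 * n \<and> (\<forall>u v c. (u, v, c) \<in> set ps \<longrightarrow> {u, v} \<in> E) \<and>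
    (case foldl (parity_step n) (n, n, False) ps of (s, z, b) \<Rightarrow> s = z \<and> b)"
proof -
  obtain k f where k: "odd k" "k \<le> n" "f k = f 0" and f: "\<And>i. i < k \<Longrightarrow> {f i, f (Suc i)} \<in> E"
    using ex_short_odd_closed_walk[OF E nb] by blast
  define w where "w j = map (\<lambda>i. (f i, f (Suc i), False)) [0..<j]" for j
  have "foldl (parity_step n) (n, n, False) (w (Suc j)) = (f 0, f (Suc j), odd (Suc j))" if "Suc j \<le> k" for j
    using that
  proof (induction j)
    case (Suc j)
    have "f 0 < n" using edge_less(1)[OF E f[of 0]] Suc.prems by simp
    thus ?case using Suc by (simp add: w_def)
  qed (simp add: w_def)
  moreover obtain j where j: "k = Suc j" using k(1) by (cases k) auto
  ultimately have "foldl (parity_step n) (n, n, False) (w k) = (f 0, f k, odd k)" by simp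
  moreover have "w k \<noteq> []" "length (w k) \<le> 2 * n" using k(2) j by (auto simp: w_def)
  moreover have "{u, v} \<in> E" if "(u, v, c) \<in> set (w k)" for u v c
    using that f by (auto simp: w_def)
  ultimately show ?thesis using k(1,3) by (intro exI[of _ "w k"]) auto
qed

section \<open>Choice of the parameters\<close>

text \<open>As \<open>n \<ge> 2\<close>, constants are absorbed into powers of \<open>n\<close>, and
  all parameters can be compared with one power \<open>n ^ K\<close>.\<close>

lemma mult_power_le:
  fixes n :: nat
  assumes "2 \<le> n" "c \<le> 2 ^ e" "a + e \<le> K"
  shows "c * n ^ a \<le> n ^ K"
proof -
  have "c * n ^ a \<le> 2 ^ e * n ^ a" using assms(2) by (rule mult_le_mono1)
  also have "\<dots> \<le> n ^ e * n ^ a" using assms(1) by (intro mult_le_mono1 power_mono) auto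
  also have "\<dots> = n ^ (a + e)" by (simp add: power_add)
  also have "\<dots> \<le> n ^ K" using assms by (intro power_increasing) auto
  finally show ?thesis .
qed

lemma card_claim_words_le: "card (claim_words n b L) \<le> Suc (L * (n * (n * (b * 2))))"
proof -
  let ?X = "{..<L} \<times> {..<n} \<times> {..<n} \<times> {1..b} \<times> (UNIV :: bool set)"
  have "card (claim_words n b L) \<le> Suc (card ((\<lambda>c. [c]) ` ?X))"
    unfolding claim_words_def by (rule card_insert_le_m1) auto
  also have "card ((\<lambda>c. [c]) ` ?X) \<le> card ?X" by (rule card_image_le) simp
  finally show ?thesis by (simp add: card_cartesian_product)
qed

lemma finite_claim_words: "finite (claim_words n b L)"
  unfolding claim_words_def by simp

lemma ex_word_code:
  assumes "finite X" "x0 \<in> X" "card X \<le> p"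
  shows "\<exists>(f :: 'a \<Rightarrow> nat) g. (\<forall>x\<in>X. f x < p \<and> g (f x) = x) \<and> (\<forall>k. g k \<in> X)"
proof -
  obtain f where f: "f ` X \<subseteq> {..<p}" "inj_on f X"
    using card_le_inj[OF assms(1) finite_lessThan[of p]] assms(3) by auto
  define g where "g k = (if k \<in> f ` X then inv_into X f k else x0)" for k
  have "g k \<in> X" for k using assms(2) by (cases "k \<in> f ` X") (simp_all add: g_def inv_into_into)
  moreover have "f x < p \<and> g (f x) = x" if "x \<in> X" for x using f that by (auto simp: g_def)
  ultimately show ?thesis by blast
qed

lemma certificate_scheme:
  assumes cert: "certificate n F z0 zstep zacc Z marks T" and Z: "card Z \<le> 2 * (n + 1) ^ 2"
    and n: "2 \<le> n" and q: "2 \<le> q" "q \<le> m" and m: "m \<le> n ^ 2"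
  shows "has_relaxed_scheme (graph_streams n m (n ^ k)) (\<lambda>xs. F (stream_edges xs))
    (24 * (4 * real k + 49) * (real n * log 2 n + real m / real q * log 2 n))
    (84 * (4 * real k + 49) * ((real q)\<^sup>2 * log q m * log 2 n))"
proof -
  \<comment> \<open>The summand 1 ensures \<open>4 * m \<le> H * q\<close>, hence
    \<open>4 * m * q\<close> buckets with \<open>q ^ 2\<close> columns.\<close>
  define H where "H = 4 * m div q + 1"
  \<comment> \<open>\<open>L = i + 1\<close> is the least exponent with \<open>m < q ^ L\<close>. As
    \<open>q \<le> m\<close> gives \<open>i \<ge> 1\<close>, it is at most
    \<open>2 * log q m\<close>.\<close>
  obtain i where i: "q ^ i \<le> m" "m < q ^ (i + 1)" using ex_power_ivl1[of q m] q by auto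
  define L where "L = i + 1"
  have i1: "1 \<le> i" using i(2) q by (cases i) auto
  have "2 ^ i \<le> (2::nat) ^ (2 * n)"
  proof -
    have "(2::nat) ^ i \<le> q ^ i" using q by (intro power_mono) auto
    also have "\<dots> \<le> n ^ 2" using i(1) m by simp
    also have "\<dots> \<le> (2 ^ n) ^ 2" by (rule power_mono[OF less_imp_le[OF less_exp]]) simp
    finally show ?thesis by (simp add: power_mult[symmetric] mult.commute)
  qed
  hence "i \<le> 2 * n" by simp
  hence Ln: "L \<le> 3 * n" using n by (simp add: L_def)
  \<comment> \<open>The largest lower bound on \<open>p\<close> comes from the sum of all defects,
    at most \<open>10 * n ^ (2 * k + 7)\<close>; 24 is generous. It entails the 49 in the word
    length, since \<open>4 * k + 49 = 2 * K + 1\<close>.\<close>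
  define K where "K = 2 * k + 24"
  have "n ^ K \<ge> 2 ^ 4" 
  proof -
    have "(2::nat) ^ 4 \<le> 2 ^ K" by (intro power_increasing) (auto simp: K_def)
    also have "\<dots> \<le> n ^ K" using n by (intro power_mono) auto
    finally show ?thesis .
  qed
  then obtain p where p: "prime p" "n ^ K < p" "p \<le> 2 * (n ^ K) ^ 2" using ex_prime_between[of "n ^ K"] by auto
  define j where "j = nat \<lceil>log 2 n\<rceil>"
  define W where "W = (4 * k + 49) * j"
  have log1: "1 \<le> log 2 n" using n by simp
  have j: "n \<le> 2 ^ j" "real j \<le> 2 * log 2 n" "1 \<le> j"
  proof -
    have "log 2 n \<le> real j" unfolding j_def by linarith
    hence "real n \<le> 2 powr real j" using n by (simp add: log_le_iff)
    thus "n \<le> 2 ^ j" by (simp add: powr_realpow)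
    show "real j \<le> 2 * log 2 n" "1 \<le> j" unfolding j_def using log1 by linarith+
  qed
  have "p \<le> 2 ^ W"
  proof -
    have "p \<le> 2 * n ^ (2 * K)" using p(3) by (simp add: power_mult[symmetric] mult.commute)
    also have "\<dots> \<le> n ^ (2 * K + 1)" using n by (intro mult_power_le[where e = 1]) auto
    also have "\<dots> \<le> (2 ^ j) ^ (2 * K + 1)" using j(1) by (rule power_mono) simp
    also have "\<dots> = 2 ^ W" by (simp add: W_def K_def power_mult[symmetric] algebra_simps)
    finally show ?thesis .
  qed
  have small: "c * n ^ a < p" if "c \<le> 2 ^ e" "a + e \<le> K" for c a e
    using mult_power_le[OF n that] p(2) by simp
  have H_le: "H \<le> 5 * n ^ 2"
  proof -
    have "4 * m div q \<le> 4 * m" by (rule div_le_dividend)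
    moreover have "1 \<le> n ^ 2" using n by simp
    ultimately show ?thesis using m unfolding H_def by linarith
  qed
  have C_le: "q ^ 2 \<le> n ^ 4"
  proof -
    have "q ^ 2 \<le> (n ^ 2) ^ 2" using q m by (intro power_mono) auto
    thus ?thesis by (simp add: power_mult[symmetric])
  qed
  have nn: "n \<le> n ^ 2" "1 \<le> n ^ 2" using n by (auto simp: power2_eq_square)
  obtain ecl :: "(nat \<times> nat \<times> nat \<times> nat \<times> bool) list \<Rightarrow> nat" and dcl
    where cl: "\<And>c. c \<in> claim_words n (n ^ k) L \<Longrightarrow> ecl c < p \<and> dcl (ecl c) = c" "\<And>x. dcl x \<in> claim_words n (n ^ k) L"
  proof -
    have "card (claim_words n (n ^ k) L) \<le> Suc (L * (n * (n * (n ^ k * 2))))" by (rule card_claim_words_le)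
    also have "\<dots> \<le> Suc (3 * n * (n * (n * (n ^ k * 2))))" using Ln by (simp add: mult_le_mono1)
    also have "\<dots> \<le> 7 * n ^ (k + 3)" using n by (simp add: power_add power3_eq_cube algebra_simps Suc_le_eq)
    also have "\<dots> \<le> p" by (intro less_imp_le small[of _ 3]) (auto simp: K_def)
    finally have "card (claim_words n (n ^ k) L) \<le> p" .
    moreover have "[] \<in> claim_words n (n ^ k) L" by (simp add: claim_words_def)
    ultimately show ?thesis using ex_word_code[OF finite_claim_words] that by metis
  qed
  have p0: "0 < p" using p(1) prime_gt_0_nat by blast
  obtain enc :: "nat \<Rightarrow> bool list" and dec where ed: "\<And>x. length (enc x) = W" "\<And>x. x < p \<Longrightarrow> dec (enc x) = x" "\<And>w. dec w < p"
  proof -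
    have "{..<p} \<noteq> {}" "card {..<p} \<le> 2 ^ W" using p0 \<open>p \<le> 2 ^ W\<close> by auto
    from ex_bit_decoder[OF finite_lessThan this] show ?thesis using that by (metis lessThan_iff)
  qed
  interpret certificate n F z0 zstep zacc Z marks T by (rule cert)
  interpret protocol n p H "q ^ 2" L F z0 zstep zacc Z marks T "n ^ k" m q W dcl ecl enc dec
  proof unfold_locales
    show "prime p" by (rule p(1))
    show "0 < H" by (simp add: H_def)
    show "0 < q ^ 2" using q by simp
    have "9 * H \<le> 45 * n ^ 2" using H_le by simp
    also have "\<dots> < p" by (rule small[of _ 6]) (auto simp: K_def)
    finally show "9 * H \<le> p" by simp
    have "H * q ^ 2 \<le> (5 * n ^ 2) * n ^ 4" using H_le C_le by (rule mult_le_mono)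
    also have "\<dots> = 5 * n ^ 6" by (simp add: power_add[symmetric])
    also have "\<dots> < p" by (rule small[of _ 3]) (auto simp: K_def)
    finally show "H * q ^ 2 \<le> p" by simp
    show "n ^ 2 \<le> p" using small[of 1 0 2] by (simp add: K_def)
    show "0 < W" using j(3) by (simp add: W_def)
    show "p \<le> 2 ^ W" by fact
    show "2 * n * (n ^ 2 * n ^ k * n ^ 4 + (n ^ 2 * n ^ k + n ^ k) ^ 2) < p"
    proof -
      have "n ^ 2 * n ^ k + n ^ k \<le> 2 * n ^ (k + 2)"
      proof -
        have "n ^ (k + 2) = n ^ 2 * n ^ k" by (simp only: power_add mult.commute)
        thus ?thesis using mult_le_mono1[OF nn(2), of "n ^ k"] by linarith
      qed
      hence "(n ^ 2 * n ^ k + n ^ k) ^ 2 \<le> (2 * n ^ (k + 2)) ^ 2" by (rule power_mono) simp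
      also have "\<dots> = 4 * n ^ (2 * k + 4)"
      proof -
        have "(k + 2) * 2 = 2 * k + 4" by simp
        thus ?thesis by (simp only: power_mult_distrib power_mult[symmetric]) simp
      qed
      also have "\<dots> \<le> 4 * n ^ (2 * k + 6)" using n by (intro mult_le_mono2 power_increasing) auto
      finally have 1: "(n ^ 2 * n ^ k + n ^ k) ^ 2 \<le> 4 * n ^ (2 * k + 6)" .
      have "n ^ 2 * n ^ k * n ^ 4 = n ^ (2 + k + 4)" by (simp only: power_add)
      also have "\<dots> \<le> n ^ (2 * k + 6)" using n by (intro power_increasing) auto
      finally have "n ^ 2 * n ^ k * n ^ 4 + (n ^ 2 * n ^ k + n ^ k) ^ 2 \<le> 5 * n ^ (2 * k + 6)" using 1 by linarith
      hence "2 * n * (n ^ 2 * n ^ k * n ^ 4 + (n ^ 2 * n ^ k + n ^ k) ^ 2) \<le> 2 * n * (5 * n ^ (2 * k + 6))" by (rule mult_le_mono2)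
      also have "\<dots> = 10 * n ^ Suc (2 * k + 6)" by (simp only: power_Suc mult_ac)
      also have "\<dots> < p" by (rule small[of _ 4]) (auto simp: K_def)
      finally show ?thesis .
    qed
    show "4 * n < p" using small[of 4 2 1] by (simp add: K_def)
    have "card Z \<le> 2 * (2 * n) ^ 2" using Z n by (elim order.trans) (intro mult_le_mono2 power_mono, auto)
    also have "\<dots> = 8 * n ^ 2" by (simp add: power_mult_distrib)
    also have "\<dots> < p" by (rule small[of _ 3]) (auto simp: K_def)
    finally show "card Z \<le> p" by simp
    have "4 * m \<le> H * q"
      using div_mult_mod_eq[of "4 * m" q] mod_less_divisor[of q "4 * m"] q unfolding H_def by (simp only: distrib_right) linarith
    thus "4 * m * q \<le> H * q ^ 2" unfolding power2_eq_square mult.assoc[symmetric] by (rule mult_le_mono1)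
    show "0 < m" using q by simp
    show "m < q ^ L" using i(2) by (simp add: L_def)
    have "L + 2 * n + 3 * H \<le> 20 * n ^ 2" using Ln H_le nn by linarith
    also have "\<dots> < p" by (rule small[of _ 5]) (auto simp: K_def)
    finally show "L + 2 * n + 3 * H < p" .
  qed (use cl ed in auto)
  define w where "w = 2 * (4 * real k + 49)"
  have W_le: "real W \<le> w * log 2 n"
  proof -
    have "real W = (4 * real k + 49) * real j" by (simp add: W_def)
    also have "\<dots> \<le> (4 * real k + 49) * (2 * log 2 n)" using j(2) by (intro mult_left_mono) auto
    also have "\<dots> = w * log 2 n" by (simp add: w_def)
    finally show ?thesis .
  qed
  have mq: "1 \<le> real m / real q" using q by simp
  have ann: "real (L + 2 * n + 3 * H) \<le> 12 * (real n + real m / real q)"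
  proof -
    have "real (4 * m div q) \<le> real (4 * m) / real q" by (rule of_nat_div_le_of_nat)
    hence "real H \<le> 4 * (real m / real q) + 1" by (simp add: H_def)
    moreover have "real L \<le> 3 * real n" using Ln by linarith
    moreover have "2 \<le> real n" using n by simp
    ultimately show ?thesis using mq by simp
  qed
  have log_L: "real L \<le> 2 * log q m"
  proof -
    have "real (q ^ i) \<le> real m" using i(1) by (rule of_nat_mono)
    hence "real i \<le> log q m" using q by (simp add: le_log_of_power)
    thus ?thesis using i1 by (simp add: L_def)
  qed
  have L1: "1 \<le> L" by (simp add: L_def)
  have "real ((L + 2 * n + 3 * H) * W) \<le> (12 * (real n + real m / real q)) * (w * log 2 n)"
    unfolding of_nat_mult using ann W_le by (rule mult_mono) auto
  hence A: "real ((L + 2 * n + 3 * H) * W) \<le> 24 * (4 * real k + 49) * (real n * log 2 n + real m / real q * log 2 n)"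
    by (simp add: w_def algebra_simps)
  have "7 * (L * q ^ 2) + L + 13 \<le> 21 * (L * q ^ 2)"
  proof -
    have "1 \<le> q ^ 2" using q by simp
    hence "L * 1 \<le> L * q ^ 2" by (rule mult_le_mono2)
    thus ?thesis using L1 by linarith
  qed
  hence "real (7 * (L * q ^ 2) + L + 13) \<le> 21 * (real L * (real q)\<^sup>2)" using of_nat_mono by fastforce
  also have "\<dots> \<le> 21 * (2 * log q m * (real q)\<^sup>2)" using log_L by (intro mult_left_mono mult_right_mono) auto
  finally have "real (7 * (L * q ^ 2) + L + 13) \<le> 21 * (2 * log q m * (real q)\<^sup>2)" .
  from mult_mono[OF W_le this]
  have "real (W * (7 * (L * q ^ 2) + L + 13)) \<le> w * log 2 n * (21 * (2 * log q m * (real q)\<^sup>2))"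
    using log1 unfolding of_nat_mult by (simp add: w_def)
  hence B: "real (W * (7 * (L * q ^ 2) + L + 13)) \<le> 84 * (4 * real k + 49) * ((real q)\<^sup>2 * log q m * log 2 n)"
    by (simp add: w_def algebra_simps)
  show ?thesis by (rule has_relaxed_scheme_mono[OF protocol_scheme order.refl A B])
qed

text \<open>The choice is the integer part of \<open>sqrt v\<close>, but at least 2 and, for
  \<open>v > M\<^sup>2\<close>, equal to \<open>M\<close>. Up to \<open>v = M\<^sup>2\<close> the
  factor \<open>log v M\<close> is at least 1/2 and does not hurt the annotation bound; beyond that
  it tends to 0 and the summand 1 takes over.\<close>

lemma ex_tradeoff:
  fixes v :: real and M :: nat
  assumes v: "1 < v" and M: "2 \<le> M"
  shows "\<exists>q::nat. 2 \<le> q \<and> q \<le> M \<and> real M / real q \<le> 4 * (1 + real M * v powr (- 1/2) * log v M) \<and>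
    (real q)\<^sup>2 * log q M \<le> 8 * (v * log v M)"
proof -
  have powr: "v powr (- 1/2) = 1 / sqrt v" using v by (simp add: powr_minus_divide powr_half_sqrt)
  have lnv: "0 < ln v" and ln2: "2 / 3 \<le> ln (2::real)" using v ln2_ge_two_thirds by auto
  have lnM: "ln 2 \<le> ln (real M)" using M by simp
  have sq: "0 < sqrt v" using v by simp
  have half: "1 / 2 \<le> log v M" if "v \<le> (real M)\<^sup>2"
  proof -
    have "ln v \<le> ln ((real M)\<^sup>2)" using that v M by (subst ln_le_cancel_iff) auto
    also have "\<dots> = 2 * ln (real M)" using M by (simp add: ln_realpow)
    finally show ?thesis using lnv by (simp add: log_def field_simps)
  qed
  have ann: "real M / real q \<le> 4 * (1 + real M * v powr (- 1/2) * log v M)"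
    if "v \<le> (real M)\<^sup>2" "sqrt v \<le> 2 * real q" "0 < q" for q :: nat
  proof -
    have "real M / real q \<le> 2 * (real M / sqrt v)"
    proof -
      have "real M * sqrt v \<le> real M * (2 * real q)" using that(2) by (intro mult_left_mono) auto
      thus ?thesis using sq that(3) by (simp add: field_simps)
    qed
    also have "\<dots> = 4 * (real M / sqrt v * (1 / 2))" by simp
    also have "\<dots> \<le> 4 * (real M / sqrt v * log v M)" using half[OF that(1)] sq by (intro mult_left_mono) auto
    finally show ?thesis unfolding powr by simp
  qed
  consider "v < 4" | "4 \<le> v" "v \<le> (real M)\<^sup>2" | "(real M)\<^sup>2 < v" by linarith
  thus ?thesis
  proof cases
    case 1
    have "4 \<le> (real M)\<^sup>2" using M power_mono[of 2 "real M" 2] by simp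
    hence "v \<le> (real M)\<^sup>2" using 1 by simp
    moreover have "sqrt v \<le> 2" using 1 real_sqrt_le_mono[of v 4] by simp
    ultimately have a: "real M / real 2 \<le> 4 * (1 + real M * v powr (- 1/2) * log v M)" by (intro ann) auto
    have "ln v \<le> v - 1" using v by (intro ln_le_minus_one) simp
    hence "ln v \<le> 2 * (v * ln 2)" using v mult_left_mono[OF ln2, of v] by linarith
    hence "ln v * ln (real M) \<le> 2 * (v * ln 2) * ln (real M)" using lnM ln2 by (intro mult_right_mono) auto
    hence "(real 2)\<^sup>2 * log (real 2) M \<le> 8 * (v * log v M)"
      using lnv ln2 by (simp add: log_def field_simps)
    thus ?thesis using a M by (intro exI[of _ 2]) auto
  next
    case 2
    define q where "q = nat \<lfloor>sqrt v\<rfloor>"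
    have s2: "2 \<le> sqrt v" using 2(1) real_sqrt_le_mono[of 4 v] by simp
    have q: "real q \<le> sqrt v" "sqrt v < real q + 1" "2 \<le> q" unfolding q_def using s2 by linarith+
    have "sqrt v \<le> real M" using 2(2) by (simp add: real_le_lsqrt)
    hence "q \<le> M" using q(1) by simp
    moreover have "real M / real q \<le> 4 * (1 + real M * v powr (- 1/2) * log v M)"
      using q by (intro ann 2(2)) auto
    moreover have "(real q)\<^sup>2 * log q M \<le> 8 * (v * log v M)"
    proof -
      have qv: "(real q)\<^sup>2 \<le> v" using power_mono[OF q(1), of 2] v by simp
      \<comment> \<open>Rounding down costs little: \<open>sqrt v < q + 1 \<le> q\<^sup>2\<close>
        for \<open>q \<ge> 2\<close>, so \<open>log q M\<close> is at most four times
        \<open>log v M\<close>.\<close>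
      have "sqrt v \<le> (real q)\<^sup>2"
      proof -
        have "real q + 1 \<le> 2 * real q" using q(3) by simp
        also have "\<dots> \<le> real q * real q" using q(3) by (intro mult_right_mono) auto
        finally show ?thesis using q(2) by (simp add: power2_eq_square)
      qed
      hence "(sqrt v)\<^sup>2 \<le> ((real q)\<^sup>2)\<^sup>2" using sq by (intro power_mono) auto
      hence "ln v \<le> ln (real q ^ 4)" using v q(3) by (simp add: power_mult[symmetric])
      also have "\<dots> = 4 * ln (real q)" using q(3) by (simp add: ln_realpow)
      finally have lq: "ln v \<le> 4 * ln (real q)" .
      have lq0: "0 < ln (real q)" using q(3) by simp
      have "log q M \<le> 4 * log v M"
      proof -
        have "ln (real M) * ln v \<le> ln (real M) * (4 * ln (real q))" using lq lnM ln2 by (intro mult_left_mono) auto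
        thus ?thesis using lq0 lnv by (simp add: log_def field_simps)
      qed
      moreover have "0 \<le> log q M" "0 \<le> log v M" using lq0 lnv lnM ln2 by (auto simp: log_def)
      ultimately have "(real q)\<^sup>2 * log q M \<le> v * (4 * log v M)" using qv v by (intro mult_mono) auto
      also have "\<dots> \<le> 8 * (v * log v M)" using \<open>0 \<le> log v M\<close> v by simp
      finally show ?thesis .
    qed
    ultimately show ?thesis using q(3) by blast
  next
    case 3
    \<comment> \<open>Here \<open>v * log v M\<close> still dominates \<open>M\<^sup>2\<close> up to
      a constant: by \<open>ln t \<le> t - 1\<close>, the factor \<open>t\<close> in
      \<open>v\<close> outweighs the growth of \<open>ln v\<close>.\<close>
    define t where "t = v / (real M)\<^sup>2"
    have M2: "0 < (real M)\<^sup>2" using M by simp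
    have t: "1 < t" "v = (real M)\<^sup>2 * t" using 3 M2 by (auto simp: t_def field_simps)
    have "ln v = 2 * ln (real M) + ln t" using t M by (simp add: ln_mult ln_realpow)
    moreover have "ln t \<le> t - 1" using t(1) by (intro ln_le_minus_one) simp
    moreover have "t * (2 / 3) \<le> t * ln (real M)" using ln2 lnM t(1) by (intro mult_left_mono) auto
    moreover have "1 * ln (real M) \<le> t * ln (real M)" using ln2 lnM t(1) by (intro mult_right_mono) auto
    ultimately have "ln v \<le> 8 * (t * ln (real M))" using t(1) by linarith
    hence "(real M)\<^sup>2 * ln v \<le> (real M)\<^sup>2 * (8 * (t * ln (real M)))" using M2 by (intro mult_left_mono) auto
    hence "(real M)\<^sup>2 \<le> 8 * (v * log v M)" using lnv t(2) by (simp add: log_def field_simps)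
    moreover have "log M M = 1" using M by simp
    moreover have "0 \<le> real M * v powr (- 1/2) * log v M" using lnv lnM ln2 by (simp add: log_def)
    ultimately show ?thesis using M by (intro exI[of _ M]) auto
  qed
qed

text \<open>For \<open>n = 1\<close> the factor \<open>log 2 n\<close> is 0, so no bit may be spent.
  The only stream is the empty one, and its answer is built into the verifier.\<close>

lemma has_relaxed_scheme_one_vertex:
  assumes "0 \<le> l" "0 \<le> s"
  shows "has_relaxed_scheme (graph_streams 1 m b) F l s"
proof -
  define V :: "update verifier" where
    "V = \<lparr>initial = return_pmf [], step = (\<lambda>s t. return_pmf s), out = (\<lambda>_. Some (F []))\<rparr>"
  define P :: "update prover" where "P = \<lparr>coins = return_pmf 0, annotation = (\<lambda>_ _ _. [])\<rparr>"
  have empty: "xs = []" if "xs \<in> graph_streams 1 m b" for xs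
  proof (rule ccontr)
    assume "xs \<noteq> []"
    then obtain e d ys where "xs = (e, d) # ys" by (metis list.exhaust prod.exhaust)
    hence "e \<subseteq> {..<1}" "card e = 2" using that by (auto simp: graph_streams_def strict_turnstile_def)
    moreover have "card e \<le> card {..<1::nat}" using calculation(1) by (rule card_mono[rotated]) simp
    ultimately show False by simp
  qed
  have out: "verifier_output V ts = return_pmf (Some (F []))" for ts
  proof -
    have "foldl (\<lambda>D t. bind_pmf D (\<lambda>s. step V s t)) (initial V) ts = return_pmf []"
      by (induction ts rule: rev_induct) (auto simp: V_def bind_return_pmf)
    thus ?thesis by (simp add: verifier_output_def V_def)
  qed
  have "relaxed_scheme (graph_streams 1 m b) F P V"
    unfolding relaxed_scheme_def
  proof (intro conjI ballI impI allI)
    fix xs assume "xs \<in> graph_streams 1 m b" "F xs"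
    hence "F []" using empty by metis
    thus "measure_pmf.prob (honest_output P V xs) {v. v \<noteq> Some True} \<le> 1 / 3"
      by (simp add: honest_output_def out P_def bind_return_pmf)
  next
    fix xs a assume "xs \<in> graph_streams 1 m b" "\<not> F xs"
    hence "\<not> F []" using empty by metis
    thus "measure_pmf.prob (verifier_output V (annotated xs a)) {v. v = Some True} \<le> 1 / 3" by (simp add: out)
  qed
  moreover have "annotation_length_le (graph_streams 1 m b) P l"
    using assms(1) by (simp add: annotation_length_le_def P_def)
  moreover have "verifier_space V 0" by (simp add: verifier_space_def V_def)
  ultimately show ?thesis using assms(2) unfolding has_relaxed_scheme_def by (intro exI[of _ P] exI[of _ V] exI[of _ 0]) simp
qed

text \<open>Replacing \<open>m\<close> by this minimum lets \<open>p\<close> be polynomial in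
  \<open>n\<close> even if the given \<open>m\<close> is not.\<close>

lemma graph_streams_min: "graph_streams n m b \<subseteq> graph_streams n (min m (n ^ 2)) b"
proof
  fix xs assume xs: "xs \<in> graph_streams n m b"
  hence "card (stream_edges xs) \<le> card (all_edges n)"
    using stream_edges_subset by (intro card_mono finite_all_edges) (auto simp: graph_streams_def)
  thus "xs \<in> graph_streams n (min m (n ^ 2)) b"
    using xs card_all_edges_le[of n] by (simp add: graph_streams_def)
qed

lemma scheme_of_certificate_family:
  fixes k :: nat
  assumes "\<And>n. 2 \<le> n \<Longrightarrow> certificate n (problem {..<n}) (z0 n) (zstep n) (zacc n) (Z n) marks (T n) \<and>
    card (Z n) \<le> 2 * (n + 1) ^ 2"
  shows "\<exists>C > 0. \<forall>(n::nat) (m::nat) (c\<^sub>v::real). n \<ge> 1 \<longrightarrow> m \<ge> 2 \<longrightarrow> c\<^sub>v > 1 \<longrightarrow>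
      has_relaxed_scheme (graph_streams n m (n ^ k)) (\<lambda>xs. problem {..<n} (stream_edges xs))
        (C * (real n * log 2 (real n)
              + real m * c\<^sub>v powr (- 1/2) * log 2 (real n) * log c\<^sub>v (real m)))
        (C * (c\<^sub>v * log 2 (real n) * log c\<^sub>v (real m)))"
proof -
  define w where "w = 4 * real k + 49"
  have w: "0 < w" by (simp add: w_def)
  show ?thesis
  \<comment> \<open>672 is the product of 84, the space constant of
    \<open>certificate_scheme\<close>, and 8 from \<open>ex_tradeoff\<close>. The annotation
    requires only \<open>24 * 5\<close>.\<close>
  proof (intro exI[of _ "672 * w"] conjI allI impI)
    show "0 < 672 * w" using w by simp
    fix n m :: nat and v :: real
    assume n: "1 \<le> n" and m: "2 \<le> m" and v: "1 < v"
    show "has_relaxed_scheme (graph_streams n m (n ^ k)) (\<lambda>xs. problem {..<n} (stream_edges xs))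
        (672 * w * (real n * log 2 (real n) + real m * v powr (- 1/2) * log 2 (real n) * log v (real m)))
        (672 * w * (v * log 2 (real n) * log v (real m)))"
    proof (cases "n = 1")
      case True
      show ?thesis unfolding True by (rule has_relaxed_scheme_one_vertex) simp_all
    next
      case False
      hence n2: "2 \<le> n" using n by simp
      define M where "M = min m (n ^ 2)"
      have "(2::nat) ^ 2 \<le> n ^ 2" using n2 by (rule power_mono) simp
      hence M: "2 \<le> M" "M \<le> n ^ 2" "M \<le> m" using m by (auto simp: M_def)
      obtain q where q: "2 \<le> q" "q \<le> M" "real M / real q \<le> 4 * (1 + real M * v powr (- 1/2) * log v M)"
        "(real q)\<^sup>2 * log q M \<le> 8 * (v * log v M)"
        using ex_tradeoff[OF v M(1)] by blast
      define a where "a = log 2 (real n)"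
      have a: "1 \<le> a" using n2 by (simp add: a_def)
      have logM: "0 \<le> log v M" "log v M \<le> log v m" using v M by (auto simp: log_le_cancel_iff)
      have mono: "real M * v powr (- 1/2) * log v M \<le> real m * v powr (- 1/2) * log v m"
        using M(3) logM by (intro mult_mono) auto
      have "24 * w * (real n * a + real M / real q * a) \<le> 672 * w * (real n * a + real m * v powr (- 1/2) * a * log v m)"
      proof -
        have mq: "real M / real q \<le> 4 * (real n + real m * v powr (- 1/2) * log v m)" using q(3) mono n2 by simp
        hence "real n + real M / real q \<le> 5 * (real n + real m * v powr (- 1/2) * log v m)"
        proof -
          have "0 \<le> real m * v powr (- 1/2) * log v m" using logM by simp
          moreover have "r \<le> 4 * (x + y) \<Longrightarrow> 0 \<le> y \<Longrightarrow> x + r \<le> 5 * (x + y)" for r x y :: real by simp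
          ultimately show ?thesis using mq by blast
        qed
        hence "(24 * w * a) * (real n + real M / real q) \<le> (24 * w * a) * (5 * (real n + real m * v powr (- 1/2) * log v m))"
          using w a by (intro mult_left_mono) auto
        also have "\<dots> = 120 * (w * a * (real n + real m * v powr (- 1/2) * log v m))" by simp
        also have "\<dots> \<le> 672 * (w * a * (real n + real m * v powr (- 1/2) * log v m))"
          using w a logM by (intro mult_right_mono) auto
        finally show ?thesis by (simp add: algebra_simps)
      qed
      hence A: "24 * (4 * real k + 49) * (real n * log 2 n + real M / real q * log 2 n)
         \<le> 672 * w * (real n * log 2 (real n) + real m * v powr (- 1/2) * log 2 (real n) * log v (real m))"
        by (simp add: a_def w_def)
      have "84 * w * ((real q)\<^sup>2 * log q M * a) \<le> 672 * w * (v * a * log v m)"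
      proof -
        have "(real q)\<^sup>2 * log q M \<le> 8 * (v * log v m)"
          using q(4) mult_left_mono[OF logM(2), of v] v by linarith
        hence "(84 * w * a) * ((real q)\<^sup>2 * log q M) \<le> (84 * w * a) * (8 * (v * log v m))"
          using w a by (intro mult_left_mono) auto
        thus ?thesis by (simp add: algebra_simps)
      qed
      hence B: "84 * (4 * real k + 49) * ((real q)\<^sup>2 * log q M * log 2 n) \<le> 672 * w * (v * log 2 (real n) * log v (real m))"
        by (simp add: a_def w_def)
      from assms[OF n2] have c: "certificate n (problem {..<n}) (z0 n) (zstep n) (zacc n) (Z n) marks (T n)"
        "card (Z n) \<le> 2 * (n + 1) ^ 2" by auto
      show ?thesis
        by (rule has_relaxed_scheme_mono[OF certificate_scheme[OF c n2 q(1,2) M(2)] _ A B])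
           (unfold M_def, rule graph_streams_min)
    qed
  qed
qed

text \<open>Matchings are checked by the marks alone, odd closed walks by the automaton alone, and
  connectivity by both.\<close>

lemma perfect_matching_certificate:
  assumes "2 \<le> n"
  shows "certificate n (has_perfect_matching {..<n}) () (\<lambda>_ _. ()) (\<lambda>_. True) UNIV pm_marks {..<n}"
proof (rule certificate.intro, goal_cases)
  case (7 E ps)
  show ?case by (rule perfect_matching_sound[OF 7(2,4)])
next
  case (8 E)
  from perfect_matching_complete[OF 8(1) assms 8(2)] show ?case by blast
qed (auto simp: pm_marks_def)

lemma connected_certificate:
  assumes "2 \<le> n"
  shows "certificate n (connected_graph {..<n}) 0 (walk_step n) (\<lambda>z. z \<noteq> n) {..n} walk_marks {1..<n}"
proof (rule certificate.intro, goal_cases)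
  case (7 E ps)
  show ?case by (rule connected_sound[OF 7])
next
  case (8 E)
  from connected_complete[OF 8(1) assms 8(2)] show ?case by blast
qed (auto simp: walk_marks_def split: if_splits)

lemma non_bipartite_certificate:
  "certificate n (non_bipartite {..<n}) (n, n, False) (parity_step n) (\<lambda>(s, z, b). s = z \<and> b)
     ({..n} \<times> {..n} \<times> UNIV) (\<lambda>_. []) {}"
proof (rule certificate.intro, goal_cases)
  case (7 E ps)
  show ?case by (rule non_bipartite_sound[OF 7(1-3)])
next
  case (8 E)
  from non_bipartite_complete[OF 8] show ?case by (auto simp: count_concat_marks)
next
  case (3 z u v c)
  thus ?case by (cases z) auto
qed auto

theorem theorem6p1:
  fixes k :: nat
  shows "\<forall>problem \<in> {has_perfect_matching, connected_graph, non_bipartite}.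
    \<exists>C > 0. \<forall>(n::nat) (m::nat) (c\<^sub>v::real). n \<ge> 1 \<longrightarrow> m \<ge> 2 \<longrightarrow> c\<^sub>v > 1 \<longrightarrow>
      has_relaxed_scheme (graph_streams n m (n ^ k)) (\<lambda>xs. problem {..<n} (stream_edges xs))
        (C * (real n * log 2 (real n)
              + real m * c\<^sub>v powr (- 1/2) * log 2 (real n) * log c\<^sub>v (real m)))
        (C * (c\<^sub>v * log 2 (real n) * log c\<^sub>v (real m)))"
proof -
  have "certificate n (has_perfect_matching {..<n}) () (\<lambda>_ _. ()) (\<lambda>_. True) UNIV pm_marks {..<n} \<and>
    card (UNIV :: unit set) \<le> 2 * (n + 1) ^ 2" if "2 \<le> n" for n
    using perfect_matching_certificate[OF that] by simp
  note pm = scheme_of_certificate_family[where problem = has_perfect_matching, OF this]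
  have "certificate n (connected_graph {..<n}) 0 (walk_step n) (\<lambda>z. z \<noteq> n) {..n} walk_marks {1..<n} \<and>
    card {..n} \<le> 2 * (n + 1) ^ 2" if "2 \<le> n" for n
    using connected_certificate[OF that] by (simp add: power2_eq_square)
  note con = scheme_of_certificate_family[where problem = connected_graph, OF this]
  have "certificate n (non_bipartite {..<n}) (n, n, False) (parity_step n) (\<lambda>(s, z, b). s = z \<and> b)
     ({..n} \<times> {..n} \<times> UNIV) (\<lambda>_. []) {} \<and> card ({..n} \<times> {..n} \<times> (UNIV :: bool set)) \<le> 2 * (n + 1) ^ 2" for n
    using non_bipartite_certificate[of n] by (simp add: card_cartesian_product power2_eq_square)
  note nb = scheme_of_certificate_family[where problem = non_bipartite, OF this]
  show ?thesis using pm[of k] con[of k] nb[of k] by (simp only: ball_simps insert_iff)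
qed

end
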